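(* Assume the Continuum Hypothesis. For every field $K$ of cardinality $\aleph_1$ and every stationary subset $S\subseteq\omega_1$, there is a valuation domain $R$ of cardinality $\aleph_1$ with residue field $K$ and quotient field $Q$, with $Q=\bigcup_{\nu<\omega_1}r_\nu^{-1}R$ for some $r_\nu\in R\setminus\{0\}$ with $r_\mu\mid r_\nu$ for $\mu<\nu$, such that $\Gamma_R(Q/R)=\tilde S$ and there is a non-standard uniserial $R$-module of type $Q/R$.
   Context: Residue field of a valuation domain $R$: $R/P$ with $P$ the maximal ideal. Uniserial: submodules totally ordered. For $R$-submodules $A\subseteq J$ of $Q$, $J/A$ is uniserial; a uniserial module is standard if isomorphic to such a $J/A$, non-standard otherwise. For uniserial $U$ and $0\ne a\in U$, $\mathrm{Ann}(a)=\{r:ra=0\}$, $D(a)=\bigcup\{r^{-1}R: r\text{ divides }a\}$; $U$ has type $Q/R$ if $Q/R\cong D(a)/\mathrm{Ann}(a)$. For $J=\bigcup_{\nu<\omega_1}r_\nu^{-1}R$ and limit $\delta<\omega_1$, $(A:J_\delta)=\bigcap_{\nu<\delta}r_\nu A$ and $R/(A:J_\delta)$ has the linear topology with basic neighborhoods of $0$ the images of $r_\nu A$, $\nu<\delta$. Subsets of $\omega_1$ are equivalent if they agree on a closed unbounded set; $\tilde S$ denotes the class of $S$. $\Gamma_R(J/A)=\tilde S'$ with $S'=\{\delta<\omega_1\text{ limit}: R/(A:J_\delta)\text{ not complete}\}$ (independent of the choice of $r_\nu$). A set $S\subseteq\omega_1$ is stationary if it meets every closed unbounded subset of $\omega_1$.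 *)

theory Defs
  imports "HOL-Algebra.Algebra"
begin

definition aleph1_card :: "'a set \<Rightarrow> bool" where
  "aleph1_card A \<longleftrightarrow> (card_of A, cardSuc natLeq) \<in> ordIso"

definition CH :: bool where
  "CH \<longleftrightarrow> aleph1_card (UNIV :: real set)"

definition w1 :: "nat set rel" where
  "w1 = cardSuc natLeq"

definition w1_less :: "nat set \<Rightarrow> nat set \<Rightarrow> bool" where
  "w1_less a b \<longleftrightarrow> (a, b) \<in> w1 \<and> a \<noteq> b"

definition w1_limit :: "nat set \<Rightarrow> bool" where
  "w1_limit d \<longleftrightarrow> d \<in> Field w1 \<and> (\<exists>a. w1_less a d) \<and>
     (\<forall>a. w1_less a d \<longrightarrow> (\<exists>b. w1_less a b \<and> w1_less b d))"

definition w1_club :: "nat set set \<Rightarrow> bool" where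
  "w1_club C \<longleftrightarrow> C \<subseteq> Field w1
     \<and> (\<forall>a\<in>Field w1. \<exists>c\<in>C. w1_less a c)
     \<and> (\<forall>d. w1_limit d \<longrightarrow> (\<forall>a. w1_less a d \<longrightarrow> (\<exists>c\<in>C. w1_less a c \<and> w1_less c d)) \<longrightarrow> d \<in> C)"

definition w1_stationary :: "nat set set \<Rightarrow> bool" where
  "w1_stationary S \<longleftrightarrow> S \<subseteq> Field w1 \<and> (\<forall>C. w1_club C \<longrightarrow> S \<inter> C \<noteq> {})"

definition w1_equiv :: "nat set set \<Rightarrow> nat set set \<Rightarrow> bool" where
  "w1_equiv S T \<longleftrightarrow> (\<exists>C. w1_club C \<and> S \<inter> C = T \<inter> C)"

definition subR :: "('a, 'b) ring_scheme \<Rightarrow> 'a set \<Rightarrow> ('a, 'b) ring_scheme" where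
  "subR Q Rs = Q\<lparr>carrier := Rs\<rparr>"

definition rdvd :: "('a, 'b) ring_scheme \<Rightarrow> 'a \<Rightarrow> 'a \<Rightarrow> bool" where
  "rdvd R a b \<longleftrightarrow> (\<exists>c\<in>carrier R. b = a \<otimes>\<^bsub>R\<^esub> c)"

definition valuation_domain :: "('a, 'b) ring_scheme \<Rightarrow> bool" where
  "valuation_domain R \<longleftrightarrow> domain R \<and>
     (\<forall>a\<in>carrier R. \<forall>b\<in>carrier R. rdvd R a b \<or> rdvd R b a)"

definition is_quotient_field :: "('a, 'b) ring_scheme \<Rightarrow> 'a set \<Rightarrow> bool" where
  "is_quotient_field Q Rs \<longleftrightarrow> field Q \<and> subring Rs Q \<and>
     (\<forall>q\<in>carrier Q. \<exists>a\<in>Rs. \<exists>b\<in>Rs. b \<noteq> \<zero>\<^bsub>Q\<^esub> \<and> q = a \<otimes>\<^bsub>Q\<^esub> inv\<^bsub>Q\<^esub> b)"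

definition field_module :: "('a, 'b) ring_scheme \<Rightarrow> ('a, 'a) module" where
  "field_module Q = \<lparr>carrier = carrier Q, monoid.mult = monoid.mult Q, monoid.one = \<one>\<^bsub>Q\<^esub>,
     ring.zero = \<zero>\<^bsub>Q\<^esub>, ring.add = ring.add Q, module.smult = monoid.mult Q\<rparr>"

definition quot_mod :: "('r, 'm, 'c) module_scheme \<Rightarrow> 'm set \<Rightarrow> 'm set \<Rightarrow> ('r, 'm set) module" where
  "quot_mod M J A = \<lparr>carrier = (\<lambda>x. A +>\<^bsub>M\<^esub> x) ` J,
     monoid.mult = (\<lambda>B C. B), monoid.one = A,
     ring.zero = A, ring.add = (\<lambda>B C. B <+>\<^bsub>M\<^esub> C),
     module.smult = (\<lambda>r B. A +>\<^bsub>M\<^esub> (r \<odot>\<^bsub>M\<^esub> (SOME x. x \<in> B)))\<rparr>"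

definition mod_iso :: "('r, 'x) ring_scheme \<Rightarrow> ('r, 'm, 'c) module_scheme \<Rightarrow> ('r, 'n, 'd) module_scheme \<Rightarrow> bool" where
  "mod_iso R M N \<longleftrightarrow> (\<exists>f. bij_betw f (carrier M) (carrier N)
     \<and> (\<forall>x\<in>carrier M. \<forall>y\<in>carrier M. f (x \<oplus>\<^bsub>M\<^esub> y) = f x \<oplus>\<^bsub>N\<^esub> f y)
     \<and> (\<forall>r\<in>carrier R. \<forall>x\<in>carrier M. f (r \<odot>\<^bsub>M\<^esub> x) = r \<odot>\<^bsub>N\<^esub> f x))"

definition uniserial :: "('r, 'x) ring_scheme \<Rightarrow> ('r, 'm, 'c) module_scheme \<Rightarrow> bool" where
  "uniserial R U \<longleftrightarrow> module R U \<and>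
     (\<forall>N1 N2. submodule N1 R U \<longrightarrow> submodule N2 R U \<longrightarrow> N1 \<subseteq> N2 \<or> N2 \<subseteq> N1)"

definition standard_uniserial :: "('a, 'b) ring_scheme \<Rightarrow> 'a set \<Rightarrow> ('a, 'm, 'c) module_scheme \<Rightarrow> bool" where
  "standard_uniserial Q Rs U \<longleftrightarrow> uniserial (subR Q Rs) U \<and>
     (\<exists>J A. submodule A (subR Q Rs) (field_module Q) \<and> submodule J (subR Q Rs) (field_module Q)
        \<and> A \<subseteq> J \<and> mod_iso (subR Q Rs) U (quot_mod (field_module Q) J A))"

definition nonstandard_uniserial :: "('a, 'b) ring_scheme \<Rightarrow> 'a set \<Rightarrow> ('a, 'm, 'c) module_scheme \<Rightarrow> bool" where
  "nonstandard_uniserial Q Rs U \<longleftrightarrow> uniserial (subR Q Rs) U \<and> \<not> standard_uniserial Q Rs U"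

definition Ann :: "'a set \<Rightarrow> ('a, 'm, 'c) module_scheme \<Rightarrow> 'm \<Rightarrow> 'a set" where
  "Ann Rs U a = {r\<in>Rs. r \<odot>\<^bsub>U\<^esub> a = \<zero>\<^bsub>U\<^esub>}"

definition Dset :: "('a, 'b) ring_scheme \<Rightarrow> 'a set \<Rightarrow> ('a, 'm, 'c) module_scheme \<Rightarrow> 'm \<Rightarrow> 'a set" where
  "Dset Q Rs U a = (\<Union>{ (\<lambda>s. inv\<^bsub>Q\<^esub> r \<otimes>\<^bsub>Q\<^esub> s) ` Rs | r. r \<in> Rs \<and> (\<exists>b\<in>carrier U. r \<odot>\<^bsub>U\<^esub> b = a)})"

definition has_type_Q_mod_R :: "('a, 'b) ring_scheme \<Rightarrow> 'a set \<Rightarrow> ('a, 'm, 'c) module_scheme \<Rightarrow> bool" where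
  "has_type_Q_mod_R Q Rs U \<longleftrightarrow> (\<exists>a\<in>carrier U. a \<noteq> \<zero>\<^bsub>U\<^esub> \<and>
     mod_iso (subR Q Rs) (quot_mod (field_module Q) (carrier Q) Rs)
                         (quot_mod (field_module Q) (Dset Q Rs U a) (Ann Rs U a)))"

definition colon_ideal :: "('a, 'b) ring_scheme \<Rightarrow> 'a set \<Rightarrow> (nat set \<Rightarrow> 'a) \<Rightarrow> nat set \<Rightarrow> 'a set" where
  "colon_ideal Q Rs r d = Rs \<inter> (\<Inter>nu\<in>{nu. w1_less nu d}. (\<lambda>s. r nu \<otimes>\<^bsub>Q\<^esub> s) ` Rs)"

text \<open>R/(R:Q_delta) complete in the linear topology with basic neighbourhoods of 0 the images
  of r_nu R (nu < delta): every compatible family of cosets (a Cauchy net indexed by the basis)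
  has a limit.\<close>
definition complete_at :: "('a, 'b) ring_scheme \<Rightarrow> 'a set \<Rightarrow> (nat set \<Rightarrow> 'a) \<Rightarrow> nat set \<Rightarrow> bool" where
  "complete_at Q Rs r d \<longleftrightarrow>
     (\<forall>x. (\<forall>nu. w1_less nu d \<longrightarrow> x nu \<in> Rs) \<longrightarrow>
          (\<forall>mu nu. w1_less mu nu \<and> w1_less nu d \<longrightarrow> x nu \<ominus>\<^bsub>Q\<^esub> x mu \<in> (\<lambda>s. r mu \<otimes>\<^bsub>Q\<^esub> s) ` Rs) \<longrightarrow>
          (\<exists>y\<in>Rs. \<forall>nu. w1_less nu d \<longrightarrow> y \<ominus>\<^bsub>Q\<^esub> x nu \<in> (\<lambda>s. r nu \<otimes>\<^bsub>Q\<^esub> s) ` Rs))"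

definition Gamma_set :: "('a, 'b) ring_scheme \<Rightarrow> 'a set \<Rightarrow> (nat set \<Rightarrow> 'a) \<Rightarrow> nat set set" where
  "Gamma_set Q Rs r = {d. w1_limit d \<and> \<not> complete_at Q Rs r d}"

end

theory Submission
  imports Defs "HOL-Library.Poly_Mapping" "HOL-Library.Dual_Ordered_Lattice"
    "HOL-Analysis.Abstract_Topology_2"
begin

text \<open>
  Let \<open>G\<close> be the group of finitely supported functions \<open>\<omega>1 \<rightarrow> \<int>\<close>, ordered by the largest index at which two
  functions differ, with basis \<open>e \<alpha>\<close> and convex subgroups \<open>G \<delta>\<close> spanned by the \<open>e \<alpha>\<close>, \<open>\<alpha> < \<delta>\<close>. The
  field \<open>Q\<close> consists of the Hahn series over \<open>K\<close> whose support lies in some \<open>G \<nu>\<close> and, for limit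
  \<open>\<delta> \<in> S\<close>, meets each coset of \<open>G \<delta>\<close> in a subset of one coset of some \<open>G \<nu>\<close>, \<open>\<nu> < \<delta>\<close>. Let \<open>R\<close> be its
  valuation ring and \<open>r \<nu> = X^(e \<nu>)\<close>. Cauchy families below \<open>\<delta>\<close> can be glued if \<open>\<delta> \<notin> S\<close>, whereas for
  \<open>\<delta> \<in> S\<close> the sum of \<open>X^(e \<delta>_n)\<close> over a sequence \<open>\<delta>_n\<close> cofinal in \<open>\<delta>\<close> has no limit in \<open>R\<close>.

  Take finite-to-one functions \<open>v \<nu> : \<nu> \<rightarrow> \<omega>\<close>, any two of which agree up to finitely many arguments, and
  distinct scalars \<open>c i\<close>; let \<open>u \<nu>\<close> be the product of the \<open>1 + c (v \<nu> \<alpha>) X^(e \<alpha>)\<close>, \<open>\<alpha> < \<nu>\<close>. By coherence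
  \<open>u \<mu>\<close> is a unit of \<open>R\<close> times \<open>u \<nu>\<close> modulo \<open>X^(e \<mu>)\<close>, so the \<open>X^(- e \<nu>) u \<nu>\<close>, modulo series with
  nonnegative exponents, generate a uniserial \<open>R\<close>-module of type \<open>Q/R\<close>. If it were standard there would be
  units \<open>d \<nu>\<close> of \<open>R\<close> with \<open>d \<mu> u \<nu>\<close> congruent to \<open>d \<nu> u \<mu>\<close> modulo \<open>X^(e \<mu>)\<close>. For \<open>\<delta> \<in> S\<close> the part of
  \<open>d \<delta>\<close> in \<open>G \<delta>\<close> lives in some \<open>G \<gamma>\<close>, \<open>\<gamma> < \<delta>\<close>, and by pressing down one \<open>\<gamma>\<close> serves unboundedly many
  \<open>\<delta>\<close>. Comparing coefficients at \<open>e \<alpha>\<close>, the corresponding \<open>v \<delta>\<close> agree above \<open>\<gamma>\<close>; glued together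
  they have an infinite fibre below one of the \<open>\<delta>\<close>, a contradiction.

  As \<open>K\<close> is only a ring record, coefficients are taken in the free commutative ring on the type of \<open>K\<close> and
  all statements are read modulo the kernel \<open>I\<close> of its evaluation onto \<open>K\<close>. The Continuum Hypothesis
  makes the set of series small enough to be transported into that type.
\<close>

section \<open>The first uncountable ordinal\<close>

lemma Card_order_w1: "Card_order w1"
  unfolding w1_def by (intro cardSuc_Card_order natLeq_Card_order)

lemma Well_order_w1: "Well_order w1"
  using Card_order_w1 unfolding card_order_on_def by blast

lemma Field_w1_ordIso: "|Field w1| =o w1"
  using Card_order_w1 by (rule card_of_Field_ordIso)

lemma card_le_natLeq_iff: "|A| \<le>o natLeq \<longleftrightarrow> countable A"
proof -
  have "|A| \<le>o natLeq \<longleftrightarrow> |A| \<le>o |UNIV :: nat set|"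
    using card_of_nat ordIso_symmetric ordLeq_ordIso_trans by blast
  also have "\<dots> \<longleftrightarrow> countable A"
    unfolding countable_def card_of_ordLeq[symmetric] by simp
  finally show ?thesis .
qed

lemma uncountable_Field_w1: "uncountable (Field w1)"
proof
  assume "countable (Field w1)"
  then have "w1 \<le>o natLeq"
    using card_le_natLeq_iff Field_w1_ordIso ordIso_symmetric ordIso_ordLeq_trans by blast
  moreover have "natLeq <o w1"
    unfolding w1_def by (intro cardSuc_greater natLeq_Card_order)
  ultimately show False
    using not_ordLess_ordLeq by blast
qed

lemma countable_less_w1:
  assumes "a \<in> Field w1" shows "countable {b. w1_less b a}"
proof -
  have "|underS w1 a| <o w1"
    using card_of_underS[OF Card_order_w1 assms] .
  then have "|underS w1 a| \<le>o natLeq"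
    unfolding w1_def using cardSuc_ordLeq_ordLess[OF natLeq_Card_order card_of_Card_order] by blast
  moreover have "underS w1 a = {b. w1_less b a}"
    unfolding underS_def w1_less_def by auto
  ultimately show ?thesis
    using card_le_natLeq_iff by metis
qed

text \<open>Copying the field of \<open>w1\<close> into a type of class \<open>wellorder\<close>
  makes \<open>LEAST\<close>, initial segments and well-founded recursion available;
  \<open>Rep_omega1\<close> carries the results back to \<open>w1_less\<close>.\<close>

typedef omega1 = "Field w1"
  using uncountable_Field_w1 by (metis countable_empty ex_in_conv)

lemma Rep_omega1_Field [simp]: "Rep_omega1 a \<in> Field w1"
  by (rule Rep_omega1)

instantiation omega1 :: wellorder
begin

definition less_eq_omega1 :: "omega1 \<Rightarrow> omega1 \<Rightarrow> bool" where
  "a \<le> b \<longleftrightarrow> (Rep_omega1 a, Rep_omega1 b) \<in> w1"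

definition less_omega1 :: "omega1 \<Rightarrow> omega1 \<Rightarrow> bool" where
  "a < b \<longleftrightarrow> w1_less (Rep_omega1 a) (Rep_omega1 b)"

instance
proof
  have lin: "Linear_order w1" and wf: "wf (w1 - Id)"
    using Well_order_w1 unfolding well_order_on_def by auto
  have r: "Refl w1" and t: "trans w1" and an: "antisym w1" and tot: "Total w1"
    using lin unfolding linear_order_on_def partial_order_on_def preorder_on_def by auto
  fix x y z :: omega1
  show "x < y \<longleftrightarrow> x \<le> y \<and> \<not> y \<le> x"
    unfolding less_eq_omega1_def less_omega1_def w1_less_def
    using an by (metis Rep_omega1_Field antisymD r refl_onD)
  show "x \<le> x"
    unfolding less_eq_omega1_def using r by (simp add: refl_onD)
  show "x \<le> z" if "x \<le> y" "y \<le> z"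
    using that t unfolding less_eq_omega1_def by (meson transD)
  show "x = y" if "x \<le> y" "y \<le> x"
    using that an unfolding less_eq_omega1_def by (meson antisymD Rep_omega1_inject)
  show "x \<le> y \<or> y \<le> x"
    unfolding less_eq_omega1_def using tot r
    by (metis Rep_omega1_Field refl_onD total_on_def)
  show "P a" if step: "\<And>x. (\<And>y. y < x \<Longrightarrow> P y) \<Longrightarrow> P x" for P and a :: omega1
  proof -
    have "wf {(x, y). (Rep_omega1 x, Rep_omega1 y) \<in> w1 - Id}"
      using wf_inv_image[OF wf, of Rep_omega1] unfolding inv_image_def by simp
    then show ?thesis
      by (induction a rule: wf_induct_rule) (auto intro: step simp: less_omega1_def w1_less_def)
  qed
qed

end

lemma w1_less_Rep [simp]: "w1_less (Rep_omega1 a) (Rep_omega1 b) \<longleftrightarrow> a < b"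
  by (simp add: less_omega1_def)

lemma w1_less_FieldD: "w1_less a b \<Longrightarrow> a \<in> Field w1 \<and> b \<in> Field w1"
  unfolding w1_less_def by (auto simp: Field_def)

lemma all_less_w1: "(\<forall>b. w1_less b (Rep_omega1 a) \<longrightarrow> P b) \<longleftrightarrow> (\<forall>b<a. P (Rep_omega1 b))"
  by (metis Rep_omega1_cases w1_less_FieldD w1_less_Rep)

lemma ex_less_w1: "(\<exists>b. w1_less b (Rep_omega1 a) \<and> P b) \<longleftrightarrow> (\<exists>b<a. P (Rep_omega1 b))"
  by (metis Rep_omega1_cases w1_less_FieldD w1_less_Rep)

lemma countable_lessThan_omega1 [simp]: "countable {..<a::omega1}"
proof -
  have "Rep_omega1 ` {..<a} \<subseteq> {b. w1_less b (Rep_omega1 a)}"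
    by auto
  then have "countable (Rep_omega1 ` {..<a})"
    using countable_less_w1[of "Rep_omega1 a"] countable_subset by auto
  then show ?thesis
    using countable_image_inj_on[of Rep_omega1] by (meson Rep_omega1_inject inj_on_def)
qed

lemma countable_atMost_omega1 [simp]: "countable {..a::omega1}"
  by (simp add: ivl_disj_un(2)[symmetric])

lemma uncountable_omega1: "uncountable (UNIV :: omega1 set)"
proof
  assume "countable (UNIV :: omega1 set)"
  then have "countable (range Rep_omega1)" by simp
  then show False
    using uncountable_Field_w1 by (simp add: type_definition.Rep_range[OF type_definition_omega1])
qed

text \<open>Otherwise \<open>omega1\<close> would be a union of countably many countable initial
  segments.\<close>

lemma countable_bounded_omega1:
  assumes "countable (Y :: omega1 set)"
  obtains b where "\<And>x. x \<in> Y \<Longrightarrow> x < b"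
proof (rule ccontr)
  assume "\<not> thesis"
  then have "\<forall>b. \<exists>x\<in>Y. b \<le> x" using that not_less by blast
  then have "(UNIV :: omega1 set) \<subseteq> (\<Union>x\<in>Y. {..x})" by auto
  moreover have "countable (\<Union>x\<in>Y. {..x})" using assms by simp
  ultimately show False using uncountable_omega1 countable_subset by blast
qed

lemma greater_omega1: "\<exists>b. (a::omega1) < b"
  by (metis countable_bounded_omega1 countable_atMost_omega1 atMost_iff order_refl)

section \<open>Limit ordinals, closed unbounded sets and pressing down\<close>

definition limit_ord :: "omega1 \<Rightarrow> bool" where
  "limit_ord d \<longleftrightarrow> (\<exists>a. a < d) \<and> (\<forall>a<d. \<exists>b. a < b \<and> b < d)"

lemma w1_limit_Rep [simp]: "w1_limit (Rep_omega1 d) \<longleftrightarrow> limit_ord d"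
proof -
  have *: "(\<exists>a. w1_less a (Rep_omega1 d)) \<longleftrightarrow> (\<exists>a. a < d)"
    using ex_less_w1[of d "\<lambda>_. True"] by simp
  have **: "(\<exists>b. w1_less (Rep_omega1 a) b \<and> w1_less b (Rep_omega1 d)) \<longleftrightarrow> (\<exists>b. a < b \<and> b < d)" for a
    using ex_less_w1[of d "\<lambda>b. w1_less (Rep_omega1 a) b"] by auto
  show ?thesis
    unfolding w1_limit_def limit_ord_def all_less_w1 * ** by simp
qed

text \<open>Only countably many ordinals lie below \<open>d\<close>; an increasing sequence that
  passes the \<open>n\<close>-th of them at step \<open>n\<close> is cofinal.\<close>

lemma limit_ord_cofinal:
  assumes "limit_ord d"
  obtains c :: "nat \<Rightarrow> omega1"
  where "strict_mono c" "\<And>n. c n < d" "\<And>a. a < d \<Longrightarrow> \<exists>n. a < c n"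
proof -
  have ne: "{..<d} \<noteq> {}" using assms by (auto simp: limit_ord_def)
  define en where "en = from_nat_into {..<d}"
  have en: "en n < d" for n using from_nat_into[OF ne, of n] by (simp add: en_def)
  have ens: "\<exists>n. en n = a" if "a < d" for a
    using that from_nat_into_surj[OF countable_lessThan_omega1, of a d] by (auto simp: en_def)
  have nx: "\<exists>y. y < d \<and> x < y \<and> en n < y" if "x < d" for x n
    using assms that en[of n] unfolding limit_ord_def
    by (metis max_less_iff_conj max_def)
  define P where "P \<equiv> \<lambda>(n::nat) x. x < d \<and> en n < x"
  have "\<exists>c. \<forall>n. P n (c n) \<and> c n < c (Suc n)"
  proof (rule dependent_nat_choice)
    show "\<exists>x. P 0 x" using nx[OF en[of 0]] by (auto simp: P_def)
    show "\<exists>y. P (Suc n) y \<and> x < y" if "P n x" for x n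
      using nx[of x "Suc n"] that by (auto simp: P_def)
  qed
  then obtain c where c: "\<And>n. P n (c n)" "\<And>n. c n < c (Suc n)" by blast
  show thesis
  proof (rule that[of c])
    show "strict_mono c" by (simp add: c(2) strict_mono_Suc_iff)
    show "c n < d" for n using c(1)[of n] by (simp add: P_def)
    show "\<exists>n. a < c n" if "a < d" for a
      using ens[OF that] c(1) by (auto simp: P_def)
  qed
qed

text \<open>Closing off: each step of a sequence of length \<omega> passes all values of
  \<open>b\<close> on the countable segment reached so far, and \<open>d\<close> is the
  supremum.\<close>

lemma closure_limit_ord:
  fixes b :: "omega1 \<Rightarrow> omega1"
  obtains d where "a < d" "limit_ord d" "\<And>x. x < d \<Longrightarrow> b x < d"
proof -
  have nx: "\<exists>y. x < y \<and> (\<forall>z\<le>x. b z < y)" for x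
  proof -
    have "countable (insert x (b ` {..x}))" by simp
    then obtain y where "\<And>z. z \<in> insert x (b ` {..x}) \<Longrightarrow> z < y"
      using countable_bounded_omega1 by blast
    then show ?thesis by auto
  qed
  \<comment> \<open>The clause at \<open>n = 0\<close> pins the start of the sequence to
    \<open>a\<close>.\<close>
  then have "\<exists>c :: nat \<Rightarrow> omega1. \<forall>n. (if n = 0 then c n = a else True) \<and> (c n < c (Suc n) \<and> (\<forall>z\<le>c n. b z < c (Suc n)))"
    by (intro dependent_nat_choice) auto
  then obtain c where c0: "c 0 = a" and c: "\<And>n. c n < c (Suc n)" "\<And>n z. z \<le> c n \<Longrightarrow> b z < c (Suc n)"
    by (metis (full_types))
  obtain y where y: "\<And>x. x \<in> range c \<Longrightarrow> x < y"
    using countable_bounded_omega1[of "range c"] by auto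
  define d where "d = (LEAST y. \<forall>n. c n < y)"
  have d: "c n < d" for n
    unfolding d_def by (rule LeastI2[of _ y]) (use y in auto)
  have dl: "\<exists>n. x \<le> c n" if "x < d" for x
    using not_less_Least[OF that[unfolded d_def]] by (auto simp: not_less)
  have dl': "\<exists>n. x < c n" if "x < d" for x
    using dl[OF that] c(1) le_less_trans by blast
  show thesis
  proof (rule that[of d])
    show "a < d" using d[of 0] c0 by simp
    show "limit_ord d" unfolding limit_ord_def using d dl' by blast
    show "b x < d" if "x < d" for x
      using dl[OF that] c(2) d less_trans by blast
  qed
qed

text \<open>Unboundedness is \<open>closure_limit_ord\<close>. For closedness, any
  \<open>x < d\<close> lies below a member \<open>c < d\<close> of the set, and then
  \<open>b x < c < d\<close>.\<close>

lemma w1_club_closure: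
  fixes b :: "omega1 \<Rightarrow> omega1"
  shows "w1_club (Rep_omega1 ` {d. limit_ord d \<and> (\<forall>x<d. b x < d)})" (is "w1_club ?C")
  unfolding w1_club_def
proof (intro conjI ballI allI impI)
  show "?C \<subseteq> Field w1" by auto
  show "\<exists>c\<in>?C. w1_less a c" if "a \<in> Field w1" for a
  proof -
    obtain a' where a': "a = Rep_omega1 a'" using Rep_omega1_cases[OF \<open>a \<in> Field w1\<close>] by blast
    obtain d where "a' < d" "limit_ord d" "\<And>x. x < d \<Longrightarrow> b x < d"
      using closure_limit_ord[of a' b] by blast
    then show ?thesis unfolding a' by (intro bexI[of _ "Rep_omega1 d"]) auto
  qed
  fix d assume d: "w1_limit d"
    and cof: "\<forall>a. w1_less a d \<longrightarrow> (\<exists>c\<in>?C. w1_less a c \<and> w1_less c d)"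
  obtain d' where d': "d = Rep_omega1 d'" using d Rep_omega1_cases by (auto simp: w1_limit_def)
  have "b x < d'" if "x < d'" for x
    using cof that unfolding d' all_less_w1
    by (force simp: image_iff intro: less_trans)
  then show "d \<in> ?C" using d unfolding d' by auto
qed

lemma w1_club_limit: "w1_club {d. w1_limit d}"
proof -
  have "Rep_omega1 ` {d. limit_ord d \<and> (\<forall>x<d. x < d)} = {d. w1_limit d}"
  proof (intro equalityI subsetI)
    fix d assume d: "d \<in> {d. w1_limit d}"
    then obtain e where "d = Rep_omega1 e" using Rep_omega1_cases by (auto simp: w1_limit_def)
    then show "d \<in> Rep_omega1 ` {d. limit_ord d \<and> (\<forall>x<d. x < d)}" using d by auto
  qed auto
  then show ?thesis using w1_club_closure[of "\<lambda>x. x"] by simp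
qed

text \<open>If every fibre of \<open>f\<close> were bounded, say the fibre of \<open>c\<close> by
  \<open>b c\<close>, then a point \<open>d\<close> of \<open>S\<close> in the club of limits closed
  under \<open>b\<close> would satisfy \<open>f d < d\<close> and hence
  \<open>d \<le> b (f d) < d\<close>. This is Fodor's lemma with an unbounded fibre in place of a
  stationary one.\<close>

lemma pressing_down:
  fixes f :: "omega1 \<Rightarrow> omega1"
  assumes S: "w1_stationary S"
    and f: "\<And>d. Rep_omega1 d \<in> S \<Longrightarrow> limit_ord d \<Longrightarrow> f d < d"
  obtains c where "\<And>a. \<exists>d>a. Rep_omega1 d \<in> S \<and> limit_ord d \<and> f d = c"
proof (rule ccontr)
  assume "\<not> thesis"
  then have "\<forall>c. \<exists>a. \<forall>d. Rep_omega1 d \<in> S \<and> limit_ord d \<and> f d = c \<longrightarrow> d \<le> a"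
    using that not_le by metis
  then obtain b where b: "\<And>c d. Rep_omega1 d \<in> S \<Longrightarrow> limit_ord d \<Longrightarrow> f d = c \<Longrightarrow> d \<le> b c"
    by metis
  have "S \<inter> Rep_omega1 ` {d. limit_ord d \<and> (\<forall>x<d. b x < d)} \<noteq> {}"
    using S w1_club_closure[of b] by (auto simp: w1_stationary_def)
  then obtain d where d: "Rep_omega1 d \<in> S" "limit_ord d" "\<And>x. x < d \<Longrightarrow> b x < d"
    by auto
  then show False
    using f[OF d(1,2)] b[OF d(1,2) refl] by (metis leD)
qed

text \<open>The value of \<open>v \<nu>\<close> at \<open>\<alpha>\<close> is taken from the first \<open>v (\<mu> i)\<close> defined at \<open>\<alpha>\<close>, where \<open>\<mu> 0, \<mu> 1, \<dots>\<close>
  enumerates the predecessors of \<open>\<nu>\<close>; the maximum with \<open>i\<close> keeps it finite-to-one.\<close>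

lemma coherent_finite_to_one:
  "\<exists>v :: omega1 \<Rightarrow> omega1 \<Rightarrow> nat. (\<forall>n k. finite {a. a < n \<and> v n a \<le> k}) \<and>
     (\<forall>m n. m \<le> n \<longrightarrow> finite {a. a < m \<and> v m a \<noteq> v n a})"
proof -
  define mu where "mu n = from_nat_into {..<n::omega1}" for n
  define ix where "ix n a = (LEAST i. a \<le> mu n i)" for n a :: omega1
  define v where "v = wfrec {(x, y). x < y} (\<lambda>v n a. if a < n then max (v (mu n (ix n a)) a) (ix n a) else 0)"
  have mu_less: "mu n i < n" if "a < n" for n a i
  proof -
    have "{..<n} \<noteq> {}" using that by auto
    then show ?thesis using from_nat_into[of "{..<n}" i] by (simp add: mu_def)
  qed
  have mu_surj: "\<exists>i. mu n i = a" if "a < n" for n a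
    using that from_nat_into_surj[OF countable_lessThan_omega1, of a n] by (auto simp: mu_def)
  have v: "v n a = (if a < n then max (v (mu n (ix n a)) a) (ix n a) else 0)" for n a
    unfolding v_def
    by (subst wfrec[OF wf]) (auto simp: cut_apply mu_less)
  have ix: "a \<le> mu n (ix n a)" "mu n i = b \<Longrightarrow> a \<le> b \<Longrightarrow> ix n a \<le> i" if an: "a < n" for n a i b
  proof -
    obtain j where "mu n j = a" using mu_surj[OF an] by blast
    then show "a \<le> mu n (ix n a)" unfolding ix_def by (intro LeastI) auto
    show "ix n a \<le> i" if "mu n i = b" "a \<le> b" unfolding ix_def by (intro Least_le) (use that in auto)
  qed
  \<comment> \<open>The point \<open>a = n\<close>, where \<open>v n\<close> has its default value
    0, is included because \<open>v (mu n i)\<close> is also read at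
    \<open>a = mu n i\<close>.\<close>
  have fin1: "finite {a. a \<le> n \<and> v n a \<le> k}" for n k
  proof (induction n rule: less_induct)
    case (less n)
    have "{a. a \<le> n \<and> v n a \<le> k} \<subseteq> insert n (\<Union>i\<le>k. {a. a \<le> mu n i \<and> mu n i < n \<and> v (mu n i) a \<le> k})"
    proof
      fix a assume a: "a \<in> {a. a \<le> n \<and> v n a \<le> k}"
      show "a \<in> insert n (\<Union>i\<le>k. {a. a \<le> mu n i \<and> mu n i < n \<and> v (mu n i) a \<le> k})"
      proof (cases "a < n")
        case True
        then show ?thesis using a ix(1)[OF True] v[of n a] mu_less[OF True] by auto
      qed (use a in auto)
    qed
    moreover have "finite {a. a \<le> mu n i \<and> mu n i < n \<and> v (mu n i) a \<le> k}" for i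
      using less.IH[of "mu n i"] by (cases "mu n i < n") auto
    ultimately show ?case using finite_subset by (metis (no_types, lifting) finite_UN finite_atMost finite_insert)
  qed
  have fin2: "finite {a. a < m \<and> v m a \<noteq> v n a}" if "m \<le> n" for m n
    using that
  proof (induction n arbitrary: m rule: less_induct)
    case (less n)
    show ?case
    proof (cases "m = n")
      case False
      then have mn: "m < n" using less.prems by simp
      obtain j where j: "mu n j = m" using mu_surj[OF mn] by blast
      \<comment> \<open>For \<open>i = ix n a\<close>, a disagreement of \<open>v m\<close> and
        \<open>v n\<close> at \<open>a\<close> has three possible causes: \<open>v m\<close> and
        \<open>v (mu n i)\<close> disagree there, the maximum with \<open>i\<close> raised the
        value, or \<open>a = mu n i\<close>. Only indices up to that of \<open>m\<close>
        occur.\<close>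
      let ?D = "\<lambda>i. {a. a < m \<and> a < mu n i \<and> v m a \<noteq> v (mu n i) a} \<union> {a. a \<le> mu n i \<and> v (mu n i) a \<le> i} \<union> {mu n i}"
      have "{a. a < m \<and> v m a \<noteq> v n a} \<subseteq> (\<Union>i\<le>j. ?D i)"
      proof
        fix a assume "a \<in> {a. a < m \<and> v m a \<noteq> v n a}"
        then have a: "a < m" "v m a \<noteq> v n a" by auto
        then have an: "a < n" using mn by auto
        have i: "ix n a \<le> j" using ix(2)[OF an j] a by simp
        have "a \<in> ?D (ix n a)"
          using a ix(1)[OF an] v[of n a] an by auto
        then show "a \<in> (\<Union>i\<le>j. ?D i)" using i by blast
      qed
      moreover have "finite (?D i)" for i
      proof -
        have "finite {a. a < m \<and> a < mu n i \<and> v m a \<noteq> v (mu n i) a}"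
        proof (cases "m \<le> mu n i")
          case True
          then show ?thesis using less.IH[OF mu_less[OF mn] True] by (rule_tac finite_subset) auto
        next
          case False
          then have "finite {a. a < mu n i \<and> v (mu n i) a \<noteq> v m a}"
            using less.IH[OF mn, of "mu n i"] by simp
          then show ?thesis by (rule rev_finite_subset) auto
        qed
        then show ?thesis using fin1 by simp
      qed
      ultimately show ?thesis using finite_subset by (metis (no_types, lifting) finite_UN finite_atMost)
    qed simp
  qed
  show ?thesis
  proof (intro exI[of _ v] conjI allI impI)
    show "finite {a. a < n \<and> v n a \<le> k}" for n k
      by (rule finite_subset[OF _ fin1[of n k]]) auto
  qed (fact fin2)
qed

section \<open>Hahn series with coefficients in a commutative ring\<close>

definition wos :: "'g::linorder set \<Rightarrow> bool" where
  "wos A \<longleftrightarrow> (\<forall>B\<subseteq>A. B \<noteq> {} \<longrightarrow> (\<exists>m\<in>B. \<forall>b\<in>B. m \<le> b))"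

lemma wosD: "wos A \<Longrightarrow> B \<subseteq> A \<Longrightarrow> B \<noteq> {} \<Longrightarrow> \<exists>m\<in>B. \<forall>b\<in>B. m \<le> b"
  unfolding wos_def by blast

lemma wos_subset: "wos A \<Longrightarrow> B \<subseteq> A \<Longrightarrow> wos B"
  unfolding wos_def by (meson subset_trans)

lemma wosI_seq:
  assumes "\<And>s. range s \<subseteq> A \<Longrightarrow> (\<And>n. s (Suc n) < s n) \<Longrightarrow> False"
  shows "wos A"
  unfolding wos_def
proof (intro allI impI)
  fix B assume B: "B \<subseteq> A" "B \<noteq> {}"
  show "\<exists>m\<in>B. \<forall>b\<in>B. m \<le> b"
  proof (rule ccontr)
    assume "\<not> ?thesis"
    then have "\<forall>m\<in>B. \<exists>b\<in>B. b < m" by (meson not_less)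
    then have "\<exists>s. \<forall>n::nat. s n \<in> B \<and> s (Suc n) < s n"
      using B(2) by (intro dependent_nat_choice) auto
    then show False using assms B(1) by (metis image_subsetI subsetD)
  qed
qed

text \<open>Every sequence has a monotone subsequence; a nonincreasing one reaches its minimum in
  the well-ordered set and is constant from there on, so its tail serves.\<close>

lemma wos_mono_subseq:
  assumes "wos A" "range s \<subseteq> A"
  obtains f :: "nat \<Rightarrow> nat" where "strict_mono f" "mono (\<lambda>n. s (f n))"
proof -
  obtain f :: "nat \<Rightarrow> nat" where f: "strict_mono f" "monoseq (\<lambda>n. s (f n))"
    using seq_monosub by blast
  consider "mono (\<lambda>n. s (f n))" | "antimono (\<lambda>n. s (f n))"
    using f(2) monoseq_iff by blast
  then show thesis
  proof cases
    case 1
    then show thesis using that f(1) by blast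
  next
    case 2
    have "range (\<lambda>n. s (f n)) \<subseteq> A" using assms(2) by auto
    then obtain m where m: "m \<in> range (\<lambda>n. s (f n))" "\<forall>b\<in>range (\<lambda>n. s (f n)). m \<le> b"
      using wosD[OF assms(1)] by blast
    then obtain N where N: "m = s (f N)" by blast
    have "s (f (n + N)) = m" for n
      using m(2) antimonoD[OF 2, of N "n + N"] N by (metis le_add2 order_antisym rangeI)
    then have "mono (\<lambda>n. s (f (n + N)))" by (simp add: monoI)
    moreover have "strict_mono (\<lambda>n. f (n + N))"
      using f(1) by (simp add: strict_mono_def)
    ultimately show thesis using that by blast
  qed
qed

lemma wos_mono_subseq2:
  assumes "wos A" "wos B" "range s \<subseteq> A" "range t \<subseteq> B"
  obtains f :: "nat \<Rightarrow> nat" where "strict_mono f" "mono (\<lambda>n. s (f n))" "mono (\<lambda>n. t (f n))"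
proof -
  obtain f :: "nat \<Rightarrow> nat" where f: "strict_mono f" "mono (\<lambda>n. s (f n))"
    using wos_mono_subseq[OF assms(1,3)] .
  have "range (\<lambda>n. t (f n)) \<subseteq> B" using assms(4) by auto
  then obtain h :: "nat \<Rightarrow> nat" where h: "strict_mono h" "mono (\<lambda>n. t (f (h n)))"
    using wos_mono_subseq[OF assms(2)] by blast
  show thesis
  proof (rule that[of "\<lambda>n. f (h n)"])
    show "strict_mono (\<lambda>n. f (h n))" using f(1) h(1) by (simp add: strict_mono_def)
    show "mono (\<lambda>n. s (f (h n)))"
      using f(2) h(1) unfolding mono_def by (simp add: strict_mono_less_eq)
  qed (fact h(2))
qed

lemma wos_Un:
  assumes "wos A" "wos B" shows "wos (A \<union> B)"
  unfolding wos_def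
proof (intro allI impI)
  fix C assume C: "C \<subseteq> A \<union> B" "C \<noteq> {}"
  have 1: "C \<inter> A \<noteq> {} \<Longrightarrow> \<exists>m\<in>C \<inter> A. \<forall>b\<in>C \<inter> A. m \<le> b" by (rule wosD[OF assms(1)]) auto
  have 2: "C \<inter> B \<noteq> {} \<Longrightarrow> \<exists>m\<in>C \<inter> B. \<forall>b\<in>C \<inter> B. m \<le> b" by (rule wosD[OF assms(2)]) auto
  show "\<exists>m\<in>C. \<forall>b\<in>C. m \<le> b"
  proof (cases "C \<inter> A = {} \<or> C \<inter> B = {}")
    case True
    then have "C \<inter> A = C \<or> C \<inter> B = C" using C(1) by auto
    then show ?thesis using 1 2 C(2) by (metis)
  next
    case False
    obtain m where m: "m \<in> C \<inter> A" "\<forall>b\<in>C \<inter> A. m \<le> b" using 1 False by meson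
    obtain n where n: "n \<in> C \<inter> B" "\<forall>b\<in>C \<inter> B. n \<le> b" using 2 False by meson
    have "\<forall>b\<in>C. min m n \<le> b"
      using C(1) m(2) n(2) by (metis Int_iff UnE min.coboundedI1 min.coboundedI2 subsetD)
    moreover have "min m n \<in> C" using m n by (simp add: min_def)
    ultimately show ?thesis by blast
  qed
qed

lemma wos_singleton [simp]: "wos {a}" and wos_empty [simp]: "wos {}"
  unfolding wos_def by auto

text \<open>Along a common subsequence both summands are nondecreasing, so the sums cannot
  descend.\<close>

lemma wos_plus:
  fixes A B :: "'g::linordered_ab_group_add set"
  assumes "wos A" "wos B" shows "wos {a + b |a b. a \<in> A \<and> b \<in> B}"
proof (rule wosI_seq)
  fix s assume r: "range s \<subseteq> {a + b |a b. a \<in> A \<and> b \<in> B}" and d: "\<And>n. s (Suc n) < s n"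
  have "s n \<in> {a + b |a b. a \<in> A \<and> b \<in> B}" for n
    using r by blast
  then have "\<forall>n. \<exists>a b. s n = a + b \<and> a \<in> A \<and> b \<in> B"
    by blast
  then obtain a b where ab: "\<And>n. s n = a n + b n" "\<And>n. a n \<in> A" "\<And>n. b n \<in> B"
    by metis
  have "range a \<subseteq> A" "range b \<subseteq> B" using ab by auto
  then obtain f :: "nat \<Rightarrow> nat" where f: "strict_mono f" "mono (\<lambda>n. a (f n))" "mono (\<lambda>n. b (f n))"
    by (rule wos_mono_subseq2[OF assms])
  have "s (f 0) \<le> s (f 1)"
    unfolding ab(1) using f(2,3) by (intro add_mono) (auto simp: mono_def)
  moreover have "s (f 1) < s (f 0)"
    using f(1) d lift_Suc_mono_less[of "\<lambda>n. - s n" "f 0" "f 1"] by (simp add: strict_mono_def)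
  ultimately show False by simp
qed

text \<open>With infinitely many decompositions, \<open>a\<close> and \<open>g - a\<close> would
  both be nondecreasing along an injective sequence of values of \<open>a\<close>. This finiteness
  gives sense to the convolution of series.\<close>

lemma finite_decomp:
  fixes A B :: "'g::linordered_ab_group_add set"
  assumes "wos A" "wos B" shows "finite {a \<in> A. g - a \<in> B}"
proof (rule ccontr)
  assume "infinite {a \<in> A. g - a \<in> B}"
  then obtain s :: "nat \<Rightarrow> 'g" where s: "inj s" "range s \<subseteq> {a \<in> A. g - a \<in> B}"
    using infinite_countable_subset by blast
  then have "range s \<subseteq> A" "range (\<lambda>n. g - s n) \<subseteq> B" by auto
  then obtain f :: "nat \<Rightarrow> nat" where f: "strict_mono f" "mono (\<lambda>n. s (f n))" "mono (\<lambda>n. g - s (f n))"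
    by (rule wos_mono_subseq2[OF assms])
  have "s (f 0) \<le> s (f 1)" "g - s (f 0) \<le> g - s (f 1)"
    using f(2,3) by (auto simp: mono_def)
  then have "s (f 0) = s (f 1)" by simp
  then have "f 0 = f 1" using s(1) by (simp add: inj_eq)
  then show False using f(1) by (simp add: strict_mono_eq)
qed

definition monoid_gen :: "'g::comm_monoid_add set \<Rightarrow> 'g set" where
  "monoid_gen A = {sum_list xs |xs. set xs \<subseteq> A}"

lemma zero_monoid_gen [simp]: "0 \<in> monoid_gen A"
  unfolding monoid_gen_def by (auto intro: exI[of _ "[]"])

lemma monoid_gen_add: "a \<in> A \<Longrightarrow> b \<in> monoid_gen A \<Longrightarrow> a + b \<in> monoid_gen A"
proof -
  assume a: "a \<in> A" and "b \<in> monoid_gen A"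
  then obtain xs where "b = sum_list xs" "set xs \<subseteq> A" unfolding monoid_gen_def by auto
  then show ?thesis unfolding monoid_gen_def
    using a by (auto intro!: exI[of _ "a # xs"])
qed

lemma monoid_gen_nonneg:
  fixes A :: "'g::linordered_ab_group_add set"
  assumes "\<And>a. a \<in> A \<Longrightarrow> 0 < a" "b \<in> monoid_gen A" shows "0 \<le> b"
proof -
  obtain xs where "b = sum_list xs" "set xs \<subseteq> A" using assms(2) unfolding monoid_gen_def by auto
  then show ?thesis using assms(1) by (auto intro!: sum_list_nonneg intro: less_imp_le)
qed

text \<open>Neumann's lemma by a minimal bad sequence: an infinite descending sequence whose terms are
  successively chosen with minimal word length.\<close>

lemma wos_monoid_gen:
  fixes A :: "'g::linordered_ab_group_add set"
  assumes A: "wos A" "\<And>a. a \<in> A \<Longrightarrow> 0 < a"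
  shows "wos (monoid_gen A)"
proof (rule ccontr)
  assume "\<not> ?thesis"
  define bad where "bad b \<longleftrightarrow> (\<exists>s::nat\<Rightarrow>'g. s 0 = b \<and> range s \<subseteq> monoid_gen A \<and> (\<forall>n. s (Suc n) < s n))" for b
  define len where "len b = (LEAST n. \<exists>xs. set xs \<subseteq> A \<and> sum_list xs = b \<and> length xs = n)" for b
  have ex_bad: "\<exists>b. bad b"
  proof (rule ccontr)
    assume nb: "\<nexists>b. bad b"
    have "wos (monoid_gen A)"
    proof (rule wosI_seq)
      fix s :: "nat \<Rightarrow> 'g" assume "range s \<subseteq> monoid_gen A" "\<And>n. s (Suc n) < s n"
      then have "bad (s 0)" unfolding bad_def by blast
      then show False using nb by blast
    qed
    then show False using \<open>\<not> wos (monoid_gen A)\<close> by blast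
  qed
  have bad_gen: "b \<in> monoid_gen A" if "bad b" for b
    using that unfolding bad_def by auto
  have bad_less: "\<exists>c<b. bad c" if "bad b" for b
  proof -
    obtain s where "s 0 = b" "range s \<subseteq> monoid_gen A" "\<forall>n. s (Suc n) < s n"
      using \<open>bad b\<close> unfolding bad_def by blast
    then have "bad (s 1)" "s 1 < b"
      unfolding bad_def by (auto intro!: exI[of _ "\<lambda>n. s (Suc n)"])
    then show ?thesis by blast
  qed
  have minlen: "\<exists>b. P b \<and> (\<forall>c. P c \<longrightarrow> len b \<le> len c)" if "\<exists>b. P b" for P
  proof -
    obtain k where "P k" using \<open>\<exists>b. P b\<close> by blast
    from ex_has_least_nat[of P k len, OF this] show ?thesis .
  qed
  have "\<exists>s. \<forall>n. (bad (s n) \<and> (n = 0 \<longrightarrow> (\<forall>c. bad c \<longrightarrow> len (s n) \<le> len c))) \<and>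
      (s (Suc n) < s n \<and> (\<forall>c. bad c \<and> c < s n \<longrightarrow> len (s (Suc n)) \<le> len c))"
  proof (rule dependent_nat_choice)
    show "\<exists>x. bad x \<and> (0 = (0::nat) \<longrightarrow> (\<forall>c. bad c \<longrightarrow> len x \<le> len c))"
      using minlen[of bad] ex_bad by blast
    fix x :: 'g and n :: nat assume "bad x \<and> (n = 0 \<longrightarrow> (\<forall>c. bad c \<longrightarrow> len x \<le> len c))"
    then show "\<exists>y. (bad y \<and> (Suc n = 0 \<longrightarrow> (\<forall>c. bad c \<longrightarrow> len y \<le> len c))) \<and>
        (y < x \<and> (\<forall>c. bad c \<and> c < x \<longrightarrow> len y \<le> len c))"
      using minlen[of "\<lambda>c. bad c \<and> c < x"] bad_less[of x] by blast
  qed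
  then obtain s where ss: "\<forall>n. (bad (s n) \<and> (n = 0 \<longrightarrow> (\<forall>c. bad c \<longrightarrow> len (s n) \<le> len c))) \<and>
      (s (Suc n) < s n \<and> (\<forall>c. bad c \<and> c < s n \<longrightarrow> len (s (Suc n)) \<le> len c))"
    by (elim exE)
  then have s: "\<And>n. bad (s n)" "\<And>c. bad c \<Longrightarrow> len (s 0) \<le> len c"
      "\<And>n. s (Suc n) < s n" "\<And>n c. bad c \<Longrightarrow> c < s n \<Longrightarrow> len (s (Suc n)) \<le> len c"
    by simp_all
  have "\<exists>a t. s n = a + t \<and> a \<in> A \<and> t \<in> monoid_gen A \<and> len t < len (s n)" for n
  proof -
    have "\<exists>m xs. set xs \<subseteq> A \<and> sum_list xs = s n \<and> length xs = m"
      using bad_gen[OF s(1)[of n]] unfolding monoid_gen_def by auto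
    from LeastI_ex[OF this] obtain xs where xs: "set xs \<subseteq> A" "sum_list xs = s n" "length xs = len (s n)"
      unfolding len_def by blast
    have "s n \<noteq> 0"
      using s(3)[of n] monoid_gen_nonneg[OF A(2) bad_gen[OF s(1)[of "Suc n"]]] by auto
    then obtain a ys where ys: "xs = a # ys" using xs(2) by (cases xs) auto
    have "len (sum_list ys) \<le> length ys"
      unfolding len_def by (rule Least_le) (use xs ys in auto)
    moreover have "sum_list ys \<in> monoid_gen A" unfolding monoid_gen_def using xs ys by auto
    ultimately show ?thesis using xs ys by (intro exI[of _ a] exI[of _ "sum_list ys"]) auto
  qed
  then obtain a t where at: "\<And>n. s n = a n + t n" "\<And>n. a n \<in> A" "\<And>n. t n \<in> monoid_gen A"
      "\<And>n. len (t n) < len (s n)"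
    by metis
  have ts: "t n < s n" for n using A(2)[OF at(2)[of n]] at(1)[of n] by simp
  \<comment> \<open>The remainder \<open>t n\<close> lies below \<open>s n\<close>, hence below its
    predecessor in the sequence, and is shorter than \<open>s n\<close>; a bad \<open>t n\<close>
    would contradict the choice of \<open>s n\<close>. For \<open>n = 0\<close> minimal length among
    all bad elements suffices.\<close>
  have not_bad: "\<not> bad (t n)" for n
  proof
    assume b: "bad (t n)"
    show False
    proof (cases n)
      case 0
      then show False using s(2)[OF b] at(4)[of n] by simp
    next
      case (Suc m)
      then show False using s(4)[OF b, of m] at(4)[of n] less_trans[OF ts[of n], of "s m"] s(3)[of m] by simp
    qed
  qed
  \<comment> \<open>A descending sequence of remainders would begin with a bad one. Hence letters
    and remainders are nondecreasing along a common subsequence, against the descent of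
    \<open>s\<close>.\<close>
  have "wos (range t)"
  proof (rule wosI_seq)
    fix z assume z: "range z \<subseteq> range t" "\<And>n. z (Suc n) < z n"
    then have "bad (z 0)" unfolding bad_def using at(3) by (intro exI[of _ z]) auto
    moreover obtain n where "z 0 = t n" using z(1) by blast
    ultimately show False using not_bad[of n] by simp
  qed
  moreover have "range a \<subseteq> A" using at(2) by auto
  ultimately obtain f :: "nat \<Rightarrow> nat" where f: "strict_mono f" "mono (\<lambda>n. a (f n))" "mono (\<lambda>n. t (f n))"
    by (rule wos_mono_subseq2[OF A(1) _ _ order_refl])
  have "s (f 0) \<le> s (f 1)"
    unfolding at(1) using f(2,3) by (intro add_mono) (auto simp: mono_def)
  moreover have "s (f 1) < s (f 0)"
    using f(1) s(3) lift_Suc_mono_less[of "\<lambda>n. - s n" "f 0" "f 1"] by (simp add: strict_mono_def)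
  ultimately show False by simp
qed

section \<open>The ring of Hahn series\<close>

typedef (overloaded) ('g, 'a) hahn =
  "{f :: 'g::linordered_ab_group_add \<Rightarrow> 'a::comm_ring_1. wos {g. f g \<noteq> 0}}"
  morphisms hcoeff Hahn
  by (intro exI[of _ "\<lambda>_. 0"]) simp

lemma hcoeff_Hahn: "wos A \<Longrightarrow> (\<And>g. f g \<noteq> 0 \<Longrightarrow> g \<in> A) \<Longrightarrow> hcoeff (Hahn f) = f"
  by (rule Hahn_inverse) (auto intro: wos_subset)

definition hsupp :: "('g::linordered_ab_group_add, 'a::comm_ring_1) hahn \<Rightarrow> 'g set" where
  "hsupp x = {g. hcoeff x g \<noteq> 0}"

lemma wos_hsupp [simp]: "wos (hsupp x)"
  using hcoeff[of x] by (simp add: hsupp_def)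

lemma in_hsupp: "g \<in> hsupp x \<longleftrightarrow> hcoeff x g \<noteq> 0"
  by (simp add: hsupp_def)

lemma hahn_eqI: "(\<And>g. hcoeff x g = hcoeff y g) \<Longrightarrow> x = y"
  by (metis ext hcoeff_inject)

definition hmono :: "'g::linordered_ab_group_add \<Rightarrow> 'a::comm_ring_1 \<Rightarrow> ('g, 'a) hahn" where
  "hmono g c = Hahn (\<lambda>h. if h = g then c else 0)"

lemma hcoeff_hmono: "hcoeff (hmono g c) h = (if h = g then c else 0)"
  unfolding hmono_def by (subst hcoeff_Hahn[of "{g}"]) (auto split: if_splits)

lemma hsupp_hmono: "hsupp (hmono g c) \<subseteq> {g}"
  by (auto simp: hsupp_def hcoeff_hmono)

instantiation hahn :: (linordered_ab_group_add, comm_ring_1) comm_ring_1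
begin

definition "0 = hmono 0 (0::'b)"
definition "1 = hmono 0 (1::'b)"
definition "x + y = Hahn (\<lambda>g. hcoeff x g + hcoeff y g)"
definition "x - y = Hahn (\<lambda>g. hcoeff x g - hcoeff y g)"
definition "- x = Hahn (\<lambda>g. - hcoeff x g)"
definition "x * y = Hahn (\<lambda>g. \<Sum>a | hcoeff x a \<noteq> 0 \<and> hcoeff y (g - a) \<noteq> 0. hcoeff x a * hcoeff y (g - a))"

lemma hcoeff_0 [simp]: "hcoeff 0 g = 0"
  by (simp add: zero_hahn_def hcoeff_hmono)

lemma hcoeff_1: "hcoeff 1 g = (if g = 0 then 1 else 0)"
  by (simp add: one_hahn_def hcoeff_hmono)

lemma hcoeff_add [simp]: "hcoeff (x + y) g = hcoeff x g + hcoeff y g"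
  unfolding plus_hahn_def
  by (subst hcoeff_Hahn[of "hsupp x \<union> hsupp y"]) (auto simp: wos_Un in_hsupp)

lemma hcoeff_diff [simp]: "hcoeff (x - y) g = hcoeff x g - hcoeff y g"
  unfolding minus_hahn_def
  by (subst hcoeff_Hahn[of "hsupp x \<union> hsupp y"]) (auto simp: wos_Un in_hsupp)

lemma hcoeff_uminus [simp]: "hcoeff (- x) g = - hcoeff x g"
  unfolding uminus_hahn_def
  by (subst hcoeff_Hahn[of "hsupp x"]) (auto simp: in_hsupp)

lemma mult_sum_support:
  assumes "(\<Sum>a | hcoeff x a \<noteq> 0 \<and> hcoeff y (g - a) \<noteq> 0. hcoeff x a * hcoeff y (g - a)) \<noteq> 0"
  shows "g \<in> {a + b |a b. a \<in> hsupp x \<and> b \<in> hsupp y}"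
proof -
  obtain a where "hcoeff x a \<noteq> 0 \<and> hcoeff y (g - a) \<noteq> 0"
    using assms by (metis (mono_tags, lifting) empty_iff mem_Collect_eq sum.not_neutral_contains_not_neutral)
  then show ?thesis unfolding in_hsupp mem_Collect_eq by (intro exI[of _ a] exI[of _ "g - a"]) simp
qed

lemma hcoeff_mult_raw: "hcoeff (x * y) g =
  (\<Sum>a | hcoeff x a \<noteq> 0 \<and> hcoeff y (g - a) \<noteq> 0. hcoeff x a * hcoeff y (g - a))"
  unfolding times_hahn_def
  by (subst hcoeff_Hahn[OF wos_plus[OF wos_hsupp[of x] wos_hsupp[of y]]]) (auto dest: mult_sum_support)

lemma finite_mult_index: "finite {a. hcoeff x a \<noteq> 0 \<and> hcoeff y (g - a) \<noteq> 0}"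
  using finite_decomp[of "hsupp x" "hsupp y" g] by (simp add: in_hsupp)

text \<open>Enlarging the index set only adds zero terms, so several products can be expanded over
  one common finite set.\<close>

lemma hcoeff_mult:
  assumes "finite T" "\<And>a. hcoeff x a \<noteq> 0 \<Longrightarrow> hcoeff y (g - a) \<noteq> 0 \<Longrightarrow> a \<in> T"
  shows "hcoeff (x * y) g = (\<Sum>a\<in>T. hcoeff x a * hcoeff y (g - a))"
  unfolding hcoeff_mult_raw
proof (rule sum.mono_neutral_left)
  show "finite T" by fact
  show "\<forall>i\<in>T - {a. hcoeff x a \<noteq> 0 \<and> hcoeff y (g - a) \<noteq> 0}. hcoeff x i * hcoeff y (g - i) = 0"
  proof
    fix i assume "i \<in> T - {a. hcoeff x a \<noteq> 0 \<and> hcoeff y (g - a) \<noteq> 0}"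
    then have "hcoeff x i = 0 \<or> hcoeff y (g - i) = 0" by blast
    then show "hcoeff x i * hcoeff y (g - i) = 0" by auto
  qed
qed (use assms(2) in auto)

lemma hahn_mult_commute: "x * y = y * (x :: ('a, 'b) hahn)"
proof (rule hahn_eqI)
  fix g
  show "hcoeff (x * y) g = hcoeff (y * x) g"
    unfolding hcoeff_mult_raw
    by (rule sum.reindex_bij_witness[where i="\<lambda>a. g - a" and j="\<lambda>a. g - a"])
      (auto simp: algebra_simps)
qed

lemma hsupp_mult_sub: "hsupp (x * y) \<subseteq> {a + b |a b. a \<in> hsupp x \<and> b \<in> hsupp y}"
  by (rule subsetI, rule mult_sum_support) (simp add: in_hsupp hcoeff_mult_raw)

text \<open>Written over pairs, with the third exponent forced, the triple product is symmetric in
  \<open>x\<close> and \<open>y\<close> up to swapping the pair; together with commutativity this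
  yields associativity.\<close>

lemma hcoeff_mult3:
  assumes "finite P" "\<And>a b. hcoeff x a \<noteq> 0 \<Longrightarrow> hcoeff y b \<noteq> 0 \<Longrightarrow> hcoeff z (g - a - b) \<noteq> 0 \<Longrightarrow> (a, b) \<in> P"
    and "\<And>a b. (a, b) \<in> P \<Longrightarrow> hcoeff z (g - a - b) \<noteq> 0" "\<And>a b. (a, b) \<in> P \<Longrightarrow> hcoeff y b \<noteq> 0"
  shows "hcoeff (x * (y * z)) g = (\<Sum>(a, b)\<in>P. hcoeff x a * hcoeff y b * hcoeff z (g - a - b))"
proof -
  define T where "T = fst ` P"
  define Tb where "Tb a = {b. (a, b) \<in> P}" for a
  have fT: "finite T" using assms(1) by (simp add: T_def)
  have fTb: "finite (Tb a)" for a
    using finite_subset[of "Tb a" "snd ` P"] assms(1) by (force simp: Tb_def)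
  have "hcoeff (x * (y * z)) g = (\<Sum>a\<in>T. hcoeff x a * hcoeff (y * z) (g - a))"
  proof (rule hcoeff_mult[OF fT])
    fix a assume a: "hcoeff x a \<noteq> 0" "hcoeff (y * z) (g - a) \<noteq> 0"
    then have "g - a \<in> hsupp (y * z)" by (simp add: in_hsupp)
    then obtain b c where "g - a = b + c" "hcoeff y b \<noteq> 0" "hcoeff z c \<noteq> 0"
      using hsupp_mult_sub by (force simp: in_hsupp)
    moreover from this have "c = g - a - b" by (simp add: algebra_simps)
    ultimately have "(a, b) \<in> P" using assms(2)[OF a(1)] by simp
    then show "a \<in> T" unfolding T_def by force
  qed
  also have "\<dots> = (\<Sum>a\<in>T. \<Sum>b\<in>Tb a. hcoeff x a * hcoeff y b * hcoeff z (g - a - b))"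
  proof (rule sum.cong[OF refl])
    fix a assume "a \<in> T"
    show "hcoeff x a * hcoeff (y * z) (g - a) = (\<Sum>b\<in>Tb a. hcoeff x a * hcoeff y b * hcoeff z (g - a - b))"
    proof (cases "hcoeff x a = 0")
      case False
      then have "hcoeff (y * z) (g - a) = (\<Sum>b\<in>Tb a. hcoeff y b * hcoeff z (g - a - b))"
        using assms(2) by (intro hcoeff_mult[OF fTb]) (auto simp: Tb_def)
      then show ?thesis by (simp add: sum_distrib_left mult.assoc)
    qed simp
  qed
  also have "\<dots> = (\<Sum>(a, b)\<in>Sigma T Tb. hcoeff x a * hcoeff y b * hcoeff z (g - a - b))"
    using fT fTb by (simp add: sum.Sigma)
  also have "Sigma T Tb = P" by (force simp: T_def Tb_def)
  finally show ?thesis .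
qed

lemma finite_triples:
  "finite {(a, b). hcoeff x a \<noteq> 0 \<and> hcoeff y b \<noteq> 0 \<and> hcoeff z (g - a - b) \<noteq> 0}" (is "finite ?P")
proof -
  let ?W = "{b + c |b c. b \<in> hsupp y \<and> c \<in> hsupp z}"
  have "finite {a \<in> hsupp x. g - a \<in> ?W}"
    by (intro finite_decomp wos_plus wos_hsupp)
  moreover have "finite {b \<in> hsupp y. (g - a) - b \<in> hsupp z}" for a
    by (intro finite_decomp wos_hsupp)
  ultimately have "finite (SIGMA a:{a \<in> hsupp x. g - a \<in> ?W}. {b \<in> hsupp y. (g - a) - b \<in> hsupp z})"
    by (intro finite_SigmaI)
  moreover have "?P \<subseteq> (SIGMA a:{a \<in> hsupp x. g - a \<in> ?W}. {b \<in> hsupp y. (g - a) - b \<in> hsupp z})"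
  proof
    fix p assume "p \<in> ?P"
    then obtain a b where p: "p = (a, b)"
      and h: "hcoeff x a \<noteq> 0" "hcoeff y b \<noteq> 0" "hcoeff z (g - a - b) \<noteq> 0" by blast
    have "g - a \<in> ?W"
      unfolding in_hsupp mem_Collect_eq using h by (intro exI[of _ b] exI[of _ "g - a - b"]) simp
    then show "p \<in> (SIGMA a:{a \<in> hsupp x. g - a \<in> ?W}. {b \<in> hsupp y. (g - a) - b \<in> hsupp z})"
      using h p by (simp add: in_hsupp)
  qed
  ultimately show ?thesis using finite_subset by blast
qed

lemma hahn_mult_left_commute: "x * (y * z) = y * (x * (z :: ('a, 'b) hahn))"
proof (rule hahn_eqI)
  fix g
  let ?P = "\<lambda>x y. {(a, b). hcoeff x a \<noteq> 0 \<and> hcoeff y b \<noteq> 0 \<and> hcoeff z (g - a - b) \<noteq> 0}"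
  have "hcoeff (x * (y * z)) g = (\<Sum>(a, b)\<in>?P x y. hcoeff x a * hcoeff y b * hcoeff z (g - a - b))"
    by (rule hcoeff_mult3[OF finite_triples]) auto
  also have "\<dots> = (\<Sum>(a, b)\<in>?P y x. hcoeff y a * hcoeff x b * hcoeff z (g - a - b))"
    by (rule sum.reindex_bij_witness[where i=prod.swap and j=prod.swap])
      (auto simp: algebra_simps)
  also have "\<dots> = hcoeff (y * (x * z)) g"
    by (rule hcoeff_mult3[OF finite_triples, symmetric]) auto
  finally show "hcoeff (x * (y * z)) g = hcoeff (y * (x * z)) g" .
qed

lemma hcoeff_hmono_mult: "hcoeff (hmono h c * x) g = c * hcoeff (x :: ('a, 'b) hahn) (g - h)"
  by (subst hcoeff_mult[of "{h}"]) (auto simp: hcoeff_hmono split: if_splits)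

instance
proof
  fix a b c :: "('a, 'b) hahn"
  show "a * b = b * a" by (rule hahn_mult_commute)
  show "a * b * c = a * (b * c)"
    by (metis hahn_mult_commute hahn_mult_left_commute)
  show "1 * a = a" by (rule hahn_eqI) (simp add: one_hahn_def hcoeff_hmono_mult)
  show "(a + b) * c = a * c + b * c"
  proof (rule hahn_eqI)
    fix g
    let ?T = "{u. hcoeff a u \<noteq> 0 \<and> hcoeff c (g - u) \<noteq> 0} \<union> {u. hcoeff b u \<noteq> 0 \<and> hcoeff c (g - u) \<noteq> 0}"
    have f: "finite ?T" by (simp add: finite_mult_index)
    have "hcoeff ((a + b) * c) g = (\<Sum>u\<in>?T. hcoeff (a + b) u * hcoeff c (g - u))"
      by (rule hcoeff_mult[OF f]) auto
    moreover have "hcoeff (a * c) g = (\<Sum>u\<in>?T. hcoeff a u * hcoeff c (g - u))"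
      by (rule hcoeff_mult[OF f]) auto
    moreover have "hcoeff (b * c) g = (\<Sum>u\<in>?T. hcoeff b u * hcoeff c (g - u))"
      by (rule hcoeff_mult[OF f]) auto
    ultimately show "hcoeff ((a + b) * c) g = hcoeff (a * c + b * c) g"
      by (simp add: distrib_right sum.distrib)
  qed
  show "(0::('a, 'b) hahn) \<noteq> 1"
    by (metis hcoeff_0 hcoeff_1 zero_neq_one)
qed (rule hahn_eqI; simp)+

end

lemma hmono_mult_hmono: "hmono g c * hmono h d = hmono (g + h) (c * d)"
  by (rule hahn_eqI) (auto simp: hcoeff_hmono_mult hcoeff_hmono algebra_simps)

lemma hmono_0_1 [simp]: "hmono 0 1 = 1"
  by (simp add: one_hahn_def)

text \<open>The series \<open>h\<close> is the geometric series of \<open>m\<close>, obtained by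
  solving \<open>h = 1 + m * h\<close> coefficientwise. The recursion is well-founded because the
  monoid generated by the support is well-ordered, and the coefficient at \<open>g\<close> uses only
  those at \<open>g - a\<close> with \<open>a > 0\<close>.\<close>

lemma hahn_geometric:
  fixes m :: "('g::linordered_ab_group_add, 'a::comm_ring_1) hahn"
  assumes pos: "\<And>g. g \<in> hsupp m \<Longrightarrow> 0 < g"
  obtains h where "(1 - m) * h = 1" "hsupp h \<subseteq> monoid_gen (hsupp m)"
proof -
  define B where "B = monoid_gen (hsupp m)"
  have wB: "wos B" unfolding B_def by (intro wos_monoid_gen wos_hsupp pos)
  define r where "r = {(x, y). x < y \<and> x \<in> B \<and> y \<in> B}"
  have wf: "wf r"
  proof (rule wfI_min)
    fix x and Y :: "'g set" assume "x \<in> Y"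
    show "\<exists>z\<in>Y. \<forall>y. (y, z) \<in> r \<longrightarrow> y \<notin> Y"
    proof (cases "Y \<inter> B = {}")
      case True
      then show ?thesis using \<open>x \<in> Y\<close> unfolding r_def by blast
    next
      case False
      then obtain z where "z \<in> Y \<inter> B" "\<forall>b\<in>Y \<inter> B. z \<le> b"
        using wosD[OF wB, of "Y \<inter> B"] by blast
      then show ?thesis unfolding r_def by (intro bexI[of _ z]) (auto dest: leD)
    qed
  qed
  define T where "T g = {a. hcoeff m a \<noteq> 0 \<and> g - a \<in> B}" for g
  define k where "k = wfrec r (\<lambda>k g. if g \<in> B then (if g = 0 then 1 else 0) + (\<Sum>a\<in>T g. hcoeff m a * k (g - a)) else 0)"
  have k: "k g = (if g \<in> B then (if g = 0 then 1 else 0) + (\<Sum>a\<in>T g. hcoeff m a * k (g - a)) else 0)" for g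
  proof -
    have "(g - a, g) \<in> r" if "g \<in> B" "a \<in> T g" for a
      using that pos[of a] by (auto simp: r_def T_def in_hsupp)
    then show ?thesis
      unfolding k_def by (subst wfrec[OF wf]) (auto simp: cut_apply intro!: sum.cong)
  qed
  have ksupp: "k g \<noteq> 0 \<Longrightarrow> g \<in> B" for g using k[of g] by (auto split: if_splits)
  define h where "h = Hahn k"
  have hk: "hcoeff h = k" unfolding h_def by (rule hcoeff_Hahn[OF wB ksupp])
  have fT: "finite (T g)" for g
    using finite_decomp[OF wos_hsupp[of m] wB, of g] by (simp add: T_def in_hsupp)
  show thesis
  proof (rule that[of h])
    show "hsupp h \<subseteq> monoid_gen (hsupp m)" using ksupp by (auto simp: in_hsupp hk B_def)
    have "hcoeff h g - hcoeff (m * h) g = hcoeff 1 g" for g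
    proof -
      have "hcoeff (m * h) g = (\<Sum>a\<in>T g. hcoeff m a * k (g - a))"
        using ksupp by (subst hcoeff_mult[OF fT]) (auto simp: T_def hk)
      \<comment> \<open>Outside \<open>B\<close> both sides of the recursion are zero:
        \<open>B\<close> contains 0 and is closed under adding exponents of
        \<open>m\<close>.\<close>
      moreover have "T g = {} \<and> g \<noteq> 0" if "g \<notin> B"
      proof -
        have "a + (g - a) \<in> B" if "a \<in> T g" for a
          using that unfolding B_def T_def by (intro monoid_gen_add) (auto simp: in_hsupp)
        then show ?thesis using \<open>g \<notin> B\<close> by (auto simp: B_def)
      qed
      ultimately show ?thesis using k[of g] by (auto simp: hk hcoeff_1)
    qed
    then show "(1 - m) * h = 1"
      by (intro hahn_eqI) (simp add: left_diff_distrib)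
  qed
qed

section \<open>The value group\<close>

instance dual :: (linorder) linorder
  by standard (metis less_eq_dual.rep_eq linear)

text \<open>The order of \<open>poly_mapping\<close> lets the smallest index dominate; with the dual index
  order the largest one does.\<close>

type_synonym grp = "omega1 dual \<Rightarrow>\<^sub>0 int"

definition gcoord :: "grp \<Rightarrow> omega1 \<Rightarrow> int" where
  "gcoord g a = Poly_Mapping.lookup g (dual a)"

definition gbase :: "omega1 \<Rightarrow> grp" where
  "gbase a = Poly_Mapping.single (dual a) 1"

lemma gcoord_0 [simp]: "gcoord 0 a = 0"
  and gcoord_add [simp]: "gcoord (g + h) a = gcoord g a + gcoord h a"
  and gcoord_diff [simp]: "gcoord (g - h) a = gcoord g a - gcoord h a"
  and gcoord_uminus [simp]: "gcoord (- g) a = - gcoord g a"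
  and gcoord_gbase: "gcoord (gbase b) a = (if a = b then 1 else 0)"
  unfolding gcoord_def gbase_def
  by (auto simp: lookup_add lookup_minus lookup_single when_def)

lemma finite_gcoord: "finite {a. gcoord g a \<noteq> 0}"
proof -
  have "dual ` {a. gcoord g a \<noteq> 0} \<subseteq> Poly_Mapping.keys g"
    by (auto simp: gcoord_def in_keys_iff)
  then have "finite (dual ` {a. gcoord g a \<noteq> 0})"
    using finite_subset finite_keys by blast
  then show ?thesis
    by (rule finite_imageD) (rule inj_on_subset[OF inj_dual subset_UNIV])
qed

lemma grp_eqI: "(\<And>a. gcoord g a = gcoord h a) \<Longrightarrow> g = h"
  unfolding gcoord_def by (rule poly_mapping_eqI) (metis dual_undual)

lemma grp_less_iff: "g < h \<longleftrightarrow> (\<exists>a. gcoord g a < gcoord h a \<and> (\<forall>b>a. gcoord g b = gcoord h b))"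
proof -
  have "less_fun (Poly_Mapping.lookup g) (Poly_Mapping.lookup h) \<longleftrightarrow>
      (\<exists>a. gcoord g a < gcoord h a \<and> (\<forall>b>a. gcoord g b = gcoord h b))" (is "?l \<longleftrightarrow> ?r")
  proof
    assume ?l
    then obtain k where k: "Poly_Mapping.lookup g k < Poly_Mapping.lookup h k"
      "\<And>k'. k' < k \<Longrightarrow> Poly_Mapping.lookup g k' = Poly_Mapping.lookup h k'"
      by (rule less_funE) blast
    then show ?r
      by (intro exI[of _ "undual k"]) (simp add: gcoord_def less_dual.rep_eq)
  next
    assume ?r
    then obtain a where a: "gcoord g a < gcoord h a" "\<And>b. a < b \<Longrightarrow> gcoord g b = gcoord h b"
      by blast
    have "Poly_Mapping.lookup g k = Poly_Mapping.lookup h k" if "k < dual a" for k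
      using a(2)[of "undual k"] that by (simp add: gcoord_def less_dual.rep_eq)
    then show ?l unfolding less_fun_def
      using a(1) by (intro exI[of _ "dual a"]) (simp add: gcoord_def)
  qed
  then show ?thesis by (simp add: less_poly_mapping.rep_eq)
qed

lemma gcoord_leading:
  assumes "g \<noteq> 0"
  obtains a where "gcoord g a \<noteq> 0" "\<And>b. a < b \<Longrightarrow> gcoord g b = 0"
proof -
  let ?A = "{a. gcoord g a \<noteq> 0}"
  have ne: "?A \<noteq> {}" using assms grp_eqI[of g 0] by auto
  show thesis
  proof (rule that[of "Max ?A"])
    show "gcoord g (Max ?A) \<noteq> 0" using Max_in[OF finite_gcoord ne] by simp
    show "gcoord g b = 0" if "Max ?A < b" for b
      using Max_ge[OF finite_gcoord, of b] that by (metis (mono_tags, lifting) leD mem_Collect_eq)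
  qed
qed

section \<open>The convex subgroups\<close>

definition gsub :: "omega1 \<Rightarrow> grp set" where
  "gsub n = {g. \<forall>a\<ge>n. gcoord g a = 0}"

lemma gsub_0 [simp]: "0 \<in> gsub n"
  and gsub_add: "g \<in> gsub n \<Longrightarrow> h \<in> gsub n \<Longrightarrow> g + h \<in> gsub n"
  and gsub_diff: "g \<in> gsub n \<Longrightarrow> h \<in> gsub n \<Longrightarrow> g - h \<in> gsub n"
  and gsub_uminus: "g \<in> gsub n \<Longrightarrow> - g \<in> gsub n"
  and gsub_mono: "g \<in> gsub m \<Longrightarrow> m \<le> n \<Longrightarrow> g \<in> gsub n"
  by (auto simp: gsub_def)

lemma gsub_gbase [simp]: "gbase a \<in> gsub n \<longleftrightarrow> a < n"
  by (auto simp: gsub_def gcoord_gbase not_le)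

lemma gsub_ex: "\<exists>n. g \<in> gsub n"
proof -
  obtain n where "\<And>a. a \<in> {a. gcoord g a \<noteq> 0} \<Longrightarrow> a < n"
    using countable_bounded_omega1[OF countable_finite[OF finite_gcoord]] by blast
  then show ?thesis by (auto simp: gsub_def intro!: exI[of _ n] dest: leD)
qed

text \<open>Supports of group elements are finite, so the leading index of \<open>g\<close> lies
  below \<open>d\<close>, and a limit leaves room above it.\<close>

lemma gsub_limit:
  assumes "limit_ord d" "g \<in> gsub d" shows "\<exists>n<d. g \<in> gsub n"
proof (cases "g = 0")
  case True
  then show ?thesis using assms(1) by (auto simp: limit_ord_def)
next
  case False
  then obtain a where a: "gcoord g a \<noteq> 0" "\<And>b. a < b \<Longrightarrow> gcoord g b = 0"
    using gcoord_leading by blast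
  then have "a < d" using assms(2) by (auto simp: gsub_def not_le[symmetric])
  then obtain b where "a < b" "b < d" using assms(1) by (auto simp: limit_ord_def)
  then show ?thesis using a(2) by (auto simp: gsub_def intro!: exI[of _ b])
qed

text \<open>The leading coefficient of \<open>g\<close> is positive and sits at an index at least
  \<open>n\<close>, where \<open>h\<close> has none. Convexity of \<open>gsub n\<close>
  follows.\<close>

lemma gsub_less_pos:
  assumes "0 < g" "g \<notin> gsub n" "h \<in> gsub n" shows "h < g"
proof -
  have "g \<noteq> 0" using assms(1) by auto
  then obtain a where a: "gcoord g a \<noteq> 0" "\<And>b. a < b \<Longrightarrow> gcoord g b = 0"
    using gcoord_leading by blast
  have "n \<le> a" using a(2) assms(2) by (force simp: gsub_def not_less)
  obtain c where c: "0 < gcoord g c" "\<And>b. c < b \<Longrightarrow> gcoord g b = 0"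
    using assms(1) by (auto simp: grp_less_iff)
  have "c = a" using a c by (metis linorder_less_linear less_irrefl)
  then show ?thesis unfolding grp_less_iff
    using c \<open>n \<le> a\<close> assms(3) by (intro exI[of _ a]) (auto simp: gsub_def)
qed

lemma gsub_convex: "0 \<le> g \<Longrightarrow> g \<le> h \<Longrightarrow> h \<in> gsub n \<Longrightarrow> g \<in> gsub n"
  using gsub_less_pos[of g n h] gsub_0 by (metis leD order_le_imp_less_or_eq)

lemma gbase_pos [simp]: "0 < gbase a"
  unfolding grp_less_iff by (intro exI[of _ a]) (simp add: gcoord_gbase)

lemma gsub_less_gbase: "h \<in> gsub a \<Longrightarrow> h < gbase a"
  by (rule gsub_less_pos[of _ a]) auto

lemma gbase_mono: "a < b \<Longrightarrow> gbase a < gbase b"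
  by (simp add: gsub_less_gbase)

lemma gsub_below_gbase: "0 \<le> g \<Longrightarrow> g < gbase a \<Longrightarrow> a < n \<Longrightarrow> g \<in> gsub n"
  by (rule gsub_convex[of g "gbase a"]) auto

text \<open>A group element is determined by its graph over its support, a finite subset of a
  countable set.\<close>

lemma countable_gsub: "countable (gsub n)"
proof -
  define f where "f g = (\<lambda>a. (a, gcoord g a)) ` {a. gcoord g a \<noteq> 0}" for g
  have "inj f"
  proof (rule injI, rule grp_eqI)
    fix g h a assume *: "f g = f h"
    have "(a, k) \<in> f g \<longleftrightarrow> k \<noteq> 0 \<and> gcoord g a = k" for g k by (auto simp: f_def)
    then show "gcoord g a = gcoord h a" using * by metis
  qed
  moreover have "f ` gsub n \<subseteq> {A. finite A \<and> A \<subseteq> {..<n} \<times> UNIV}"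
    by (auto simp: f_def finite_gcoord gsub_def not_le[symmetric])
  moreover have "countable {A. finite A \<and> A \<subseteq> {..<n} \<times> (UNIV :: int set)}"
    by (intro countable_Collect_finite_subset countable_SIGMA) auto
  ultimately show ?thesis
    by (meson countable_image_inj_on countable_subset inj_on_subset subset_UNIV)
qed

section \<open>Admissible supports and their closure properties\<close>

text \<open>The last clause confines the part of \<open>A\<close> in each coset of
  \<open>gsub d\<close> to one coset of a \<open>gsub n\<close> with \<open>n < d\<close>, where
  \<open>n\<close> may depend on the coset. It excludes supports that run cofinally through a coset,
  and it is stable under sums, products and inversion.\<close>

definition good :: "omega1 set \<Rightarrow> grp set \<Rightarrow> bool" where
  "good D A \<longleftrightarrow> wos A \<and> (\<exists>n. A \<subseteq> gsub n) \<and>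
     (\<forall>d\<in>D. limit_ord d \<longrightarrow> (\<forall>g. \<exists>n<d. \<forall>a\<in>A. a - g \<in> gsub d \<longrightarrow> a - g \<in> gsub n))"

lemma goodD:
  assumes "good D A" "d \<in> D" "limit_ord d"
  obtains n where "n < d" "\<And>a. a \<in> A \<Longrightarrow> a - g \<in> gsub d \<Longrightarrow> a - g \<in> gsub n"
  using assms unfolding good_def by blast

lemma good_wos: "good D A \<Longrightarrow> wos A"
  unfolding good_def by (elim conjE)

lemma good_bounded: "good D A \<Longrightarrow> \<exists>n. A \<subseteq> gsub n"
  unfolding good_def by (elim conjE)

lemma good_subset: "good D A \<Longrightarrow> B \<subseteq> A \<Longrightarrow> good D B"
  unfolding good_def by (meson subset_iff wos_subset)

lemma good_Un:
  assumes "good D A" "good D B" shows "good D (A \<union> B)"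
  unfolding good_def
proof (intro conjI ballI impI allI)
  show "wos (A \<union> B)" using assms by (intro wos_Un good_wos)
  obtain m n where "A \<subseteq> gsub m" "B \<subseteq> gsub n" using good_bounded assms by metis
  then have "A \<union> B \<subseteq> gsub (max m n)"
    using gsub_mono by (metis Un_least max.cobounded1 max.cobounded2 subset_iff)
  then show "\<exists>n. A \<union> B \<subseteq> gsub n" by blast
  fix d g assume d: "d \<in> D" "limit_ord d"
  obtain m where m: "m < d" "\<And>a. a \<in> A \<Longrightarrow> a - g \<in> gsub d \<Longrightarrow> a - g \<in> gsub m"
    using goodD[OF assms(1) d] by blast
  obtain n where n: "n < d" "\<And>a. a \<in> B \<Longrightarrow> a - g \<in> gsub d \<Longrightarrow> a - g \<in> gsub n"
    using goodD[OF assms(2) d] by blast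
  have "\<forall>a\<in>A \<union> B. a - g \<in> gsub d \<longrightarrow> a - g \<in> gsub (max m n)"
    using m(2) n(2) gsub_mono by (metis UnE max.cobounded1 max.cobounded2)
  then show "\<exists>n<d. \<forall>a\<in>A \<union> B. a - g \<in> gsub d \<longrightarrow> a - g \<in> gsub n"
    using m(1) n(1) by (intro exI[of _ "max m n"]) auto
qed

lemma good_singleton: "good D {a}"
  unfolding good_def
proof (intro conjI ballI impI allI)
  show "\<exists>n. {a} \<subseteq> gsub n" using gsub_ex[of a] by auto
  fix d g assume d: "d \<in> D" "limit_ord d"
  show "\<exists>n<d. \<forall>a\<in>{a}. a - g \<in> gsub d \<longrightarrow> a - g \<in> gsub n"
    using gsub_limit[OF d(2), of "a - g"] d(2) by (cases "a - g \<in> gsub d") (auto simp: limit_ord_def)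
qed simp

text \<open>A failure of the last clause of \<open>good\<close> in sequential form. Monotonicity is
  demanded so that convexity of \<open>gsub d\<close> applies to differences of terms.\<close>

definition escaping :: "grp set \<Rightarrow> grp \<Rightarrow> omega1 \<Rightarrow> (nat \<Rightarrow> grp) \<Rightarrow> bool" where
  "escaping A g d s \<longleftrightarrow> (\<forall>n. s n \<in> A) \<and> mono s \<and> (\<forall>n. s n - g \<in> gsub d) \<and>
     (\<forall>n<d. \<exists>i. \<forall>j\<ge>i. s j - g \<notin> gsub n)"

lemma escapingD:
  assumes "escaping A g d s"
  shows "s n \<in> A" "mono s" "s n - g \<in> gsub d" "n' < d \<Longrightarrow> \<exists>i. \<forall>j\<ge>i. s j - g \<notin> gsub n'"
  using assms by (auto simp: escaping_def)

text \<open>Pick elements that leave \<open>gsub (c i)\<close> for a cofinal sequence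
  \<open>c\<close>, then pass to a monotone subsequence; since \<open>c\<close> and the subsequence
  increase, every \<open>gsub n\<close> is left for good.\<close>

lemma unbounded_seq:
  assumes A: "wos A" and d: "limit_ord d"
    and ub: "\<And>n. n < d \<Longrightarrow> \<exists>a\<in>A. a - g \<in> gsub d \<and> a - g \<notin> gsub n"
  shows "\<exists>s. escaping A g d s"
proof -
  obtain c :: "nat \<Rightarrow> omega1" where c: "strict_mono c" "\<And>n. c n < d" "\<And>a. a < d \<Longrightarrow> \<exists>n. a < c n"
    by (rule limit_ord_cofinal[OF d]) blast
  have "\<forall>i. \<exists>a. a \<in> A \<and> a - g \<in> gsub d \<and> a - g \<notin> gsub (c i)"
    using ub[OF c(2)] by blast
  then obtain t where t: "\<And>i. t i \<in> A" "\<And>i. t i - g \<in> gsub d" "\<And>i. t i - g \<notin> gsub (c i)"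
    by metis
  have "range t \<subseteq> A" using t(1) by auto
  then obtain f :: "nat \<Rightarrow> nat" where f: "strict_mono f" "mono (\<lambda>i. t (f i))"
    by (rule wos_mono_subseq[OF A])
  show ?thesis
    unfolding escaping_def
  proof (intro exI[of _ "\<lambda>i. t (f i)"] conjI allI impI)
    fix n assume "n < d"
    then obtain i where i: "n < c i" using c(3) by blast
    have "t (f j) - g \<notin> gsub n" if "i \<le> j" for j
    proof -
      have "c i \<le> c (f j)"
        using c(1) f(1) that by (meson order_trans seq_suble strict_mono_less_eq)
      then have "n \<le> c (f j)" using i by simp
      then show ?thesis using t(3)[of "f j"] gsub_mono by blast
    qed
    then show "\<exists>i. \<forall>j\<ge>i. t (f j) - g \<notin> gsub n" by blast
  qed (use t f(2) in auto)
qed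

text \<open>Each increment is nonnegative and bounded by the increment of the sum, so convexity
  applies.\<close>

lemma gsub_mono_split:
  assumes "a i + b i - (a j + b j) \<in> gsub d" "mono (a :: nat \<Rightarrow> grp)" "mono (b :: nat \<Rightarrow> grp)" "j \<le> i"
  shows "a i - a j \<in> gsub d" "b i - b j \<in> gsub d"
proof -
  have m: "a j \<le> a i" "b j \<le> b i" using assms by (auto simp: mono_def)
  have s: "a i + b i - (a j + b j) = (a i - a j) + (b i - b j)" by simp
  show "a i - a j \<in> gsub d"
    using m by (intro gsub_convex[OF _ _ assms(1)]) (auto simp: s)
  show "b i - b j \<in> gsub d"
    using m by (intro gsub_convex[OF _ _ assms(1)]) (auto simp: s)
qed

text \<open>An escaping sequence of sums can be thinned so that both summands are monotone. Their
  increments then lie in \<open>gsub d\<close>, hence in a fixed smaller subgroup because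
  \<open>A\<close> and \<open>B\<close> are good, and the sums cannot escape.\<close>

lemma good_plus:
  assumes A: "good D A" and B: "good D B" shows "good D {a + b |a b. a \<in> A \<and> b \<in> B}" (is "good D ?C")
  unfolding good_def
proof (intro conjI ballI impI allI)
  have wA: "wos A" and wB: "wos B" using assms by (auto intro: good_wos)
  show wC: "wos ?C" by (rule wos_plus[OF wA wB])
  obtain m n where "A \<subseteq> gsub m" "B \<subseteq> gsub n" using good_bounded assms by metis
  then have "A \<subseteq> gsub (max m n)" "B \<subseteq> gsub (max m n)"
    using gsub_mono by (metis max.cobounded1 max.cobounded2 subset_iff)+
  then have "?C \<subseteq> gsub (max m n)" using gsub_add by blast
  then show "\<exists>n. ?C \<subseteq> gsub n" by blast
  fix d g assume d: "d \<in> D" "limit_ord d"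
  show "\<exists>n<d. \<forall>a\<in>?C. a - g \<in> gsub d \<longrightarrow> a - g \<in> gsub n"
  proof (rule ccontr)
    assume "\<not> ?thesis"
    then have "\<And>n. n < d \<Longrightarrow> \<exists>a\<in>?C. a - g \<in> gsub d \<and> a - g \<notin> gsub n" by blast
    then obtain s where "escaping ?C g d s" using unbounded_seq[OF wC d(2)] by blast
    note s = escapingD[OF this]
    have "\<forall>n. \<exists>a b. s n = a + b \<and> a \<in> A \<and> b \<in> B" using s(1) by blast
    then obtain a b where ab: "\<And>n. s n = a n + b n" "\<And>n. a n \<in> A" "\<And>n. b n \<in> B" by metis
    have "range a \<subseteq> A" "range b \<subseteq> B" using ab by auto
    then obtain f :: "nat \<Rightarrow> nat" where f: "strict_mono f" "mono (\<lambda>n. a (f n))" "mono (\<lambda>n. b (f n))"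
      by (rule wos_mono_subseq2[OF wA wB])
    have dif: "a (f i) + b (f i) - (a (f 0) + b (f 0)) \<in> gsub d" for i
      using gsub_diff[OF s(3)[of "f i"] s(3)[of "f 0"]] by (simp add: ab)
    obtain n1 where n1: "n1 < d" "\<And>x. x \<in> A \<Longrightarrow> x - a (f 0) \<in> gsub d \<Longrightarrow> x - a (f 0) \<in> gsub n1"
      using goodD[OF A d] by blast
    obtain n2 where n2: "n2 < d" "\<And>x. x \<in> B \<Longrightarrow> x - b (f 0) \<in> gsub d \<Longrightarrow> x - b (f 0) \<in> gsub n2"
      using goodD[OF B d] by blast
    obtain n3 where n3: "n3 < d" "s (f 0) - g \<in> gsub n3" using gsub_limit[OF d(2) s(3)] by blast
    define n where "n = max n1 (max n2 n3)"
    have "n < d" using n1 n2 n3 by (simp add: n_def)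
    have "s (f i) - g \<in> gsub n" for i
    proof -
      have "a (f i) - a (f 0) \<in> gsub n1" "b (f i) - b (f 0) \<in> gsub n2"
        using gsub_mono_split[OF dif[of i] f(2,3)] n1(2) n2(2) ab by auto
      then have "(a (f i) - a (f 0)) + (b (f i) - b (f 0)) + (s (f 0) - g) \<in> gsub n"
        using n3(2) by (intro gsub_add) (auto simp: n_def le_max_iff_disj elim: gsub_mono)
      then show ?thesis by (simp add: ab algebra_simps)
    qed
    moreover obtain i where "\<forall>j\<ge>i. s j - g \<notin> gsub n" using s(4)[OF \<open>n < d\<close>] by blast
    ultimately show False using seq_suble[OF f(1), of i] by blast
  qed
qed

lemma gsub_sum_list: "set xs \<subseteq> gsub n \<Longrightarrow> sum_list xs \<in> gsub n"
  by (induction xs) (auto intro: gsub_add)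

text \<open>A least-counterexample argument: from words that escape in the coset of a least element
  \<open>z\<close>, one letter is removed, and the remainders yield a smaller element of the same
  kind. This is what makes inverses of series admissible.\<close>

lemma good_monoid_gen:
  assumes A: "good D A" and pos: "\<And>a. a \<in> A \<Longrightarrow> 0 < a"
  shows "good D (monoid_gen A)"
  unfolding good_def
proof (intro conjI ballI impI allI)
  let ?B = "monoid_gen A"
  have wA: "wos A" using A by (rule good_wos)
  show wB: "wos ?B" by (rule wos_monoid_gen[OF wA pos])
  obtain m where "A \<subseteq> gsub m" using good_bounded[OF A] by blast
  then have "?B \<subseteq> gsub m" using gsub_sum_list by (auto simp: monoid_gen_def)
  then show "\<exists>n. ?B \<subseteq> gsub n" by blast
  fix d g assume d: "d \<in> D" "limit_ord d"
  define Z where "Z = {b \<in> ?B. \<forall>n<d. \<exists>b'\<in>?B. b' - b \<in> gsub d \<and> b' - b \<notin> gsub n}"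
  show "\<exists>n<d. \<forall>a\<in>?B. a - g \<in> gsub d \<longrightarrow> a - g \<in> gsub n"
  proof (rule ccontr)
    assume "\<not> ?thesis"
    then have ng: "\<And>n. n < d \<Longrightarrow> \<exists>a\<in>?B. a - g \<in> gsub d \<and> a - g \<notin> gsub n" by blast
    obtain n0 where "n0 < d" using d(2) by (auto simp: limit_ord_def)
    then obtain b0 where b0: "b0 \<in> ?B" "b0 - g \<in> gsub d" using ng by blast
    obtain n1 where n1: "n1 < d" "b0 - g \<in> gsub n1" using gsub_limit[OF d(2) b0(2)] by blast
    \<comment> \<open>Moving the reference point from \<open>g\<close> to a member \<open>b0\<close>
      of its coset shows that \<open>Z\<close> is nonempty.\<close>
    have "\<exists>b'\<in>?B. b' - b0 \<in> gsub d \<and> b' - b0 \<notin> gsub n" if nd: "n < d" for n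
    proof -
      obtain b' where b': "b' \<in> ?B" "b' - g \<in> gsub d" "b' - g \<notin> gsub (max n n1)"
        using ng[of "max n n1"] nd n1(1) by auto
      have "b' - b0 = (b' - g) - (b0 - g)" by simp
      then have "b' - b0 \<in> gsub d" using gsub_diff[OF b'(2) b0(2)] by metis
      moreover have "b' - b0 \<notin> gsub n"
      proof
        assume "b' - b0 \<in> gsub n"
        then have "(b' - b0) + (b0 - g) \<in> gsub (max n n1)"
          using n1(2) by (intro gsub_add) (auto simp: le_max_iff_disj elim: gsub_mono)
        then show False using b'(3) by simp
      qed
      ultimately show ?thesis using b'(1) by blast
    qed
    then have "b0 \<in> Z" using b0(1) by (simp add: Z_def)
    then obtain z where z: "z \<in> Z" "\<forall>b\<in>Z. z \<le> b"
      using wosD[OF wB, of Z] by (auto simp: Z_def)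
    have "\<And>n. n < d \<Longrightarrow> \<exists>a\<in>?B. a - z \<in> gsub d \<and> a - z \<notin> gsub n"
      using z(1) by (auto simp: Z_def)
    then obtain s where "escaping ?B z d s" using unbounded_seq[OF wB d(2)] by blast
    note s = escapingD[OF this]
    have words: "\<exists>xs. s n = sum_list xs \<and> set xs \<subseteq> A" for n
      using s(1)[of n] by (auto simp: monoid_gen_def)
    show False
    proof (cases "z \<in> gsub d")
      case True
      \<comment> \<open>Here all the words have sums in \<open>gsub d\<close>. Each letter is
        positive and at most its sum, so by convexity it lies in \<open>gsub d\<close>, and goodness
        of \<open>A\<close> at the coset of 0 puts all letters into one
        \<open>gsub n1\<close>.\<close>
      obtain n1 where n1: "n1 < d" "\<And>a. a \<in> A \<Longrightarrow> a - 0 \<in> gsub d \<Longrightarrow> a - 0 \<in> gsub n1"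
        using goodD[OF A d] by blast
      obtain n2 where n2: "n2 < d" "z \<in> gsub n2" using gsub_limit[OF d(2) True] by blast
      have "s n - z \<in> gsub (max n1 n2)" for n
      proof -
        obtain xs where xs: "s n = sum_list xs" "set xs \<subseteq> A" using words by blast
        have "sum_list xs \<in> gsub d" using gsub_add[OF s(3)[of n] True] xs(1) by simp
        moreover have "x \<le> sum_list xs" if "x \<in> set xs" for x
        proof -
          obtain ys zs where "xs = ys @ x # zs" using split_list[OF \<open>x \<in> set xs\<close>] by blast
          moreover have "0 \<le> sum_list ys" "0 \<le> sum_list zs"
            using xs(2) pos calculation by (auto intro!: sum_list_nonneg intro: less_imp_le)
          ultimately show ?thesis by (simp add: add_increasing add_increasing2)
        qed
        ultimately have "set xs \<subseteq> gsub d"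
          using xs(2) pos by (meson gsub_convex less_imp_le subset_iff)
        then have "set xs \<subseteq> gsub n1" using n1(2) xs(2) by auto
        then have "s n \<in> gsub n1" using gsub_sum_list xs(1) by simp
        then show ?thesis using n2(2) by (intro gsub_diff) (auto simp: le_max_iff_disj elim: gsub_mono)
      qed
      then show False using s(4)[of "max n1 n2"] n1(1) n2(1) by auto
    next
      case False
      \<comment> \<open>Now the sums lie outside \<open>gsub d\<close>, so every word has a letter
        outside \<open>gsub d\<close>; it is split off as \<open>a n\<close>.\<close>
      have "\<exists>a t. s n = a + t \<and> a \<in> A \<and> a \<notin> gsub d \<and> t \<in> ?B" for n
      proof -
        obtain xs where xs: "s n = sum_list xs" "set xs \<subseteq> A" using words by blast
        have "sum_list xs \<notin> gsub d" using gsub_diff[OF _ s(3)[of n], of "s n"] False xs(1) by auto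
        then obtain x where x: "x \<in> set xs" "x \<notin> gsub d" using gsub_sum_list by blast
        obtain ys zs where yz: "xs = ys @ x # zs" using split_list[OF x(1)] by blast
        have "sum_list (ys @ zs) \<in> ?B" 
          unfolding monoid_gen_def mem_Collect_eq using xs(2) yz by (intro exI[of _ "ys @ zs"]) auto
        moreover have "s n = x + sum_list (ys @ zs)" using xs(1) yz by (simp add: algebra_simps)
        ultimately show ?thesis using x xs(2) by blast
      qed
      then obtain a t where at: "\<And>n. s n = a n + t n" "\<And>n. a n \<in> A" "\<And>n. a n \<notin> gsub d" "\<And>n. t n \<in> ?B"
        by metis
      have "range a \<subseteq> A" "range t \<subseteq> ?B" using at by auto
      then obtain f :: "nat \<Rightarrow> nat" where f: "strict_mono f" "mono (\<lambda>n. a (f n))" "mono (\<lambda>n. t (f n))"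
        by (rule wos_mono_subseq2[OF wA wB])
      have dif: "a (f i) + t (f i) - (a (f 0) + t (f 0)) \<in> gsub d" for i
        using gsub_diff[OF s(3)[of "f i"] s(3)[of "f 0"]] by (simp add: at)
      note dat = gsub_mono_split[OF dif f(2,3) le0]
      obtain n1 where n1: "n1 < d" "\<And>x. x \<in> A \<Longrightarrow> x - a (f 0) \<in> gsub d \<Longrightarrow> x - a (f 0) \<in> gsub n1"
        using goodD[OF A d] by blast
      obtain n3 where n3: "n3 < d" "s (f 0) - z \<in> gsub n3" using gsub_limit[OF d(2) s(3)] by blast
      \<comment> \<open>The letters \<open>a (f i)\<close> have increments in one smaller subgroup;
        if the remainders did too, the sums would not escape.\<close>
      have "\<exists>b'\<in>?B. b' - t (f 0) \<in> gsub d \<and> b' - t (f 0) \<notin> gsub n" if "n < d" for n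
      proof (rule ccontr)
        assume "\<not> ?thesis"
        then have tn: "t (f i) - t (f 0) \<in> gsub n" for i using at(4) dat(2) by blast
        define k where "k = max n1 (max n n3)"
        have "k < d" using n1 n3 that by (simp add: k_def)
        have "s (f i) - z \<in> gsub k" for i
        proof -
          have "(a (f i) - a (f 0)) + (t (f i) - t (f 0)) + (s (f 0) - z) \<in> gsub k"
            using gsub_mono[OF n1(2)[OF at(2) dat(1)[of i]], of k] gsub_mono[OF tn[of i], of k]
              gsub_mono[OF n3(2), of k]
            by (intro gsub_add) (simp_all add: k_def le_max_iff_disj)
          then show ?thesis by (simp add: at algebra_simps)
        qed
        moreover obtain i where "\<forall>j\<ge>i. s j - z \<notin> gsub k" using s(4)[OF \<open>k < d\<close>] by blast
        ultimately show False using seq_suble[OF f(1), of i] by blast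
      qed
      then have "t (f 0) \<in> Z" using at(4) by (simp add: Z_def)
      \<comment> \<open>Minimality of \<open>z\<close> squeezes \<open>a (f 0)\<close> between 0 and
        an element of \<open>gsub d\<close>, although it lies outside \<open>gsub d\<close>.\<close>
      then have "z \<le> t (f 0)" using z(2) by blast
      then have "a (f 0) \<le> s (f 0) - z" using at(1)[of "f 0"] by (simp add: algebra_simps)
      then have "a (f 0) \<in> gsub d"
        using pos[OF at(2)] s(3) by (meson gsub_convex less_imp_le)
      then show False using at(3) by blast
    qed
  qed
qed

section \<open>Series with controlled supports\<close>

lemma hcoeff_sum: "hcoeff (sum f A) g = (\<Sum>a\<in>A. hcoeff (f a) g)"
  by (induction A rule: infinite_finite_induct) auto

definition hseries :: "omega1 set \<Rightarrow> (grp, 'a::comm_ring_1) hahn set" where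
  "hseries D = {x. good D (hsupp x)}"

lemma hseries_0 [simp]: "0 \<in> hseries D"
  unfolding hseries_def using good_subset[OF good_singleton, of "{}"] by (simp add: hsupp_def)

lemma hseries_hmono [simp]: "hmono g c \<in> hseries D"
  unfolding hseries_def using good_subset[OF good_singleton hsupp_hmono] by blast

lemma hseries_1 [simp]: "1 \<in> hseries D"
  unfolding one_hahn_def by (rule hseries_hmono)

lemma hseries_add: "x \<in> hseries D \<Longrightarrow> y \<in> hseries D \<Longrightarrow> x + y \<in> hseries D"
  unfolding hseries_def mem_Collect_eq
  by (rule good_subset[OF good_Un, of _ "hsupp x" "hsupp y"]) (auto simp: in_hsupp)

lemma hseries_uminus: "x \<in> hseries D \<Longrightarrow> - x \<in> hseries D"
  unfolding hseries_def mem_Collect_eq by (erule good_subset) (auto simp: in_hsupp)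

lemma hseries_diff: "x \<in> hseries D \<Longrightarrow> y \<in> hseries D \<Longrightarrow> x - y \<in> hseries D"
  using hseries_add[of x D "- y"] hseries_uminus[of y D] by simp

lemma hseries_mult: "x \<in> hseries D \<Longrightarrow> y \<in> hseries D \<Longrightarrow> x * y \<in> hseries D"
  unfolding hseries_def mem_Collect_eq
  by (rule good_subset[OF good_plus hsupp_mult_sub])

lemma hseries_sum: "(\<And>a. a \<in> A \<Longrightarrow> f a \<in> hseries D) \<Longrightarrow> sum f A \<in> hseries D"
  by (induction A rule: infinite_finite_induct) (auto intro: hseries_add)

lemma hseries_geometric:
  assumes "m \<in> hseries D" "\<And>g. g \<in> hsupp m \<Longrightarrow> 0 < g"
  obtains h where "h \<in> hseries D" "(1 - m) * h = 1" "\<And>g. g < 0 \<Longrightarrow> hcoeff h g = 0"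
proof -
  obtain h where h: "(1 - m) * h = 1" "hsupp h \<subseteq> monoid_gen (hsupp m)"
    using hahn_geometric[OF assms(2)] by blast
  have "good D (monoid_gen (hsupp m))"
    using assms by (intro good_monoid_gen) (auto simp: hseries_def)
  then have "h \<in> hseries D" unfolding hseries_def using h(2) good_subset by blast
  moreover have "hcoeff h g = 0" if "g < 0" for g
  proof (rule ccontr)
    assume "hcoeff h g \<noteq> 0"
    then have "g \<in> monoid_gen (hsupp m)" using h(2) in_hsupp by blast
    then show False using monoid_gen_nonneg[OF assms(2)] that by (metis leD)
  qed
  ultimately show thesis using that h(1) by blast
qed

text \<open>The support lies in some \<open>gsub n\<close>, and every element of
  \<open>gsub n\<close> exceeds \<open>- gbase n\<close>. Thus the monomials at the
  \<open>gbase n\<close> suffice as denominators.\<close>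

lemma hseries_lower:
  assumes "x \<in> hseries D"
  obtains n where "\<And>g. g < - gbase n \<Longrightarrow> hcoeff x g = 0"
proof -
  obtain n where n: "hsupp x \<subseteq> gsub n" using assms good_bounded unfolding hseries_def by blast
  have "hcoeff x g = 0" if "g < - gbase n" for g
  proof (rule ccontr)
    assume "hcoeff x g \<noteq> 0"
    then have "- g \<in> gsub n" using n gsub_uminus by (auto simp: in_hsupp subset_iff)
    then have "- g < gbase n" by (rule gsub_less_gbase)
    then show False using \<open>g < - gbase n\<close> by (metis less_asym less_minus_iff)
  qed
  then show thesis using that by blast
qed

section \<open>Values and division modulo a maximal ideal of coefficients\<close>

locale max_ideal =
  fixes I :: "'a::comm_ring_1 set"
  assumes I_0 [simp]: "0 \<in> I"
    and I_add: "a \<in> I \<Longrightarrow> b \<in> I \<Longrightarrow> a + b \<in> I"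
    and I_mult: "a \<in> I \<Longrightarrow> c * a \<in> I"
    and I_1 [simp]: "1 \<notin> I"
    and I_inverse: "a \<notin> I \<Longrightarrow> \<exists>b. a * b - 1 \<in> I"
begin

lemma I_mult2: "a \<in> I \<Longrightarrow> a * c \<in> I"
  using I_mult[of a c] by (simp add: mult.commute)

lemma I_uminus: "a \<in> I \<Longrightarrow> - a \<in> I"
  using I_mult[of a "-1"] by simp

lemma I_diff: "a \<in> I \<Longrightarrow> b \<in> I \<Longrightarrow> a - b \<in> I"
  using I_add[of a "- b"] I_uminus[of b] by simp

lemma I_sum: "(\<And>a. a \<in> A \<Longrightarrow> f a \<in> I) \<Longrightarrow> sum f A \<in> I"
  by (induction A rule: infinite_finite_induct) (auto intro: I_add)

lemma I_trans: "a - b \<in> I \<Longrightarrow> b - c \<in> I \<Longrightarrow> a - c \<in> I"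
  using I_add[of "a - b" "b - c"] by simp

lemma I_sym: "a - b \<in> I \<Longrightarrow> b - a \<in> I"
  using I_uminus[of "a - b"] by simp

lemma I_iff: "a - b \<in> I \<Longrightarrow> a \<in> I \<longleftrightarrow> b \<in> I"
  using I_add[of "a - b" b] I_diff[of a "a - b"] by auto

lemma I_mult_cong: "a - b \<in> I \<Longrightarrow> c - d \<in> I \<Longrightarrow> a * c - b * d \<in> I"
  using I_add[of "(a - b) * c" "b * (c - d)"] I_mult2[of "a - b" c] I_mult[of "c - d" b]
  by (simp add: algebra_simps)

lemma I_prime: assumes "a * b \<in> I" "a \<notin> I" shows "b \<in> I"
proof -
  obtain c where "a * c - 1 \<in> I" using I_inverse[OF assms(2)] by blast
  then have "(a * b) * c - (a * c - 1) * b \<in> I"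
    using I_diff[OF I_mult2[OF assms(1)] I_mult2] by blast
  then show ?thesis by (simp add: algebra_simps)
qed

text \<open>This says that the value is at least \<open>b\<close> when coefficients are read modulo
  \<open>I\<close>; \<open>null\<close> below is being zero in that sense. Exact coefficients may
  still be nonzero elements of \<open>I\<close>.\<close>

definition vanish :: "grp \<Rightarrow> (grp, 'a) hahn \<Rightarrow> bool" where
  "vanish b x \<longleftrightarrow> (\<forall>g<b. hcoeff x g \<in> I)"

definition null :: "(grp, 'a) hahn \<Rightarrow> bool" where
  "null x \<longleftrightarrow> (\<forall>g. hcoeff x g \<in> I)"

lemma vanish_0 [simp]: "vanish b 0" by (simp add: vanish_def)
lemma vanish_add: "vanish b x \<Longrightarrow> vanish b y \<Longrightarrow> vanish b (x + y)" by (simp add: vanish_def I_add)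
lemma vanish_diff: "vanish b x \<Longrightarrow> vanish b y \<Longrightarrow> vanish b (x - y)" by (simp add: vanish_def I_diff)
lemma vanish_uminus: "vanish b x \<Longrightarrow> vanish b (- x)" by (simp add: vanish_def I_uminus)
lemma vanish_mono: "vanish b x \<Longrightarrow> a \<le> b \<Longrightarrow> vanish a x" by (auto simp: vanish_def)
lemma vanish_sum: "(\<And>a. a \<in> A \<Longrightarrow> vanish b (f a)) \<Longrightarrow> vanish b (sum f A)"
  by (induction A rule: infinite_finite_induct) (auto intro: vanish_add)
lemma vanish_hmono: "b \<le> g \<Longrightarrow> vanish b (hmono g c)" by (auto simp: vanish_def hcoeff_hmono)
lemma vanish_1 [simp]: "vanish 0 1" unfolding one_hahn_def by (rule vanish_hmono) simp
lemma vanish_hmono_mult: "vanish b x \<Longrightarrow> vanish (h + b) (hmono h c * x)"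
  by (auto simp: vanish_def hcoeff_hmono_mult less_diff_eq diff_less_eq add.commute intro: I_mult)

lemma null_0 [simp]: "null 0" by (simp add: null_def)
lemma null_add: "null x \<Longrightarrow> null y \<Longrightarrow> null (x + y)" by (simp add: null_def I_add)
lemma null_diff: "null x \<Longrightarrow> null y \<Longrightarrow> null (x - y)" by (simp add: null_def I_diff)
lemma null_uminus: "null x \<Longrightarrow> null (- x)" by (simp add: null_def I_uminus)
lemma null_vanish: "null x \<Longrightarrow> vanish b x" by (simp add: null_def vanish_def)
lemma null_1 [simp]: "\<not> null 1"
  unfolding null_def by (auto intro!: exI[of _ 0] simp: hcoeff_1)

lemma vanish_cong: "vanish b (x - y) \<Longrightarrow> vanish b x \<longleftrightarrow> vanish b y"
  using vanish_add[of b "x - y" y] vanish_diff[of b x "x - y"] by auto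

lemma vanish_mult: assumes "vanish a x" "vanish b y" shows "vanish (a + b) (x * y)"
  unfolding vanish_def
proof (intro allI impI)
  fix g assume g: "g < a + b"
  have "hcoeff x u * hcoeff y (g - u) \<in> I" for u
  proof (cases "u < a")
    case True
    then show ?thesis using assms(1) by (auto simp: vanish_def intro: I_mult2)
  next
    case False
    then have "g - u < b" using g by (simp add: diff_less_eq add.commute not_less add_strict_increasing2 less_le_trans)
    then show ?thesis using assms(2) by (auto simp: vanish_def intro: I_mult)
  qed
  then show "hcoeff (x * y) g \<in> I" unfolding hcoeff_mult_raw by (intro I_sum)
qed

lemma null_mult: assumes "null x" shows "null (x * y)" "null (y * x)"
proof -
  show "null (x * y)"
    unfolding null_def hcoeff_mult_raw using assms by (auto simp: null_def intro!: I_sum I_mult2)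
  then show "null (y * x)" by (simp add: mult.commute)
qed

lemma null_mult_cong: "null (x - x') \<Longrightarrow> null (y - y') \<Longrightarrow> null (x * y - x' * y')"
  using null_add[OF null_mult(1)[of "x - x'" y] null_mult(2)[of "y - y'" x']]
  by (simp add: algebra_simps)

text \<open>In every other term of the convolution one of the two exponents is below its bound, so
  that coefficient is in \<open>I\<close>.\<close>

lemma lead_mult:
  assumes "vanish a x" "vanish b y"
  shows "hcoeff (x * y) (a + b) - hcoeff x a * hcoeff y b \<in> I"
proof -
  let ?T = "insert a {u. hcoeff x u \<noteq> 0 \<and> hcoeff y (a + b - u) \<noteq> 0}"
  have f: "finite ?T" by (simp add: finite_mult_index)
  have "hcoeff (x * y) (a + b) = (\<Sum>u\<in>?T. hcoeff x u * hcoeff y (a + b - u))"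
    by (rule hcoeff_mult[OF f]) auto
  also have "\<dots> = hcoeff x a * hcoeff y b + (\<Sum>u\<in>?T - {a}. hcoeff x u * hcoeff y (a + b - u))"
    by (subst sum.remove[OF f, of a]) auto
  finally have *: "hcoeff (x * y) (a + b) - hcoeff x a * hcoeff y b = (\<Sum>u\<in>?T - {a}. hcoeff x u * hcoeff y (a + b - u))"
    by simp
  have "hcoeff x u * hcoeff y (a + b - u) \<in> I" if "u \<noteq> a" for u
  proof (cases "u < a")
    case True
    then show ?thesis using assms(1) by (auto simp: vanish_def intro: I_mult2)
  next
    case False
    then have "a + b - u < b" using that by simp
    then show ?thesis using assms(2) by (auto simp: vanish_def intro: I_mult)
  qed
  then show ?thesis unfolding * by (intro I_sum) auto
qed

lemma order_ex:
  assumes "hcoeff x g \<notin> I"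
  obtains a where "vanish a x" "hcoeff x a \<notin> I" "a \<le> g"
proof -
  have sub: "{g. hcoeff x g \<notin> I} \<subseteq> hsupp x" by (auto simp: in_hsupp)
  obtain a where "a \<in> {g. hcoeff x g \<notin> I}" "\<forall>b\<in>{g. hcoeff x g \<notin> I}. a \<le> b"
    using wosD[OF wos_hsupp sub] assms by blast
  then show thesis using that[of a] assms by (auto simp: vanish_def not_le[symmetric])
qed

text \<open>Values add: if \<open>y\<close> had order \<open>c < b\<close>, the product would have
  at \<open>a + c\<close> a coefficient congruent to a product of two elements outside the prime
  ideal \<open>I\<close>.\<close>

lemma vanish_of_order:
  assumes "vanish a x" "hcoeff x a \<notin> I" "vanish (a + b) (x * y)"
  shows "vanish b y"
proof (rule ccontr)
  assume "\<not> vanish b y"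
  then obtain g where "g < b" "hcoeff y g \<notin> I" by (auto simp: vanish_def)
  then obtain c where c: "vanish c y" "hcoeff y c \<notin> I" "c < b" using order_ex by (metis le_less_trans)
  have "hcoeff (x * y) (a + c) \<in> I" using assms(3) c(3) by (simp add: vanish_def)
  then have "hcoeff x a * hcoeff y c \<in> I"
    using lead_mult[OF assms(1) c(1)] I_iff by blast
  then show False using I_prime assms(2) c(2) by blast
qed

text \<open>After normalisation to leading term 1 modulo \<open>I\<close>, the series is congruent
  to \<open>1 - m\<close> with \<open>m\<close> supported on positive exponents, and the geometric
  series inverts it.\<close>

lemma hseries_inverse:
  assumes x: "x \<in> hseries D" "vanish a x" "hcoeff x a \<notin> I"
  obtains y where "y \<in> hseries D" "null (x * y - 1)" "vanish (- a) y"
proof -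
  obtain c where c: "hcoeff x a * c - 1 \<in> I" using I_inverse[OF x(3)] by blast
  define z where "z = hmono (- a) c * x"
  have zc: "hcoeff z g = c * hcoeff x (g + a)" for g by (simp add: z_def hcoeff_hmono_mult)
  have zs: "z \<in> hseries D" using x(1) by (simp add: z_def hseries_mult)
  \<comment> \<open>Only positive exponents are kept: the remaining coefficients of \<open>z\<close>
    agree with those of 1 modulo \<open>I\<close>, but need not be equal to them.\<close>
  define m where "m = Hahn (\<lambda>g. if 0 < g then - hcoeff z g else 0)"
  have mc: "hcoeff m = (\<lambda>g. if 0 < g then - hcoeff z g else 0)"
    unfolding m_def by (rule hcoeff_Hahn[of "hsupp z"]) (auto simp: in_hsupp split: if_splits)
  have "hsupp m \<subseteq> hsupp z" by (auto simp: in_hsupp mc split: if_splits)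
  then have ms: "m \<in> hseries D" using zs good_subset unfolding hseries_def by blast
  have mp: "0 < g" if "g \<in> hsupp m" for g using that by (auto simp: in_hsupp mc split: if_splits)
  obtain h where h: "h \<in> hseries D" "(1 - m) * h = 1" "\<And>g. g < 0 \<Longrightarrow> hcoeff h g = 0"
    using hseries_geometric[OF ms mp] by blast
  have "null (z - (1 - m))"
    unfolding null_def
  proof
    fix g :: grp
    consider "g < 0" | "g = 0" | "0 < g" using linorder_less_linear by blast
    then show "hcoeff (z - (1 - m)) g \<in> I"
    proof cases
      case 1
      then have "hcoeff x (g + a) \<in> I" using x(2) by (simp add: vanish_def)
      then show ?thesis using 1 by (auto simp: hcoeff_1 mc zc I_mult)
    next
      case 2
      then show ?thesis using c by (simp add: hcoeff_1 mc zc mult.commute)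
    next
      case 3
      then show ?thesis by (auto simp: hcoeff_1 mc)
    qed
  qed
  then have n: "null (z * h - 1)"
    using null_mult(1)[of "z - (1 - m)" h] h(2) by (simp add: left_diff_distrib)
  show thesis
  proof (rule that[of "hmono (- a) c * h"])
    show "hmono (- a) c * h \<in> hseries D" using h(1) by (simp add: hseries_mult)
    show "null (x * (hmono (- a) c * h) - 1)" using n by (simp add: z_def ac_simps)
    have "vanish 0 h" using h(3) by (simp add: vanish_def)
    then show "vanish (- a) (hmono (- a) c * h)" using vanish_hmono_mult[of 0 h "- a" c] by simp
  qed
qed

lemma hseries_divide:
  assumes x: "x \<in> hseries D" "vanish a x" "hcoeff x a \<notin> I" and y: "y \<in> hseries D" "vanish (a + b) y"
  obtains z where "z \<in> hseries D" "vanish b z" "null (y - x * z)"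
proof -
  obtain w where w: "w \<in> hseries D" "null (x * w - 1)" "vanish (- a) w" using hseries_inverse[OF x] .
  show thesis
  proof (rule that[of "w * y"])
    show "w * y \<in> hseries D" using w y by (simp add: hseries_mult)
    show "vanish b (w * y)" using vanish_mult[OF w(3) y(2)] by simp
    show "null (y - x * (w * y))"
      using null_uminus[OF null_mult(1)[OF w(2), of y]] by (simp add: algebra_simps)
  qed
qed

section \<open>Completeness and incompleteness at limit ordinals\<close>

text \<open>The coefficient at \<open>g\<close> is read off from the first \<open>x n\<close> whose
  precision exceeds \<open>g\<close>. Goodness of the glued support at \<open>e < d\<close> is
  inherited from a single \<open>x N\<close>, and at \<open>e > d\<close> it holds since the support
  lies in \<open>gsub d\<close>; the case \<open>e = d\<close> is excluded by
  \<open>d \<notin> D\<close>.\<close>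

lemma complete_outside:
  fixes x :: "omega1 \<Rightarrow> (grp, 'a) hahn"
  assumes d: "limit_ord d" "d \<notin> D"
    and x: "\<And>n. n < d \<Longrightarrow> x n \<in> hseries D" "\<And>n. n < d \<Longrightarrow> vanish 0 (x n)"
    and cauchy: "\<And>m n. m < n \<Longrightarrow> n < d \<Longrightarrow> vanish (gbase m) (x n - x m)"
  obtains y where "y \<in> hseries D" "vanish 0 y" "\<And>n. n < d \<Longrightarrow> vanish (gbase n) (y - x n)"
proof -
  define lv where "lv g = (LEAST n. g < gbase n)" for g
  have lv: "lv g \<le> n" "g < gbase (lv g)" if "g < gbase n" for g n
    unfolding lv_def using that by (auto intro: Least_le LeastI)
  have lvd: "lv g < d" if "g \<in> gsub d" for g
    using gsub_limit[OF d(1) that] lv(1) gsub_less_gbase by (meson le_less_trans)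
  have cf: "hcoeff (x n) g - hcoeff (x (lv g)) g \<in> I" if "n < d" "g < gbase n" for n g
  proof (cases "lv g = n")
    case False
    then have "lv g < n" using lv(1)[OF that(2)] by simp
    then show ?thesis using cauchy[of "lv g" n] that lv(2)[OF that(2)] by (simp add: vanish_def)
  qed simp
  \<comment> \<open>Coefficients in \<open>I\<close> are dropped. The Cauchy condition preserves
    only being outside \<open>I\<close>, and this is what places \<open>g\<close> in the support of
    every sufficiently precise \<open>x n\<close>.\<close>
  define T where "T = {g \<in> gsub d. 0 \<le> g \<and> hcoeff (x (lv g)) g \<notin> I}"
  have Tsub: "g \<in> hsupp (x n)" if "g \<in> T" "n < d" "g < gbase n" for g n
    using cf[OF that(2,3)] that(1) I_iff[of "hcoeff (x n) g" "hcoeff (x (lv g)) g"]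
    by (auto simp: T_def in_hsupp)
  have wT: "wos T"
    unfolding wos_def
  proof (intro allI impI)
    fix B assume B: "B \<subseteq> T" "B \<noteq> {}"
    then obtain b where b: "b \<in> B" by blast
    then have bd: "b \<in> gsub d" using B(1) by (auto simp: T_def)
    obtain n where n: "n < d" "b < gbase n"
      using gsub_limit[OF d(1) bd] gsub_less_gbase by blast
    let ?B = "{c \<in> B. c < gbase n}"
    have "?B \<subseteq> hsupp (x n)" using Tsub[OF _ n(1)] B(1) by blast
    moreover have "?B \<noteq> {}" using b n(2) by blast
    ultimately obtain m where "m \<in> ?B" "\<forall>c\<in>?B. m \<le> c" using wosD[OF wos_hsupp] by blast
    then show "\<exists>m\<in>B. \<forall>b\<in>B. m \<le> b"
      by (metis (mono_tags, lifting) le_less_trans less_imp_le mem_Collect_eq not_less)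
  qed
  have "good D T"
    unfolding good_def
  proof (intro conjI ballI impI allI)
    show "wos T" by (rule wT)
    show "\<exists>n. T \<subseteq> gsub n" by (auto simp: T_def)
    fix e g assume e: "e \<in> D" "limit_ord e"
    show "\<exists>n<e. \<forall>a\<in>T. a - g \<in> gsub e \<longrightarrow> a - g \<in> gsub n"
    proof (cases "\<exists>a\<in>T. a - g \<in> gsub e")
      case False
      then show ?thesis using e(2) by (auto simp: limit_ord_def)
    next
      case True
      then obtain a0 where a0: "a0 \<in> T" "a0 - g \<in> gsub e" by blast
      have dif: "a - a0 \<in> gsub e" if "a - g \<in> gsub e" for a
        using gsub_diff[OF that a0(2)] by simp
      consider "e < d" | "d < e" using d(2) e(1) by (metis linorder_less_linear)
      then show ?thesis
      proof cases
        case 1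
        obtain k where k: "k < d" "a0 \<in> gsub k"
          using gsub_limit[OF d(1)] a0(1) by (auto simp: T_def)
        \<comment> \<open>All exponents in question differ from \<open>a0\<close> by elements of
          \<open>gsub e\<close>; hence they lie in \<open>gsub N\<close> and below the precision of
          \<open>x N\<close>.\<close>
        define N where "N = max k e"
        have N: "N < d" using k 1 by (simp add: N_def)
        have "good D (hsupp (x N))" using x(1)[OF N] by (simp add: hseries_def)
        then obtain n where n: "n < e" "\<And>a. a \<in> hsupp (x N) \<Longrightarrow> a - g \<in> gsub e \<Longrightarrow> a - g \<in> gsub n"
          using goodD e by blast
        have "a \<in> hsupp (x N)" if "a \<in> T" "a - g \<in> gsub e" for a
        proof -
          have "a0 + (a - a0) \<in> gsub N"
            using gsub_mono[OF k(2), of N] gsub_mono[OF dif[OF that(2)], of N]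
            by (intro gsub_add) (simp_all add: N_def)
          then show ?thesis using Tsub[OF that(1) N] gsub_less_gbase by simp
        qed
        then show ?thesis using n by blast
      next
        case 2
        obtain k where k: "k < e" "a0 - g \<in> gsub k" using gsub_limit[OF e(2) a0(2)] by blast
        have "a - g \<in> gsub (max k d)" if "a \<in> T" for a
        proof -
          have "a - a0 \<in> gsub d" using that a0(1) by (auto simp: T_def intro: gsub_diff)
          then have "(a - a0) + (a0 - g) \<in> gsub (max k d)"
            using gsub_mono[OF k(2), of "max k d"] gsub_mono[of "a - a0" d "max k d"]
            by (intro gsub_add) simp_all
          then show ?thesis by simp
        qed
        then show ?thesis using k(1) 2 by (intro exI[of _ "max k d"]) auto
      qed
    qed
  qed
  define y where "y = Hahn (\<lambda>g. if g \<in> T then hcoeff (x (lv g)) g else 0)"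
  have yc: "hcoeff y = (\<lambda>g. if g \<in> T then hcoeff (x (lv g)) g else 0)"
    unfolding y_def by (rule hcoeff_Hahn[OF wT]) (auto split: if_splits)
  show thesis
  proof (rule that[of y])
    have "hsupp y \<subseteq> T" by (auto simp: in_hsupp yc split: if_splits)
    then show "y \<in> hseries D" using \<open>good D T\<close> good_subset unfolding hseries_def by blast
    show "vanish 0 y" by (auto simp: vanish_def yc T_def)
    fix n assume n: "n < d"
    show "vanish (gbase n) (y - x n)"
      unfolding vanish_def
    proof (intro allI impI)
      fix g assume g: "g < gbase n"
      show "hcoeff (y - x n) g \<in> I"
      proof (cases "0 \<le> g")
        case False
        then show ?thesis using x(2)[OF n] by (auto simp: yc T_def vanish_def I_uminus)
      next
        case True
        then have gd: "g \<in> gsub d" using gsub_below_gbase g n by blast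
        show ?thesis
        proof (cases "g \<in> T")
          case True
          then show ?thesis using I_sym[OF cf[OF n g]] by (simp add: yc)
        next
          case False
          then have "hcoeff (x (lv g)) g \<in> I" using gd \<open>0 \<le> g\<close> by (auto simp: T_def)
          then have "hcoeff (x n) g \<in> I" using I_iff[OF cf[OF n g]] by simp
          then show ?thesis using False by (simp add: yc I_uminus)
        qed
      qed
    qed
  qed
qed

text \<open>The family consists of partial sums of monomials at \<open>gbase (c i)\<close> for a
  cofinal sequence \<open>c\<close> in \<open>d\<close>. A limit would have all these exponents in
  its support, contradicting goodness at the coset of 0.\<close>

lemma incomplete_inside:
  assumes d: "limit_ord d" "d \<in> D"
  obtains x :: "omega1 \<Rightarrow> (grp, 'a) hahn"
  where "\<And>n. x n \<in> hseries D" "\<And>n. vanish 0 (x n)"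
    and "\<And>m n. m < n \<Longrightarrow> n < d \<Longrightarrow> vanish (gbase m) (x n - x m)"
    and "\<And>y. y \<in> hseries D \<Longrightarrow> (\<And>n. n < d \<Longrightarrow> vanish (gbase n) (y - x n)) \<Longrightarrow> False"
proof -
  obtain c :: "nat \<Rightarrow> omega1" where c: "strict_mono c" "\<And>n. c n < d" "\<And>a. a < d \<Longrightarrow> \<exists>n. a < c n"
    by (rule limit_ord_cofinal[OF d(1)]) blast
  define J where "J n = {i. c i < n}" for n
  have fJ: "finite (J n)" if nd: "n < d" for n
  proof -
    obtain j where j: "n < c j" using c(3)[OF nd] by blast
    have "J n \<subseteq> {..<j}"
    proof
      fix i assume "i \<in> J n"
      then have "c i < c j" using j by (auto simp: J_def)
      then show "i \<in> {..<j}" using c(1) by (simp add: strict_mono_less)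
    qed
    then show ?thesis using finite_subset by blast
  qed
  define x :: "omega1 \<Rightarrow> (grp, 'a) hahn" where "x n = (\<Sum>i\<in>J n. hmono (gbase (c i)) 1)" for n
  show thesis
  proof (rule that[of x])
    show "x n \<in> hseries D" for n unfolding x_def by (intro hseries_sum) simp
    show "vanish 0 (x n)" for n unfolding x_def by (intro vanish_sum vanish_hmono) (simp add: less_imp_le)
    show "vanish (gbase m) (x n - x m)" if mn: "m < n" "n < d" for m n
    proof -
      have sub: "J m \<subseteq> J n" using mn(1) by (auto simp: J_def)
      have "x n - x m = (\<Sum>i\<in>J n - J m. hmono (gbase (c i)) 1)"
        unfolding x_def using sum_diff[OF fJ[OF mn(2)] sub, of "\<lambda>i. hmono (gbase (c i)) (1::'a)"] by simp
      moreover have "gbase m \<le> gbase (c i)" if "i \<in> J n - J m" for i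
        using that gbase_mono[of m "c i"] by (cases "m = c i") (auto simp: J_def not_less less_imp_le)
      ultimately show ?thesis by (auto intro!: vanish_sum vanish_hmono)
    qed
    fix y assume y: "y \<in> hseries D" "\<And>n. n < d \<Longrightarrow> vanish (gbase n) (y - x n)"
    have "gbase (c i) \<in> hsupp y" for i
    proof -
      \<comment> \<open>The partial sum at \<open>c (Suc i)\<close> already contains the
        \<open>i\<close>-th monomial, and its precision is beyond
        \<open>gbase (c i)\<close>.\<close>
      let ?n = "c (Suc i)"
      have ci: "c i < ?n" using c(1) by (simp add: strict_mono_less)
      have "hcoeff (x ?n) (gbase (c i)) = (\<Sum>j\<in>J ?n. if j = i then 1 else 0)"
        unfolding x_def hcoeff_sum hcoeff_hmono
      proof (rule sum.cong[OF refl])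
        fix j
        have "gbase (c i) = gbase (c j) \<longleftrightarrow> j = i"
          using gbase_mono[of "c i" "c j"] gbase_mono[of "c j" "c i"] c(1)
          by (cases i j rule: linorder_cases) (auto simp: strict_mono_less)
        then show "(if gbase (c i) = gbase (c j) then 1 else 0) = (if j = i then (1::'a) else 0)" by simp
      qed
      also have "\<dots> = 1" using fJ[OF c(2)[of "Suc i"]] ci by (simp add: J_def)
      finally have "hcoeff y (gbase (c i)) - 1 \<in> I"
        using y(2)[OF c(2)[of "Suc i"]] gbase_mono[OF ci] by (force simp: vanish_def)
      then have "hcoeff y (gbase (c i)) \<notin> I" using I_iff by fastforce
      then show ?thesis by (auto simp: in_hsupp)
    qed
    moreover obtain n where n: "n < d" "\<And>a. a \<in> hsupp y \<Longrightarrow> a - 0 \<in> gsub d \<Longrightarrow> a - 0 \<in> gsub n"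
      using goodD[of D "hsupp y" d 0] y(1) d by (auto simp: hseries_def)
    ultimately have "c i < n" for i using c(2) by force
    then show False using c(3)[OF n(1)] by (meson less_asym)
  qed
qed

end

section \<open>Infinite products and the coherent family of units\<close>

text \<open>The sums of finitely many distinct basis elements: the exponents that can arise when a
  product of binomials is multiplied out.\<close>

definition bits :: "grp set" where
  "bits = {g. \<forall>a. gcoord g a \<in> {0, 1}}"

lemma bits_zero [simp]: "0 \<in> bits" and bits_gbase [simp]: "gbase a \<in> bits"
  by (auto simp: bits_def gcoord_gbase)

lemma bits_coord: "g \<in> bits \<Longrightarrow> gcoord g a = 0 \<or> gcoord g a = 1"
  by (auto simp: bits_def)

lemma bits_monoid_gen: "bits \<subseteq> monoid_gen (range gbase)"
proof
  fix g assume "g \<in> bits"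
  moreover have "finite B \<Longrightarrow> \<forall>g. g \<in> bits \<and> {a. gcoord g a \<noteq> 0} = B \<longrightarrow> g \<in> monoid_gen (range gbase)" for B
  proof (induction B rule: finite_induct)
    case empty
    then show ?case using grp_eqI[of _ 0] by (metis (mono_tags, lifting) empty_iff gcoord_0 mem_Collect_eq zero_monoid_gen)
  next
    case (insert b B)
    show ?case
    proof (intro allI impI)
      fix g assume g: "g \<in> bits \<and> {a. gcoord g a \<noteq> 0} = insert b B"
      then have gb: "gcoord g b = 1" using bits_coord[of g b] by auto
      have "g - gbase b \<in> bits"
        using g gb by (auto simp: bits_def gcoord_gbase)
      moreover have "{a. gcoord (g - gbase b) a \<noteq> 0} = B"
        using g gb insert.hyps(2) by (auto simp: gcoord_gbase)
      ultimately have "gbase b + (g - gbase b) \<in> monoid_gen (range gbase)"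
        using insert.IH by (intro monoid_gen_add) auto
      then show "g \<in> monoid_gen (range gbase)" by simp
    qed
  qed
  ultimately show "g \<in> monoid_gen (range gbase)" using finite_gcoord by blast
qed

lemma wos_range_gbase: "wos (range gbase)"
  unfolding wos_def
proof (intro allI impI)
  fix B assume B: "B \<subseteq> range gbase" "B \<noteq> {}"
  then obtain a where "gbase a \<in> B" by blast
  then have "gbase (LEAST a. gbase a \<in> B) \<in> B" by (rule LeastI)
  moreover have "gbase (LEAST a. gbase a \<in> B) \<le> b" if "b \<in> B" for b
  proof -
    obtain c where c: "b = gbase c" using B(1) \<open>b \<in> B\<close> by blast
    then have "(LEAST a. gbase a \<in> B) \<le> c" using \<open>b \<in> B\<close> by (intro Least_le) simp
    then show ?thesis using gbase_mono c by (metis le_less)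
  qed
  ultimately show "\<exists>m\<in>B. \<forall>b\<in>B. m \<le> b" by blast
qed

text \<open>Neumann's lemma applies to the positive, well-ordered set of all
  \<open>gbase a\<close>.\<close>

lemma wos_bits: "wos bits"
  by (rule wos_subset[OF wos_monoid_gen[OF wos_range_gbase] bits_monoid_gen]) auto

lemma bits_nonneg: "g \<in> bits \<Longrightarrow> 0 \<le> g"
  by (rule monoid_gen_nonneg[of "range gbase"]) (use bits_monoid_gen in auto)

text \<open>The formal infinite product of the factors \<open>1 + k a X^(gbase a)\<close>, multiplied out.\<close>

definition hprod :: "(omega1 \<Rightarrow> 'a::comm_ring_1) \<Rightarrow> (grp, 'a) hahn" where
  "hprod k = Hahn (\<lambda>g. if g \<in> bits then \<Prod>a | gcoord g a \<noteq> 0. k a else 0)"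

lemma hcoeff_hprod: "hcoeff (hprod k) g = (if g \<in> bits then \<Prod>a | gcoord g a \<noteq> 0. k a else 0)"
  unfolding hprod_def by (subst hcoeff_Hahn[OF wos_bits]) (auto split: if_splits)

lemma hprod_0 [simp]: "hcoeff (hprod k) 0 = 1"
  by (simp add: hcoeff_hprod)

lemma hprod_gbase [simp]: "hcoeff (hprod k) (gbase a) = k a"
proof -
  have "{b. gcoord (gbase a) b \<noteq> 0} = {a}" by (auto simp: gcoord_gbase)
  then show ?thesis by (simp add: hcoeff_hprod)
qed

lemma gbase_neq_0 [simp]: "gbase a \<noteq> 0" "0 \<noteq> gbase a"
  using less_imp_neq[OF gbase_pos[of a]] by auto

lemma hprod_neg: "g < 0 \<Longrightarrow> hcoeff (hprod k) g = 0"
  unfolding hcoeff_hprod using bits_nonneg[of g] by (metis leD)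

text \<open>An exponent in \<open>bits\<close> either omits the index \<open>b\<close> or contains
  it once; the two cases match the two summands of the new factor.\<close>

lemma hprod_update:
  assumes k: "k b = 0"
  shows "hprod (k(b := c)) = hprod k * (1 + hmono (gbase b) c)"
proof (rule hahn_eqI)
  fix g
  have rhs: "hcoeff (hprod k * (1 + hmono (gbase b) c)) g = hcoeff (hprod k) g + c * hcoeff (hprod k) (g - gbase b)"
    by (simp add: distrib_left mult.commute[of _ "hmono _ _"] hcoeff_hmono_mult)
  have kz: "hcoeff (hprod k) h = 0" if "gcoord h b \<noteq> 0" for h
  proof -
    have "(\<Prod>a | gcoord h a \<noteq> 0. k a) = 0"
      using that k finite_gcoord by (intro prod_zero) auto
    then show ?thesis by (simp add: hcoeff_hprod)
  qed
  consider "g \<in> bits" "gcoord g b = 0" | "g \<in> bits" "gcoord g b = 1" | "g \<notin> bits"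
    using bits_coord by blast
  then show "hcoeff (hprod (k(b := c))) g = hcoeff (hprod k * (1 + hmono (gbase b) c)) g"
  proof cases
    case 1
    have "g - gbase b \<notin> bits" using 1(2) by (auto simp: bits_def gcoord_gbase intro!: exI[of _ b])
    moreover have "(\<Prod>a | gcoord g a \<noteq> 0. (k(b := c)) a) = (\<Prod>a | gcoord g a \<noteq> 0. k a)"
      using 1(2) by (intro prod.cong) auto
    ultimately show ?thesis unfolding rhs using 1(1) by (simp add: hcoeff_hprod)
  next
    case 2
    have m: "g - gbase b \<in> bits" using 2 by (auto simp: bits_def gcoord_gbase)
    have e: "{a. gcoord g a \<noteq> 0} = insert b {a. gcoord (g - gbase b) a \<noteq> 0}"
      using 2 by (auto simp: gcoord_gbase split: if_splits)
    have nb: "b \<notin> {a. gcoord (g - gbase b) a \<noteq> 0}" using 2 by (simp add: gcoord_gbase)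
    have "(\<Prod>a | gcoord g a \<noteq> 0. (k(b := c)) a) = c * (\<Prod>a | gcoord (g - gbase b) a \<noteq> 0. (k(b := c)) a)"
      unfolding e using nb by (subst prod.insert[OF finite_gcoord]) auto
    also have "(\<Prod>a | gcoord (g - gbase b) a \<noteq> 0. (k(b := c)) a) = (\<Prod>a | gcoord (g - gbase b) a \<noteq> 0. k a)"
      using nb by (intro prod.cong) auto
    finally show ?thesis unfolding rhs using kz[of g] 2 m by (simp add: hcoeff_hprod)
  next
    case 3
    have "hcoeff (hprod k) (g - gbase b) = 0"
    proof (cases "gcoord (g - gbase b) b = 0")
      case True
      then have "g - gbase b \<notin> bits"
        using 3 by (auto simp: bits_def gcoord_gbase split: if_splits)
      then show ?thesis by (simp add: hcoeff_hprod)
    qed (rule kz)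
    then show ?thesis unfolding rhs using 3 by (simp add: hcoeff_hprod)
  qed
qed

lemma hprod_finite_split:
  assumes "finite B"
  shows "hprod k = hprod (\<lambda>a. if a \<in> B then 0 else k a) * (\<Prod>a\<in>B. 1 + hmono (gbase a) (k a))"
  using assms
proof (induction B rule: finite_induct)
  case (insert b B)
  let ?k = "\<lambda>B a. if a \<in> B then 0 else k a"
  have "?k B = (?k (insert b B))(b := k b)" using insert.hyps(2) by auto
  then have "hprod (?k B) = hprod (?k (insert b B)) * (1 + hmono (gbase b) (k b))"
    using hprod_update[of "?k (insert b B)" b "k b"] by simp
  then show ?case using insert by (simp add: mult.assoc)
qed simp

text \<open>Once the finitely many factors at which \<open>k\<close> and \<open>l\<close> differ are
  removed, the two products coincide; cross-multiplying avoids division.\<close>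

lemma hprod_cross:
  assumes "finite {a. k a \<noteq> l a}" (is "finite ?B")
  shows "hprod k * (\<Prod>a | k a \<noteq> l a. 1 + hmono (gbase a) (l a)) =
         hprod l * (\<Prod>a | k a \<noteq> l a. 1 + hmono (gbase a) (k a))"
proof -
  have "(\<lambda>a. if a \<in> ?B then 0 else k a) = (\<lambda>a. if a \<in> ?B then 0 else l a)" by auto
  then show ?thesis
    using hprod_finite_split[OF assms, of k] hprod_finite_split[OF assms, of l] by (simp add: ac_simps)
qed

text \<open>A binary exponent containing an index \<open>a \<ge> n\<close> is at least
  \<open>gbase a\<close>, so below \<open>gbase n\<close> only factors with index below
  \<open>n\<close> contribute.\<close>

lemma hprod_local:
  assumes "\<And>a. a < n \<Longrightarrow> k a = l a" "g < gbase n"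
  shows "hcoeff (hprod k) g = hcoeff (hprod l) g"
proof (cases "g \<in> bits")
  case True
  have "a < n" if "gcoord g a \<noteq> 0" for a
  proof (rule ccontr)
    assume "\<not> a < n"
    then have "gbase n \<le> gbase a" using gbase_mono[of n a] by (metis le_less linorder_less_linear order_refl)
    moreover have "g - gbase a \<in> bits" using True that bits_coord[OF True, of a] by (auto simp: bits_def gcoord_gbase)
    then have "gbase a \<le> g" using bits_nonneg by fastforce
    ultimately show False using assms(2) by simp
  qed
  then have "(\<Prod>a | gcoord g a \<noteq> 0. k a) = (\<Prod>a | gcoord g a \<noteq> 0. l a)"
    using assms(1) by (intro prod.cong) auto
  then show ?thesis by (simp add: hcoeff_hprod)
qed (simp add: hcoeff_hprod)

section \<open>Coherent units and their transition factors\<close>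

locale coherent_units = max_ideal I for I :: "'a::comm_ring_1 set" +
  fixes D :: "omega1 set" and v :: "omega1 \<Rightarrow> omega1 \<Rightarrow> nat" and c :: "nat \<Rightarrow> 'a"
  assumes coherent: "m \<le> n \<Longrightarrow> finite {a. a < m \<and> v m a \<noteq> v n a}"
    and finite_to_one: "finite {a. a < n \<and> v n a \<le> i}"
    and c_inj: "c i - c j \<in> I \<Longrightarrow> i = j"
begin

definition R :: "(grp, 'a) hahn set" where
  "R = {x \<in> hseries D. vanish 0 x}"

lemma R_hseries: "x \<in> R \<Longrightarrow> x \<in> hseries D" and R_vanish: "x \<in> R \<Longrightarrow> vanish 0 x"
  by (auto simp: R_def)

lemma R_0 [simp]: "0 \<in> R" and R_1 [simp]: "1 \<in> R"
  by (auto simp: R_def)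

lemma R_add: "x \<in> R \<Longrightarrow> y \<in> R \<Longrightarrow> x + y \<in> R"
  and R_diff: "x \<in> R \<Longrightarrow> y \<in> R \<Longrightarrow> x - y \<in> R"
  and R_uminus: "x \<in> R \<Longrightarrow> - x \<in> R"
  by (auto simp: R_def hseries_add vanish_add hseries_diff vanish_diff hseries_uminus vanish_uminus)

lemma R_mult: "x \<in> R \<Longrightarrow> y \<in> R \<Longrightarrow> x * y \<in> R"
  using vanish_mult[of 0 x 0 y] by (auto simp: R_def hseries_mult)

lemma R_hmono: "0 \<le> g \<Longrightarrow> hmono g b \<in> R"
  by (auto simp: R_def vanish_hmono)

lemma R_vanish_mult: "f \<in> R \<Longrightarrow> vanish b x \<Longrightarrow> vanish b (f * x)"
  using vanish_mult[of 0 f b x] by (auto simp: R_def)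

definition u :: "omega1 \<Rightarrow> (grp, 'a) hahn" where
  "u n = hprod (\<lambda>a. if a < n then c (v n a) else 0)"

lemma u_vanish: "vanish 0 (u n)"
  by (auto simp: vanish_def u_def hprod_neg)

lemma factor_R: "(\<Prod>a\<in>B. 1 + hmono (gbase a) (l a)) \<in> R"
  by (induction B rule: infinite_finite_induct) (auto intro!: R_mult R_add R_hmono less_imp_le)

lemma factor_unit: "hcoeff (\<Prod>a\<in>B. 1 + hmono (gbase a) (l a)) 0 - 1 \<in> I"
proof (induction B rule: infinite_finite_induct)
  case (insert b B)
  let ?P = "\<Prod>a\<in>B. 1 + hmono (gbase a) (l a)"
  have 1: "hcoeff (1 + hmono (gbase b) (l b)) 0 = 1"
    by (auto simp: hcoeff_1 hcoeff_hmono)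
  have "1 + hmono (gbase b) (l b) \<in> R" by (intro R_add R_hmono) (auto simp: less_imp_le)
  then have "hcoeff ((1 + hmono (gbase b) (l b)) * ?P) (0 + 0) - hcoeff (1 + hmono (gbase b) (l b)) 0 * hcoeff ?P 0 \<in> I"
    using factor_R by (intro lead_mult R_vanish)
  then have "hcoeff ((1 + hmono (gbase b) (l b)) * ?P) 0 - hcoeff ?P 0 \<in> I"
    unfolding 1 by simp
  from I_trans[OF this insert.IH] show ?case using insert.hyps by simp
qed (auto simp: hcoeff_1)

lemma unit_not_I: "a - 1 \<in> I \<Longrightarrow> a \<notin> I"
  using I_iff[of a 1] by simp

text \<open>Truncated to indices below \<open>m\<close>, the two products differ in finitely many
  factors. The factor \<open>e\<close> is the quotient of the two finite products over these
  indices, and truncating \<open>u n\<close> is invisible below \<open>gbase m\<close>.\<close>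

lemma transition:
  assumes mn: "m \<le> n"
  obtains e where "e \<in> R" "hcoeff e 0 \<notin> I" "vanish (gbase m) (u m - e * u n)"
proof -
  define k where "k a = (if a < m then c (v m a) else 0)" for a
  define l where "l a = (if a < m then c (v n a) else 0)" for a
  have "{a. k a \<noteq> l a} \<subseteq> {a. a < m \<and> v m a \<noteq> v n a}" by (auto simp: k_def l_def)
  then have fin: "finite {a. k a \<noteq> l a}" using coherent[OF mn] finite_subset by blast
  define P where "P = (\<Prod>a | k a \<noteq> l a. 1 + hmono (gbase a) (k a))"
  define Q where "Q = (\<Prod>a | k a \<noteq> l a. 1 + hmono (gbase a) (l a))"
  have P: "P \<in> R" "hcoeff P 0 - 1 \<in> I" and Q: "Q \<in> R" "hcoeff Q 0 - 1 \<in> I"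
    unfolding P_def Q_def by (rule factor_R factor_unit)+
  have um: "u m = hprod k" by (simp add: u_def k_def[abs_def])
  have cross: "u m * Q = hprod l * P"
    unfolding um P_def Q_def by (rule hprod_cross[OF fin])
  have loc: "vanish (gbase m) (hprod l - u n)"
    unfolding vanish_def u_def
  proof (intro allI impI)
    fix g assume "g < gbase m"
    then have "hcoeff (hprod l) g = hcoeff (hprod (\<lambda>a. if a < n then c (v n a) else 0)) g"
      using mn by (intro hprod_local[of m]) (auto simp: l_def)
    then show "hcoeff (hprod l - hprod (\<lambda>a. if a < n then c (v n a) else 0)) g \<in> I" by simp
  qed
  obtain w where w: "w \<in> hseries D" "null (Q * w - 1)" "vanish (- 0) w"
    using hseries_inverse[OF R_hseries[OF Q(1)] R_vanish[OF Q(1)] unit_not_I[OF Q(2)]] .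
  have wR: "w \<in> R" using w by (simp add: R_def)
  have wu: "hcoeff w 0 \<notin> I"
  proof
    assume "hcoeff w 0 \<in> I"
    then have "hcoeff Q 0 * hcoeff w 0 \<in> I" by (rule I_mult)
    moreover have "hcoeff (Q * w) 0 - hcoeff Q 0 * hcoeff w 0 \<in> I"
      using lead_mult[of 0 Q 0 w] R_vanish[OF Q(1)] R_vanish[OF wR] by simp
    ultimately have "hcoeff (Q * w) 0 \<in> I" using I_iff by blast
    moreover have "hcoeff (Q * w) 0 - 1 \<in> I"
      using w(2) by (auto simp: null_def hcoeff_1 dest: spec[of _ 0])
    ultimately show False using unit_not_I by blast
  qed
  show thesis
  proof (rule that[of "P * w"])
    show "P * w \<in> R" using P wR by (simp add: R_mult)
    show "hcoeff (P * w) 0 \<notin> I"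
    proof
      assume "hcoeff (P * w) 0 \<in> I"
      then have "hcoeff P 0 * hcoeff w 0 \<in> I"
        using lead_mult[of 0 P 0 w] R_vanish[OF P(1)] R_vanish[OF wR] I_iff by fastforce
      then show False using I_prime unit_not_I[OF P(2)] wu by blast
    qed
    have "u m * (Q * w) = P * w * hprod l"
      using arg_cong[OF cross, of "\<lambda>z. z * w"] by (simp add: ac_simps)
    then have "u m - P * w * u n = - (u m * (Q * w - 1)) + (P * w) * (hprod l - u n)"
      by (simp add: right_diff_distrib)
    moreover have "vanish (gbase m) (- (u m * (Q * w - 1)))"
      by (intro vanish_uminus null_vanish null_mult w)
    moreover have "vanish (gbase m) ((P * w) * (hprod l - u n))"
      using P wR by (intro R_vanish_mult R_mult loc)
    ultimately show "vanish (gbase m) (u m - P * w * u n)" using vanish_add by metis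
  qed
qed

section \<open>The generators and the module they span\<close>

definition gen :: "omega1 \<Rightarrow> (grp, 'a) hahn" where
  "gen n = hmono (- gbase n) 1 * u n"

lemma gen_order: "vanish (- gbase n) (gen n)" "hcoeff (gen n) (- gbase n) = 1"
  using vanish_hmono_mult[OF u_vanish, of "- gbase n" 1 n]
  by (simp_all add: gen_def hcoeff_hmono_mult) (simp add: u_def)

text \<open>Multiplication by the monomial at \<open>- gbase m\<close> turns precision
  \<open>gbase m\<close> into precision 0, so \<open>gen m\<close> becomes a multiple of
  \<open>gen n\<close> modulo series of nonnegative value.\<close>

lemma gen_transition:
  assumes mn: "m \<le> n" and e: "e \<in> R" "vanish (gbase m) (u m - e * u n)"
  shows "hmono (gbase n - gbase m) 1 * e \<in> R"
    and "vanish 0 (gen m - hmono (gbase n - gbase m) 1 * e * gen n)"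
proof -
  have "gbase m \<le> gbase n" using mn gbase_mono[of m n] by (metis le_less)
  then show "hmono (gbase n - gbase m) 1 * e \<in> R" using e by (intro R_mult R_hmono) auto
  have "hmono (gbase n - gbase m) 1 * e * gen n = (hmono (gbase n - gbase m) 1 * hmono (- gbase n) 1) * (e * u n)"
    by (simp only: gen_def ac_simps)
  also have "\<dots> = hmono (- gbase m) 1 * (e * u n)"
    by (simp add: hmono_mult_hmono)
  finally have "hmono (- gbase m) 1 * (u m - e * u n) = gen m - hmono (gbase n - gbase m) 1 * e * gen n"
    by (simp add: gen_def right_diff_distrib)
  then show "vanish 0 (gen m - hmono (gbase n - gbase m) 1 * e * gen n)"
    using vanish_hmono_mult[OF e(2), of "- gbase m" 1] by simp
qed

text \<open>All series of nonnegative value are included, so \<open>M\<close> is the preimage of the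
  intended quotient module. It is taken in the full ring of Hahn series, as \<open>gen n\<close>
  need not have an admissible support.\<close>

definition M :: "(grp, 'a) hahn set" where
  "M = {x. \<exists>n. \<exists>f\<in>R. vanish 0 (x - f * gen n)}"

lemma M_I: "f \<in> R \<Longrightarrow> vanish 0 (x - f * gen n) \<Longrightarrow> x \<in> M"
  by (auto simp: M_def)

lemma gen_M: "gen n \<in> M"
  by (rule M_I[of 1 _ n]) auto

lemma vanish_M: "vanish 0 x \<Longrightarrow> x \<in> M"
  by (rule M_I[of 0]) auto

lemma M_raise:
  assumes "f \<in> R" "vanish 0 (x - f * gen m)" "m \<le> n"
  obtains h where "h \<in> R" "vanish 0 (x - h * gen n)"
proof -
  obtain e where e: "e \<in> R" "vanish (gbase m) (u m - e * u n)" using transition[OF assms(3)] by metis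
  let ?e = "hmono (gbase n - gbase m) 1 * e"
  have eR: "?e \<in> R" and v: "vanish 0 (gen m - ?e * gen n)" using gen_transition[OF assms(3) e] by auto
  have "x - f * ?e * gen n = (x - f * gen m) + f * (gen m - ?e * gen n)" by (simp add: algebra_simps)
  then have "vanish 0 (x - f * ?e * gen n)"
    using vanish_add[OF assms(2) R_vanish_mult[OF assms(1) v]] by metis
  then show thesis using that R_mult[OF assms(1) eR] by blast
qed

text \<open>By \<open>M_raise\<close> a representation over one generator can be moved to any later
  one, so the maximum of two indices serves both elements.\<close>

lemma M_common:
  assumes "x \<in> M" "y \<in> M"
  obtains n f h where "f \<in> R" "h \<in> R" "vanish 0 (x - f * gen n)" "vanish 0 (y - h * gen n)"
proof -
  obtain m f where f: "f \<in> R" "vanish 0 (x - f * gen m)" using assms(1) by (auto simp: M_def)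
  obtain l h where h: "h \<in> R" "vanish 0 (y - h * gen l)" using assms(2) by (auto simp: M_def)
  show thesis
    using M_raise[OF f max.cobounded1[of m l]] M_raise[OF h max.cobounded2[of l m]] that by metis
qed

lemma M_add: assumes "x \<in> M" "y \<in> M" shows "x + y \<in> M"
proof -
  obtain n f h where f: "f \<in> R" "h \<in> R" "vanish 0 (x - f * gen n)" "vanish 0 (y - h * gen n)"
    using M_common[OF assms] .
  have "x + y - (f + h) * gen n = (x - f * gen n) + (y - h * gen n)" by (simp add: algebra_simps)
  then show ?thesis using vanish_add[OF f(3,4)] R_add[OF f(1,2)] M_I by metis
qed

lemma M_smult: assumes "f \<in> R" "x \<in> M" shows "f * x \<in> M"
proof -
  obtain n h where h: "h \<in> R" "vanish 0 (x - h * gen n)" using assms(2) by (auto simp: M_def)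
  have "f * x - f * h * gen n = f * (x - h * gen n)" by (simp add: algebra_simps)
  then show ?thesis using R_vanish_mult[OF assms(1) h(2)] R_mult[OF assms(1) h(1)] M_I by metis
qed

lemma M_uminus: "x \<in> M \<Longrightarrow> - x \<in> M"
  using M_smult[of "- 1" x] R_uminus[OF R_1] by simp

text \<open>Of two series that are nonzero modulo \<open>I\<close>, the one of smaller order divides
  the other.\<close>

lemma R_total:
  assumes f: "f \<in> R" and h: "h \<in> R"
  obtains q where "q \<in> R" "null (f - q * h) \<or> null (h - q * f)"
proof -
  have div: "\<exists>q\<in>R. null (y - q * x)"
    if xy: "x \<in> R" "vanish a x" "hcoeff x a \<notin> I" "y \<in> R" "vanish a y" for x y a
  proof -
    obtain z where "z \<in> hseries D" "vanish 0 z" "null (y - x * z)"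
      using hseries_divide[OF R_hseries[OF xy(1)] xy(2,3) R_hseries[OF xy(4)], of 0] xy(5) by auto
    then show ?thesis by (auto simp: R_def mult.commute)
  qed
  show thesis
  proof (cases "null f \<or> null h")
    case True
    then show thesis using that[of 0] by auto
  next
    case False
    obtain a where a: "vanish a f" "hcoeff f a \<notin> I" using False order_ex unfolding null_def by metis
    obtain b where b: "vanish b h" "hcoeff h b \<notin> I" using False order_ex unfolding null_def by metis
    show thesis
    proof (cases "a \<le> b")
      case True
      then show thesis using div[OF f a h] vanish_mono[OF b(1)] that by blast
    next
      case False
      then show thesis using div[OF h b f] vanish_mono[OF a(1), of b] that by auto
    qed
  qed
qed

text \<open>Over a common generator, divisibility of the coefficients in \<open>R\<close> passes to
  the elements; this is the source of uniseriality.\<close>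

lemma M_total:
  assumes "x \<in> M" "y \<in> M"
  obtains q where "q \<in> R" "vanish 0 (x - q * y) \<or> vanish 0 (y - q * x)"
proof -
  obtain n f h where f: "f \<in> R" "h \<in> R" "vanish 0 (x - f * gen n)" "vanish 0 (y - h * gen n)"
    using M_common[OF assms] .
  have *: "vanish 0 (x - q * y)"
    if "q \<in> R" "null (f - q * h)" "vanish 0 (x - f * gen n)" "vanish 0 (y - h * gen n)" for x y f h q
  proof -
    have "x - q * y = (x - f * gen n) + (f - q * h) * gen n - q * (y - h * gen n)"
      by (simp add: algebra_simps)
    then show ?thesis
      using that by (metis vanish_diff vanish_add null_vanish null_mult(1) R_vanish_mult)
  qed
  obtain q where "q \<in> R" "null (f - q * h) \<or> null (h - q * f)" using R_total[OF f(1,2)] .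
  then show thesis using that *[OF _ _ f(3,4)] *[OF _ _ f(4,3)] by blast
qed

lemma gen_annihilator: "vanish 0 (f * gen n) \<longleftrightarrow> vanish (gbase n) f"
proof
  assume "vanish 0 (f * gen n)"
  then show "vanish (gbase n) f"
    using vanish_of_order[OF gen_order(1)[of n], of "gbase n" f] gen_order(2)[of n] by (simp add: mult.commute)
next
  assume "vanish (gbase n) f"
  then show "vanish 0 (f * gen n)" using vanish_mult[OF _ gen_order(1)[of n]] by force
qed

section \<open>Impossibility of a trivialisation by units\<close>

text \<open>Only the exponent 0 of \<open>d\<close> contributes modulo \<open>I\<close>. A
  contributing \<open>a \<ge> 0\<close> is at most \<open>gbase b\<close>, hence in
  \<open>gsub n\<close> and therefore in \<open>gsub g\<close>, so it has no coordinate at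
  \<open>b\<close>; as \<open>gbase b - a\<close> is binary, so is \<open>- a\<close>, which forces
  \<open>a = 0\<close>.\<close>

lemma coeff_gbase_mult:
  assumes d: "d \<in> R" and sm: "\<And>a. a \<in> hsupp d \<Longrightarrow> a \<in> gsub n \<Longrightarrow> a \<in> gsub g"
    and b: "g \<le> b" "b < n"
  shows "hcoeff (d * hprod k) (gbase b) - hcoeff d 0 * k b \<in> I"
proof -
  let ?T = "insert 0 {a. hcoeff d a \<noteq> 0 \<and> hcoeff (hprod k) (gbase b - a) \<noteq> 0}"
  have f: "finite ?T" by (simp add: finite_mult_index)
  have "hcoeff (d * hprod k) (gbase b) = (\<Sum>a\<in>?T. hcoeff d a * hcoeff (hprod k) (gbase b - a))"
    by (rule hcoeff_mult[OF f]) auto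
  also have "\<dots> = hcoeff d 0 * k b + (\<Sum>a\<in>?T - {0}. hcoeff d a * hcoeff (hprod k) (gbase b - a))"
    by (subst sum.remove[OF f, of 0]) auto
  finally have *: "hcoeff (d * hprod k) (gbase b) - hcoeff d 0 * k b =
      (\<Sum>a\<in>?T - {0}. hcoeff d a * hcoeff (hprod k) (gbase b - a))" by simp
  have "hcoeff d a * hcoeff (hprod k) (gbase b - a) \<in> I" if a: "a \<in> ?T - {0}" for a
  proof (cases "0 \<le> a")
    case False
    then show ?thesis using R_vanish[OF d] by (intro I_mult2) (auto simp: vanish_def)
  next
    case True
    have bt: "gbase b - a \<in> bits" using a by (auto simp: hcoeff_hprod split: if_splits)
    then have "a \<le> gbase b" using bits_nonneg by fastforce
    then have "a \<in> gsub n" using True b(2) by (intro gsub_convex[of a "gbase b"]) auto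
    then have "a \<in> gsub g" using sm a by (auto simp: in_hsupp)
    then have ab: "gcoord a b = 0" using b(1) by (auto simp: gsub_def)
    have "- a \<in> bits"
      unfolding bits_def
    proof (intro CollectI allI)
      fix x
      show "gcoord (- a) x \<in> {0, 1}"
        using bits_coord[OF bt, of x] ab by (cases "x = b") (auto simp: gcoord_gbase)
    qed
    then have "a \<le> 0" using bits_nonneg by fastforce
    then show ?thesis using True a by auto
  qed
  then show ?thesis unfolding * by (intro I_sum)
qed

text \<open>Pressing down provides unboundedly many \<open>n\<close> for which the
  \<open>v n\<close> agree above one fixed \<open>g\<close>; glued together they would be a map from
  an uncountable set to the naturals that is finite-to-one on bounded parts.\<close>

lemma no_trivialization:
  assumes S: "w1_stationary S" and DS: "D = {d. limit_ord d \<and> Rep_omega1 d \<in> S}"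
    and d: "\<And>n. d n \<in> R" "\<And>n. hcoeff (d n) 0 \<notin> I"
    and eq: "\<And>m n. m < n \<Longrightarrow> vanish (gbase m) (d m * u n - d n * u m)"
  shows False
proof -
  \<comment> \<open>Goodness of the support of \<open>d n\<close> at the coset of 0 supplies the
    regressive function.\<close>
  have "\<exists>g. n \<in> D \<longrightarrow> g < n \<and> (\<forall>a\<in>hsupp (d n). a \<in> gsub n \<longrightarrow> a \<in> gsub g)" for n
  proof (cases "n \<in> D")
    case True
    have "good D (hsupp (d n))" using R_hseries[OF d(1)] by (simp add: hseries_def)
    then obtain g where "g < n" "\<And>a. a \<in> hsupp (d n) \<Longrightarrow> a - 0 \<in> gsub n \<Longrightarrow> a - 0 \<in> gsub g"
      using goodD[of D _ n 0] True DS by blast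
    then show ?thesis by auto
  qed auto
  then obtain f where f: "\<And>n. n \<in> D \<Longrightarrow> f n < n"
    "\<And>n a. n \<in> D \<Longrightarrow> a \<in> hsupp (d n) \<Longrightarrow> a \<in> gsub n \<Longrightarrow> a \<in> gsub (f n)"
    by metis
  obtain g where g: "\<And>a. \<exists>n>a. Rep_omega1 n \<in> S \<and> limit_ord n \<and> f n = g"
    using pressing_down[OF S, of f] f(1) DS by auto
  define T where "T = {n \<in> D. f n = g}"
  have Tub: "\<exists>n\<in>T. a < n" for a using g[of a] by (auto simp: T_def DS)
  \<comment> \<open>Coefficients at 0 show that \<open>d m\<close> and \<open>d n\<close> have the
    same constant term modulo \<open>I\<close>. Those at \<open>gbase b\<close> then identify
    \<open>c (v m b)\<close> with \<open>c (v n b)\<close> modulo \<open>I\<close>, and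
    \<open>c_inj\<close> applies.\<close>
  have agree: "v m b = v n b" if mn: "m \<in> T" "n \<in> T" "m < n" and b: "g \<le> b" "b < m" for m n b
  proof -
    have sm: "a \<in> gsub g" if "x \<in> T" "a \<in> hsupp (d x)" "a \<in> gsub x" for a x
      using f(2) that by (auto simp: T_def)
    have bn: "b < n" using b mn(3) by simp
    have co: "hcoeff (d m * u n) (gbase b) - hcoeff (d m) 0 * c (v n b) \<in> I"
      using coeff_gbase_mult[OF d(1)[of m] sm[OF mn(1)] b, of "\<lambda>a. if a < n then c (v n a) else 0"] bn
      by (simp add: u_def)
    have co': "hcoeff (d n * u m) (gbase b) - hcoeff (d n) 0 * c (v m b) \<in> I"
      using coeff_gbase_mult[OF d(1)[of n] sm[OF mn(2)] b(1) bn, of "\<lambda>a. if a < m then c (v m a) else 0"] b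
      by (simp add: u_def)
    have z: "hcoeff (d x * u y) 0 - hcoeff (d x) 0 \<in> I" for x y
      using lead_mult[OF R_vanish[OF d(1)[of x]] u_vanish[of y]] by (simp add: u_def)
    have "hcoeff (d m * u n) 0 - hcoeff (d n * u m) 0 \<in> I"
      using eq[OF mn(3)] by (auto simp: vanish_def)
    then have d0: "hcoeff (d m) 0 - hcoeff (d n) 0 \<in> I"
      using z I_trans I_sym by meson
    have "hcoeff (d m * u n) (gbase b) - hcoeff (d n * u m) (gbase b) \<in> I"
      using eq[OF mn(3)] gbase_mono[OF b(2)] by (auto simp: vanish_def)
    then have 1: "hcoeff (d m) 0 * c (v n b) - hcoeff (d n) 0 * c (v m b) \<in> I"
      using co co' I_trans I_sym by meson
    have "hcoeff (d n) 0 * c (v m b) - hcoeff (d m) 0 * c (v m b) \<in> I"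
      using I_mult_cong[OF I_sym[OF d0], of "c (v m b)" "c (v m b)"] by simp
    then have "hcoeff (d m) 0 * (c (v n b) - c (v m b)) \<in> I"
      using I_trans[OF 1] by (simp add: right_diff_distrib)
    then show ?thesis using I_prime d(2) c_inj by metis
  qed
  \<comment> \<open>By \<open>agree\<close> any \<open>n \<in> T\<close> beyond
    \<open>a \<ge> g\<close> gives the same value at \<open>a\<close>; the first one is used to
    define the glued function \<open>w\<close>.\<close>
  define nx where "nx a = (LEAST n. n \<in> T \<and> a < n)" for a
  have nx: "nx a \<in> T" "a < nx a" "\<And>n. n \<in> T \<Longrightarrow> a < n \<Longrightarrow> nx a \<le> n" for a
    using LeastI_ex[of "\<lambda>n. n \<in> T \<and> a < n"] Tub unfolding nx_def by (blast intro: Least_le)+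
  define w where "w a = v (nx a) a" for a
  have w: "w a = v n a" if "n \<in> T" "g \<le> a" "a < n" for a n
    using agree[OF nx(1) that(1) _ that(2) nx(2)] nx(3)[OF that(1,3)] by (metis le_less w_def)
  have "uncountable {g..}"
  proof
    assume "countable {g..}"
    then have "countable ({..<g} \<union> {g..})" by simp
    moreover have "{..<g} \<union> {g..} = UNIV" by auto
    ultimately show False using uncountable_omega1 by simp
  qed
  have "\<exists>i. uncountable {a. g \<le> a \<and> w a = i}"
  proof (rule ccontr)
    assume "\<nexists>i. uncountable {a. g \<le> a \<and> w a = i}"
    then have "countable (\<Union>i. {a. g \<le> a \<and> w a = i})" by (intro countable_UN) auto
    moreover have "(\<Union>i. {a. g \<le> a \<and> w a = i}) = {g..}" by auto
    ultimately show False using \<open>uncountable {g..}\<close> by simp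
  qed
  then obtain i where "uncountable {a. g \<le> a \<and> w a = i}" by blast
  then have "infinite {a. g \<le> a \<and> w a = i}" using countable_finite by blast
  \<comment> \<open>A countably infinite part of the uncountable fibre is bounded, so it lies below
    a single \<open>n \<in> T\<close>, where \<open>v n\<close> is finite-to-one.\<close>
  then obtain s :: "nat \<Rightarrow> omega1" where s: "inj s" "range s \<subseteq> {a. g \<le> a \<and> w a = i}"
    using infinite_countable_subset by blast
  obtain b where b: "\<And>x. x \<in> range s \<Longrightarrow> x < b"
    using countable_bounded_omega1[of "range s"] by auto
  obtain n where n: "n \<in> T" "b < n" using Tub by blast
  have "range s \<subseteq> {a. a < n \<and> v n a \<le> i}"
  proof
    fix x assume x: "x \<in> range s"
    then have "g \<le> x" "w x = i" using s(2) by auto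
    moreover have "x < n" using b[OF x] n(2) by simp
    ultimately show "x \<in> {a. a < n \<and> v n a \<le> i}" using w[OF n(1)] by auto
  qed
  then have "finite (range s)" using finite_to_one finite_subset by blast
  then show False using s(1) finite_imageD[of s UNIV] infinite_UNIV_nat by simp
qed

end

section \<open>The valuation domain\<close>

text \<open>The maps \<open>psi\<close> and \<open>psiM\<close> name the classes of series modulo
  null series, and those of \<open>M\<close> modulo nonnegative value, by elements of
  \<open>'k\<close>, so that field and module become records over that type.\<close>

locale transported = coherent_units I D v c
  for I :: "'a::comm_ring_1 set" and D v c +
  fixes psi psiM :: "(grp, 'a) hahn \<Rightarrow> 'k"
  assumes psi_eq: "x \<in> hseries D \<Longrightarrow> y \<in> hseries D \<Longrightarrow> psi x = psi y \<longleftrightarrow> null (x - y)"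
    and psiM_eq: "x \<in> M \<Longrightarrow> y \<in> M \<Longrightarrow> psiM x = psiM y \<longleftrightarrow> vanish 0 (x - y)"
begin

definition lift :: "'k \<Rightarrow> (grp, 'a) hahn" where
  "lift a = (SOME x. x \<in> hseries D \<and> psi x = a)"

definition Q :: "'k ring" where
  "Q = \<lparr>carrier = psi ` hseries D, monoid.mult = \<lambda>a b. psi (lift a * lift b), one = psi 1,
        ring.zero = psi 0, add = \<lambda>a b. psi (lift a + lift b)\<rparr>"

definition Rs :: "'k set" where
  "Rs = psi ` R"

lemma lift: assumes "x \<in> hseries D" shows "lift (psi x) \<in> hseries D" "null (lift (psi x) - x)"
proof -
  have "lift (psi x) \<in> hseries D \<and> psi (lift (psi x)) = psi x"
    unfolding lift_def by (rule someI[of _ x]) (use assms in simp)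
  then show "lift (psi x) \<in> hseries D" "null (lift (psi x) - x)" using psi_eq assms by auto
qed

lemma Q_simps [simp]: "carrier Q = psi ` hseries D" "\<one>\<^bsub>Q\<^esub> = psi 1" "\<zero>\<^bsub>Q\<^esub> = psi 0"
  by (simp_all add: Q_def)

lemma Q_mult [simp]:
  assumes "x \<in> hseries D" "y \<in> hseries D" shows "psi x \<otimes>\<^bsub>Q\<^esub> psi y = psi (x * y)"
  using psi_eq[of "lift (psi x) * lift (psi y)" "x * y"] lift assms
  by (simp add: Q_def hseries_mult null_mult_cong)

lemma Q_add [simp]:
  assumes "x \<in> hseries D" "y \<in> hseries D" shows "psi x \<oplus>\<^bsub>Q\<^esub> psi y = psi (x + y)"
proof -
  have "lift (psi x) + lift (psi y) - (x + y) = (lift (psi x) - x) + (lift (psi y) - y)" by simp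
  then have "null (lift (psi x) + lift (psi y) - (x + y))" using lift assms null_add by metis
  then show ?thesis using psi_eq[of "lift (psi x) + lift (psi y)" "x + y"] lift assms
    by (simp add: Q_def hseries_add)
qed

lemma abelian_group_Q: "abelian_group Q"
proof (rule abelian_groupI)
  show "\<exists>y\<in>carrier Q. y \<oplus>\<^bsub>Q\<^esub> a = \<zero>\<^bsub>Q\<^esub>" if a: "a \<in> carrier Q" for a
  proof -
    obtain x where x: "a = psi x" "x \<in> hseries D" using a by auto
    then have "psi (- x) \<oplus>\<^bsub>Q\<^esub> a = \<zero>\<^bsub>Q\<^esub>" by (simp add: hseries_uminus)
    then show ?thesis using x(2) hseries_uminus by auto
  qed
qed (auto simp: hseries_add ac_simps)

lemma cring_Q: "cring Q"
proof (rule cringI[OF abelian_group_Q])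
  show "comm_monoid Q"
    by (rule comm_monoidI) (auto simp: hseries_mult ac_simps)
qed (auto simp: hseries_mult hseries_add distrib_right)

lemma psi_inverse:
  assumes "x \<in> hseries D" "\<not> null x"
  obtains y where "y \<in> hseries D" "null (x * y - 1)"
proof -
  obtain g where "hcoeff x g \<notin> I" using assms(2) by (auto simp: null_def)
  then obtain a where "vanish a x" "hcoeff x a \<notin> I" by (metis order_ex)
  then show thesis using hseries_inverse[OF assms(1)] that by metis
qed

lemma psi_zero_iff: "x \<in> hseries D \<Longrightarrow> psi x = psi 0 \<longleftrightarrow> null x"
  using psi_eq[of x 0] by simp

lemma field_Q: "field Q"
proof (rule cring.cring_fieldI2[OF cring_Q])
  show "\<zero>\<^bsub>Q\<^esub> \<noteq> \<one>\<^bsub>Q\<^esub>" using psi_eq[of 1 0] by auto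
  fix a assume a: "a \<in> carrier Q" "a \<noteq> \<zero>\<^bsub>Q\<^esub>"
  then obtain x where x: "a = psi x" "x \<in> hseries D" "\<not> null x" by (auto simp: psi_zero_iff)
  obtain y where y: "y \<in> hseries D" "null (x * y - 1)" using psi_inverse[OF x(2,3)] .
  then have "psi (x * y) = psi 1" using x by (simp add: psi_eq hseries_mult)
  then show "\<exists>b\<in>carrier Q. a \<otimes>\<^bsub>Q\<^esub> b = \<one>\<^bsub>Q\<^esub>" using x y by auto
qed

sublocale Qf: field Q
  by (rule field_Q)

lemma Q_uminus [simp]: assumes "x \<in> hseries D" shows "\<ominus>\<^bsub>Q\<^esub> psi x = psi (- x)"
proof (rule Qf.minus_equality)
  show "psi (- x) \<oplus>\<^bsub>Q\<^esub> psi x = \<zero>\<^bsub>Q\<^esub>" using assms by (simp add: hseries_uminus)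
qed (use assms hseries_uminus in auto)

lemma Q_minus [simp]: "x \<in> hseries D \<Longrightarrow> y \<in> hseries D \<Longrightarrow> psi x \<ominus>\<^bsub>Q\<^esub> psi y = psi (x - y)"
  by (simp add: a_minus_def hseries_uminus)

lemma Q_inv: assumes "x \<in> hseries D" "y \<in> hseries D" "null (x * y - 1)" shows "inv\<^bsub>Q\<^esub> (psi x) = psi y"
proof (rule Qf.comm_inv_char)
  show "psi x \<otimes>\<^bsub>Q\<^esub> psi y = \<one>\<^bsub>Q\<^esub>" using assms by (simp add: psi_eq hseries_mult)
qed (use assms in auto)

lemma Q_inv_hmono: "inv\<^bsub>Q\<^esub> (psi (hmono g 1)) = psi (hmono (- g) 1)"
  by (rule Q_inv) (auto simp: hmono_mult_hmono)

lemma psi_Rs_iff: assumes "x \<in> hseries D" shows "psi x \<in> Rs \<longleftrightarrow> vanish 0 x"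
proof
  assume "psi x \<in> Rs"
  then obtain y where y: "psi x = psi y" "y \<in> R" by (auto simp: Rs_def)
  then have "null (x - y)" using assms R_hseries psi_eq by blast
  then show "vanish 0 x" using y R_vanish null_vanish vanish_cong by blast
next
  assume "vanish 0 x"
  then show "psi x \<in> Rs" using assms by (auto simp: Rs_def R_def)
qed

abbreviation multiples :: "'k \<Rightarrow> 'k set" where
  "multiples a \<equiv> (\<lambda>s. a \<otimes>\<^bsub>Q\<^esub> s) ` Rs"

text \<open>Dividing by the monomial translates membership in a principal fractional ideal into a
  bound on the value.\<close>

lemma hmono_image_iff: assumes "x \<in> hseries D"
  shows "psi x \<in> multiples (psi (hmono g 1)) \<longleftrightarrow> vanish g x"
proof
  assume "psi x \<in> multiples (psi (hmono g 1))"
  then obtain y where y: "y \<in> R" "psi x = psi (hmono g 1) \<otimes>\<^bsub>Q\<^esub> psi y" by (auto simp: Rs_def)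
  then have "null (x - hmono g 1 * y)"
    using assms by (simp add: R_hseries psi_eq hseries_mult)
  moreover have "vanish g (hmono g 1 * y)" using vanish_hmono_mult[OF R_vanish[OF y(1)], of g 1] by simp
  ultimately show "vanish g x" using null_vanish vanish_cong by blast
next
  assume v: "vanish g x"
  have "vanish 0 (hmono (- g) 1 * x)" using vanish_hmono_mult[OF v, of "- g" 1] by simp
  then have "hmono (- g) 1 * x \<in> R" using assms by (simp add: R_def hseries_mult)
  moreover have "psi (hmono g 1) \<otimes>\<^bsub>Q\<^esub> psi (hmono (- g) 1 * x) = psi x"
    using assms by (simp add: hseries_mult mult.assoc[symmetric] hmono_mult_hmono)
  ultimately show "psi x \<in> multiples (psi (hmono g 1))" unfolding Rs_def by (metis image_eqI)
qed

lemma subring_Rs: "subring Rs Q"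
proof (rule Qf.subringI)
  show "Rs \<subseteq> carrier Q" using R_hseries by (auto simp: Rs_def)
qed (auto simp: Rs_def R_hseries intro!: imageI R_mult R_add R_uminus)

lemma subR_simps [simp]: "carrier (subR Q Rs) = Rs" "monoid.mult (subR Q Rs) = monoid.mult Q"
  "\<one>\<^bsub>subR Q Rs\<^esub> = psi 1" "\<zero>\<^bsub>subR Q Rs\<^esub> = psi 0" "add (subR Q Rs) = add Q"
  by (simp_all add: subR_def)

lemma vanish_lower: "x \<in> hseries D \<Longrightarrow> \<exists>n. vanish (- gbase n) x"
  by (erule hseries_lower) (metis vanish_def I_0)

lemma Rs_iff: "a \<in> Rs \<longleftrightarrow> (\<exists>x\<in>R. a = psi x)"
  by (auto simp: Rs_def)

section \<open>The chain of denominators and the invariant\<close>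

definition r :: "nat set \<Rightarrow> 'k" where
  "r nu = psi (hmono (gbase (Abs_omega1 nu)) 1)"

lemma r_Rep [simp]: "r (Rep_omega1 n) = psi (hmono (gbase n) 1)"
  by (simp add: r_def Rep_omega1_inverse)

text \<open>A series has value at least some \<open>- gbase n\<close>, so multiplying by the
  monomial at \<open>gbase n\<close> brings it into \<open>R\<close>.\<close>

lemma quotient_field: "is_quotient_field Q Rs"
  unfolding is_quotient_field_def
proof (intro conjI ballI)
  fix q assume "q \<in> carrier Q"
  then obtain x where x: "q = psi x" "x \<in> hseries D" by auto
  obtain n where "vanish (- gbase n) x" using vanish_lower[OF x(2)] by blast
  then have "vanish 0 (hmono (gbase n) 1 * x)" using vanish_hmono_mult[of "- gbase n" x "gbase n" 1] by simp
  then have "psi (hmono (gbase n) 1 * x) \<in> Rs" using x(2) by (simp add: psi_Rs_iff hseries_mult)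
  moreover have "psi (hmono (gbase n) 1) \<in> Rs" by (simp add: psi_Rs_iff vanish_hmono less_imp_le)
  moreover have "psi (hmono (gbase n) 1) \<noteq> psi 0"
    by (subst psi_zero_iff) (auto simp: null_def hcoeff_hmono intro!: exI[of _ "gbase n"])
  moreover have "q = psi (hmono (gbase n) 1 * x) \<otimes>\<^bsub>Q\<^esub> inv\<^bsub>Q\<^esub> (psi (hmono (gbase n) 1))"
    using x by (simp add: Q_inv_hmono hseries_mult)
      (simp add: mult.commute[of _ "hmono (- _) _"] mult.assoc[symmetric] hmono_mult_hmono)
  ultimately show "\<exists>a\<in>Rs. \<exists>b\<in>Rs. b \<noteq> \<zero>\<^bsub>Q\<^esub> \<and> q = a \<otimes>\<^bsub>Q\<^esub> inv\<^bsub>Q\<^esub> b" by auto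
qed (fact field_Q subring_Rs)+

lemma rdvd_psi: "x \<in> R \<Longrightarrow> y \<in> R \<Longrightarrow> z \<in> R \<Longrightarrow> null (y - z * x) \<Longrightarrow> rdvd (subR Q Rs) (psi x) (psi y)"
  unfolding rdvd_def
  by (rule bexI[of _ "psi z"]) (auto simp: R_hseries psi_eq hseries_mult mult.commute psi_Rs_iff R_vanish)

lemma domain_Rs: "domain (subR Q Rs)"
  unfolding subR_def by (rule Qf.subring_is_domain[OF subring_Rs])

lemma valuation_domain_Rs: "valuation_domain (subR Q Rs)"
  unfolding valuation_domain_def
proof (intro conjI ballI)
  fix a b assume "a \<in> carrier (subR Q Rs)" "b \<in> carrier (subR Q Rs)"
  then obtain x y where x: "a = psi x" "x \<in> R" and y: "b = psi y" "y \<in> R" by (auto simp: Rs_iff)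
  obtain q where "q \<in> R" "null (x - q * y) \<or> null (y - q * x)" using R_total[OF x(2) y(2)] .
  then show "rdvd (subR Q Rs) a b \<or> rdvd (subR Q Rs) b a" using x y rdvd_psi by metis
qed (rule domain_Rs)

lemma r_Rs: "nu \<in> Field w1 \<Longrightarrow> r nu \<in> Rs \<and> r nu \<noteq> \<zero>\<^bsub>Q\<^esub>"
  unfolding r_def
  by (subst psi_Rs_iff) (auto simp: psi_zero_iff vanish_hmono less_imp_le null_def hcoeff_hmono)

lemma r_dvd:
  assumes "mu \<in> Field w1" "nu \<in> Field w1" "w1_less mu nu" shows "rdvd (subR Q Rs) (r mu) (r nu)"
proof -
  obtain m n where mn: "mu = Rep_omega1 m" "nu = Rep_omega1 n"
    using Rep_omega1_cases[OF assms(1)] Rep_omega1_cases[OF assms(2)] by metis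
  then have "gbase m < gbase n" using assms(3) gbase_mono by simp
  then have "hmono (gbase n - gbase m) 1 \<in> R" by (intro R_hmono) simp
  moreover have "hmono (gbase m) 1 \<in> R" "hmono (gbase n) 1 \<in> R" by (simp_all add: R_hmono less_imp_le)
  moreover have "null (hmono (gbase n) 1 - hmono (gbase n - gbase m) 1 * hmono (gbase m) 1)"
    by (simp add: hmono_mult_hmono)
  ultimately show ?thesis unfolding mn r_Rep by (intro rdvd_psi)
qed

lemma Q_union: "carrier Q = (\<Union>nu\<in>Field w1. multiples (inv\<^bsub>Q\<^esub> (r nu)))"
proof
  show "carrier Q \<subseteq> (\<Union>nu\<in>Field w1. multiples (inv\<^bsub>Q\<^esub> (r nu)))"
  proof
    fix q assume "q \<in> carrier Q"
    then obtain x where x: "q = psi x" "x \<in> hseries D" by auto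
    obtain n where "vanish (- gbase n) x" using vanish_lower[OF x(2)] by blast
    then have "q \<in> multiples (inv\<^bsub>Q\<^esub> (r (Rep_omega1 n)))"
      using hmono_image_iff[OF x(2)] x(1) by (simp add: Q_inv_hmono)
    then show "q \<in> (\<Union>nu\<in>Field w1. multiples (inv\<^bsub>Q\<^esub> (r nu)))"
      by (rule UN_I[OF Rep_omega1_Field])
  qed
  show "(\<Union>nu\<in>Field w1. multiples (inv\<^bsub>Q\<^esub> (r nu))) \<subseteq> carrier Q"
    by (auto simp: r_def Q_inv_hmono Rs_def R_hseries intro!: imageI hseries_mult)
qed

text \<open>By \<open>hmono_image_iff\<close> the Cauchy and limit conditions become bounds on
  values; the two directions are \<open>incomplete_inside\<close> and
  \<open>complete_outside\<close>.\<close>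

lemma complete_at_iff:
  assumes d: "limit_ord d" shows "complete_at Q Rs r (Rep_omega1 d) \<longleftrightarrow> d \<notin> D"
proof
  assume C: "complete_at Q Rs r (Rep_omega1 d)"
  show "d \<notin> D"
  proof
    assume "d \<in> D"
    then obtain x :: "omega1 \<Rightarrow> (grp, 'a) hahn" where x: "\<And>n. x n \<in> hseries D" "\<And>n. vanish 0 (x n)"
      "\<And>m n. m < n \<Longrightarrow> n < d \<Longrightarrow> vanish (gbase m) (x n - x m)"
      "\<And>y. y \<in> hseries D \<Longrightarrow> (\<And>n. n < d \<Longrightarrow> vanish (gbase n) (y - x n)) \<Longrightarrow> False"
      using incomplete_inside[OF d] by blast
    define X' where "X' nu = psi (x (Abs_omega1 nu))" for nu
    have X': "X' (Rep_omega1 n) = psi (x n)" for n by (simp add: X'_def Rep_omega1_inverse)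
    have h1: "\<forall>nu. w1_less nu (Rep_omega1 d) \<longrightarrow> X' nu \<in> Rs"
      unfolding all_less_w1 X' using x(1,2) psi_Rs_iff by blast
    have h2: "\<forall>mu nu. w1_less mu nu \<and> w1_less nu (Rep_omega1 d) \<longrightarrow>
        X' nu \<ominus>\<^bsub>Q\<^esub> X' mu \<in> multiples (r mu)"
    proof (intro allI impI, elim conjE)
      fix mu nu assume l: "w1_less mu nu" "w1_less nu (Rep_omega1 d)"
      then obtain m n where mn: "mu = Rep_omega1 m" "nu = Rep_omega1 n"
        using w1_less_FieldD Rep_omega1_cases by metis
      then have "m < n" "n < d" using l by auto
      then show "X' nu \<ominus>\<^bsub>Q\<^esub> X' mu \<in> multiples (r mu)"
        unfolding mn X' r_Rep using x(1,3) by (simp add: hmono_image_iff hseries_diff)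
    qed
    obtain y where y: "y \<in> Rs" "\<forall>nu. w1_less nu (Rep_omega1 d) \<longrightarrow> y \<ominus>\<^bsub>Q\<^esub> X' nu \<in> multiples (r nu)"
      using C h1 h2 unfolding complete_at_def by blast
    obtain y' where y': "y = psi y'" "y' \<in> hseries D" using y(1) R_hseries by (auto simp: Rs_def)
    have "vanish (gbase n) (y' - x n)" if "n < d" for n
      using y(2)[unfolded all_less_w1 X' r_Rep, rule_format, OF that] y' x(1)
      by (simp add: hmono_image_iff hseries_diff)
    then show False using x(4) y'(2) by blast
  qed
next
  assume dD: "d \<notin> D"
  show "complete_at Q Rs r (Rep_omega1 d)"
    unfolding complete_at_def
  proof (intro allI impI)
    fix X' assume h1: "\<forall>nu. w1_less nu (Rep_omega1 d) \<longrightarrow> X' nu \<in> Rs"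
      and h2: "\<forall>mu nu. w1_less mu nu \<and> w1_less nu (Rep_omega1 d) \<longrightarrow>
        X' nu \<ominus>\<^bsub>Q\<^esub> X' mu \<in> multiples (r mu)"
    have "\<forall>n. \<exists>x. n < d \<longrightarrow> x \<in> R \<and> X' (Rep_omega1 n) = psi x"
      using h1 unfolding all_less_w1 Rs_def by blast
    then obtain x where x: "\<And>n. n < d \<Longrightarrow> x n \<in> R" "\<And>n. n < d \<Longrightarrow> X' (Rep_omega1 n) = psi (x n)" by metis
    have ca: "vanish (gbase m) (x n - x m)" if mn: "m < n" "n < d" for m n
    proof -
      have md: "m < d" using mn by simp
      have "X' (Rep_omega1 n) \<ominus>\<^bsub>Q\<^esub> X' (Rep_omega1 m) \<in> multiples (r (Rep_omega1 m))"
        using h2[rule_format, of "Rep_omega1 m" "Rep_omega1 n"] mn by simp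
      then show ?thesis using mn md x by (simp add: hmono_image_iff hseries_diff R_hseries)
    qed
    obtain y where y: "y \<in> hseries D" "vanish 0 y" "\<And>n. n < d \<Longrightarrow> vanish (gbase n) (y - x n)"
      using complete_outside[OF d dD R_hseries[OF x(1)] R_vanish[OF x(1)] ca] by blast
    show "\<exists>y\<in>Rs. \<forall>nu. w1_less nu (Rep_omega1 d) \<longrightarrow> y \<ominus>\<^bsub>Q\<^esub> X' nu \<in> multiples (r nu)"
      unfolding all_less_w1 r_Rep
    proof (intro bexI[of _ "psi y"] allI impI)
      show "psi y \<in> Rs" using y by (simp add: psi_Rs_iff)
      show "psi y \<ominus>\<^bsub>Q\<^esub> X' (Rep_omega1 n) \<in> multiples (psi (hmono (gbase n) 1))" if "n < d" for n
        using y that x by (simp add: hmono_image_iff hseries_diff R_hseries)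
    qed
  qed
qed

text \<open>The two sets coincide on the club of limit ordinals.\<close>

lemma Gamma_equiv:
  assumes "D = {d. limit_ord d \<and> Rep_omega1 d \<in> S}"
  shows "w1_equiv (Gamma_set Q Rs r) S"
  unfolding w1_equiv_def
proof (intro exI conjI)
  show "w1_club {d. w1_limit d}" by (rule w1_club_limit)
  have "d \<in> Gamma_set Q Rs r \<longleftrightarrow> d \<in> S" if "w1_limit d" for d
  proof -
    have "d \<in> Field w1" using \<open>w1_limit d\<close> by (simp add: w1_limit_def)
    then obtain e where e: "d = Rep_omega1 e" using Rep_omega1_cases[of d] by blast
    then have l: "limit_ord e" using \<open>w1_limit d\<close> by simp
    have "d \<in> Gamma_set Q Rs r \<longleftrightarrow> e \<in> D"
      using e l complete_at_iff[OF l] by (simp add: Gamma_set_def)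
    then show ?thesis using e l assms by simp
  qed
  then show "Gamma_set Q Rs r \<inter> {d. w1_limit d} = S \<inter> {d. w1_limit d}" by blast
qed

end

section \<open>The uniserial module\<close>

context transported
begin

definition liftM :: "'k \<Rightarrow> (grp, 'a) hahn" where
  "liftM a = (SOME x. x \<in> M \<and> psiM x = a)"

definition U :: "('k, 'k) module" where
  "U = \<lparr>carrier = psiM ` M, monoid.mult = \<lambda>a b. a, one = psiM 0, ring.zero = psiM 0,
        add = \<lambda>a b. psiM (liftM a + liftM b), module.smult = \<lambda>s a. psiM (lift s * liftM a)\<rparr>"

lemma liftM: assumes "x \<in> M" shows "liftM (psiM x) \<in> M" "vanish 0 (liftM (psiM x) - x)"
proof -
  have "liftM (psiM x) \<in> M \<and> psiM (liftM (psiM x)) = psiM x"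
    unfolding liftM_def by (rule someI[of _ x]) (use assms in simp)
  then show "liftM (psiM x) \<in> M" "vanish 0 (liftM (psiM x) - x)" using psiM_eq assms by auto
qed

lemma lift_R: assumes "x \<in> R" shows "lift (psi x) \<in> R"
  using lift[OF R_hseries[OF assms]] R_vanish[OF assms]
    vanish_cong[OF null_vanish[of "lift (psi x) - x"], of 0] by (simp add: R_def)

lemma U_simps [simp]: "carrier U = psiM ` M" "\<zero>\<^bsub>U\<^esub> = psiM 0"
  by (simp_all add: U_def)

lemma zero_M [simp]: "0 \<in> M"
  by (rule vanish_M) simp

lemma U_add [simp]: assumes "x \<in> M" "y \<in> M" shows "psiM x \<oplus>\<^bsub>U\<^esub> psiM y = psiM (x + y)"
proof -
  have "liftM (psiM x) + liftM (psiM y) - (x + y) = (liftM (psiM x) - x) + (liftM (psiM y) - y)" by simp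
  then have "vanish 0 (liftM (psiM x) + liftM (psiM y) - (x + y))" using liftM assms vanish_add by metis
  then show ?thesis using psiM_eq[of "liftM (psiM x) + liftM (psiM y)" "x + y"] liftM assms
    by (simp add: U_def M_add)
qed

lemma U_smult [simp]: assumes "f \<in> R" "x \<in> M" shows "psi f \<odot>\<^bsub>U\<^esub> psiM x = psiM (f * x)"
proof -
  have "lift (psi f) * liftM (psiM x) - f * x = (lift (psi f) - f) * liftM (psiM x) + f * (liftM (psiM x) - x)"
    by (simp add: algebra_simps)
  moreover have "vanish 0 ((lift (psi f) - f) * liftM (psiM x))"
    using lift[OF R_hseries[OF assms(1)]] by (intro null_vanish null_mult)
  moreover have "vanish 0 (f * (liftM (psiM x) - x))"
    using assms(1) liftM[OF assms(2)] by (intro R_vanish_mult)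
  ultimately have "vanish 0 (lift (psi f) * liftM (psiM x) - f * x)" using vanish_add by metis
  then show ?thesis using psiM_eq[of "lift (psi f) * liftM (psiM x)" "f * x"] lift_R liftM assms
    by (simp add: U_def M_smult)
qed

lemma abelian_group_U: "abelian_group U"
proof (rule abelian_groupI)
  show "\<exists>y\<in>carrier U. y \<oplus>\<^bsub>U\<^esub> a = \<zero>\<^bsub>U\<^esub>" if a: "a \<in> carrier U" for a
  proof -
    obtain x where x: "a = psiM x" "x \<in> M" using a by auto
    then have "psiM (- x) \<oplus>\<^bsub>U\<^esub> a = \<zero>\<^bsub>U\<^esub>" by (simp add: M_uminus)
    then show ?thesis using x(2) M_uminus by auto
  qed
qed (auto simp: M_add ac_simps)

lemma module_U: "module (subR Q Rs) U"
proof (rule moduleI)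
  show "cring (subR Q Rs)" using domain_Rs by (simp add: domain_def)
qed (auto simp: abelian_group_U Rs_iff M_smult M_add R_add R_mult R_hseries distrib_left distrib_right mult.assoc)

text \<open>By \<open>M_total\<close>, of any two elements one is a multiple of the other; an
  element of \<open>N2\<close> outside \<open>N1\<close> therefore has every element of
  \<open>N1\<close> as a multiple.\<close>

lemma uniserial_U: "uniserial (subR Q Rs) U"
  unfolding uniserial_def
proof (intro conjI allI impI)
  fix N1 N2 assume N1: "submodule N1 (subR Q Rs) U" and N2: "submodule N2 (subR Q Rs) U"
  have N12: "N1 \<subseteq> carrier U" "N2 \<subseteq> carrier U"
    using module.submoduleE(1)[OF module_U] N1 N2 by blast+
  show "N1 \<subseteq> N2 \<or> N2 \<subseteq> N1"
  proof (rule disjCI)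
    assume "\<not> N2 \<subseteq> N1"
    then obtain b where b: "b \<in> N2" "b \<notin> N1" by blast
    show "N1 \<subseteq> N2"
    proof
      fix a assume a: "a \<in> N1"
      obtain x where x: "a = psiM x" "x \<in> M" using a N12 by auto
      obtain y where y: "b = psiM y" "y \<in> M" using b N12 by auto
      obtain q where q: "q \<in> R" "vanish 0 (x - q * y) \<or> vanish 0 (y - q * x)" using M_total[OF x(2) y(2)] .
      have qR: "psi q \<in> carrier (subR Q Rs)" using q(1) by (auto simp: Rs_iff)
      from q(2) show "a \<in> N2"
      proof
        assume "vanish 0 (x - q * y)"
        then have "a = psi q \<odot>\<^bsub>U\<^esub> b" using q(1) x y by (simp add: psiM_eq M_smult)
        then show ?thesis using submodule.smult_closed[OF N2 qR b(1)] by simp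
      next
        assume "vanish 0 (y - q * x)"
        then have "b = psi q \<odot>\<^bsub>U\<^esub> a" using q(1) x y by (simp add: psiM_eq M_smult)
        then show ?thesis using submodule.smult_closed[OF N1 qR a] b(2) by simp
      qed
    qed
  qed
qed (rule module_U)

section \<open>Submodules of the field and their cosets\<close>

abbreviation FM :: "('k, 'k) module" where "FM \<equiv> field_module Q"

lemma FM_simps [simp]: "carrier FM = carrier Q" "add FM = add Q" "\<zero>\<^bsub>FM\<^esub> = \<zero>\<^bsub>Q\<^esub>"
  "module.smult FM = monoid.mult Q"
  by (simp_all add: field_module_def)

abbreviation coset :: "'k set \<Rightarrow> (grp, 'a) hahn \<Rightarrow> 'k set" where
  "coset A x \<equiv> A +>\<^bsub>FM\<^esub> psi x"

text \<open>Pulling a submodule back to series lets coset identities be checked by subtraction of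
  series.\<close>

definition series_of :: "'k set \<Rightarrow> (grp, 'a) hahn set" where
  "series_of A = {x \<in> hseries D. psi x \<in> A}"

lemma subgroup_FM: "subgroup A (add_monoid FM) \<longleftrightarrow> subgroup A (add_monoid Q)"
  by (simp add: subgroup_def m_inv_def)

lemma submodule_subgroup: "submodule A (subR Q Rs) FM \<Longrightarrow> subgroup A (add_monoid Q)"
  using submodule.axioms(1)[of A "subR Q Rs" FM] unfolding subgroup_FM .

lemma series_of:
  assumes A: "submodule A (subR Q Rs) FM"
  shows series_of_hseries: "x \<in> series_of A \<Longrightarrow> x \<in> hseries D"
    and series_of_add: "x \<in> series_of A \<Longrightarrow> y \<in> series_of A \<Longrightarrow> x + y \<in> series_of A"
    and series_of_uminus: "x \<in> series_of A \<Longrightarrow> - x \<in> series_of A"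
    and series_of_smult: "f \<in> R \<Longrightarrow> x \<in> series_of A \<Longrightarrow> f * x \<in> series_of A"
    and series_of_null: "x \<in> hseries D \<Longrightarrow> null x \<Longrightarrow> x \<in> series_of A"
    and series_of_image: "psi ` series_of A = A"
proof -
  interpret A: subgroup A "add_monoid Q" by (rule submodule_subgroup[OF A])
  show "x \<in> hseries D" if "x \<in> series_of A" using that by (simp add: series_of_def)
  show "x + y \<in> series_of A" if "x \<in> series_of A" "y \<in> series_of A"
    using A.m_closed[of "psi x" "psi y"] that by (simp add: series_of_def hseries_add)
  show "- x \<in> series_of A" if "x \<in> series_of A"
    using A.m_inv_closed[of "psi x"] that Q_uminus[of x] by (simp add: series_of_def hseries_uminus a_inv_def)
  show "f * x \<in> series_of A" if "f \<in> R" "x \<in> series_of A"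
  proof -
    have "psi f \<in> carrier (subR Q Rs)" using that(1) by (auto simp: Rs_iff)
    then have "psi f \<odot>\<^bsub>FM\<^esub> psi x \<in> A"
      using that(2) by (intro submodule.smult_closed[OF A]) (auto simp: series_of_def)
    then show ?thesis using that by (simp add: series_of_def R_hseries hseries_mult)
  qed
  show "x \<in> series_of A" if "x \<in> hseries D" "null x"
    using that A.one_closed psi_zero_iff[of x] by (simp add: series_of_def)
  show "psi ` series_of A = A" using A.subset by (auto simp: series_of_def)
qed

lemma series_of_diff:
  assumes "submodule A (subR Q Rs) FM" "x \<in> series_of A" "y \<in> series_of A" shows "x - y \<in> series_of A"
  using series_of_add[OF assms(1,2) series_of_uminus[OF assms(1,3)]] by simp

lemma coset_psi:
  assumes A: "submodule A (subR Q Rs) FM" and x: "x \<in> hseries D"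
  shows "coset A x = psi ` {y \<in> hseries D. y - x \<in> series_of A}"
proof -
  let ?Y = "{y \<in> hseries D. y - x \<in> series_of A}"
  let ?C = "psi ` ?Y"
  have "coset A x = (\<lambda>a. a \<oplus>\<^bsub>Q\<^esub> psi x) ` A"
    by (auto simp: a_r_coset_def r_coset_def)
  also have "\<dots> = (\<lambda>a. a \<oplus>\<^bsub>Q\<^esub> psi x) ` psi ` series_of A" by (simp only: series_of_image[OF A])
  also have "\<dots> = ?C"
  proof
    show "(\<lambda>a. a \<oplus>\<^bsub>Q\<^esub> psi x) ` psi ` series_of A \<subseteq> ?C"
    proof clarify
      fix y assume y: "y \<in> series_of A"
      have "psi y \<oplus>\<^bsub>Q\<^esub> psi x = psi (y + x)" using y x series_of_hseries[OF A] by simp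
      moreover have "y + x \<in> ?Y"
        using y x series_of_hseries[OF A] by (simp add: hseries_add)
      ultimately show "psi y \<oplus>\<^bsub>Q\<^esub> psi x \<in> ?C" by blast
    qed
    show "?C \<subseteq> (\<lambda>a. a \<oplus>\<^bsub>Q\<^esub> psi x) ` psi ` series_of A"
    proof clarify
      fix y assume y: "y \<in> hseries D" "y - x \<in> series_of A"
      have "psi (y - x) \<oplus>\<^bsub>Q\<^esub> psi x = psi y" using y x by (simp add: hseries_diff)
      then show "psi y \<in> (\<lambda>a. a \<oplus>\<^bsub>Q\<^esub> psi x) ` psi ` series_of A" using y(2) by (metis image_eqI)
    qed
  qed
  finally show ?thesis .
qed

lemma coset_eq_iff:
  assumes A: "submodule A (subR Q Rs) FM" and x: "x \<in> hseries D" and y: "y \<in> hseries D"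
  shows "coset A x = coset A y \<longleftrightarrow> x - y \<in> series_of A"
proof
  assume "coset A x = coset A y"
  moreover have "psi x \<in> coset A x"
    unfolding coset_psi[OF A x] using x series_of_null[OF A, of 0] by auto
  ultimately obtain z where z: "psi x = psi z" "z \<in> hseries D" "z - y \<in> series_of A"
    unfolding coset_psi[OF A y] by auto
  have "x - z \<in> series_of A" using z x by (intro series_of_null[OF A]) (auto simp: hseries_diff psi_eq)
  then have "(x - z) + (z - y) \<in> series_of A" using z(3) series_of_add[OF A] by blast
  then show "x - y \<in> series_of A" by simp
next
  assume d: "x - y \<in> series_of A"
  have "z - x \<in> series_of A \<longleftrightarrow> z - y \<in> series_of A" for z
    using series_of_add[OF A _ d, of "z - x"] series_of_diff[OF A _ d, of "z - y"] by auto
  then show "coset A x = coset A y" unfolding coset_psi[OF A x] coset_psi[OF A y] by simp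
qed

lemma set_add: "X1 <+>\<^bsub>FM\<^esub> X2 = {a \<oplus>\<^bsub>Q\<^esub> b |a b. a \<in> X1 \<and> b \<in> X2}"
  by (auto simp: set_add_def set_mult_def)

lemma coset_add:
  assumes A: "submodule A (subR Q Rs) FM" and x: "x \<in> hseries D" and y: "y \<in> hseries D"
  shows "(coset A x) <+>\<^bsub>FM\<^esub> (coset A y) = coset A (x + y)"
  unfolding coset_psi[OF A x] coset_psi[OF A y] coset_psi[OF A hseries_add[OF x y]]
proof -
  let ?C = "\<lambda>x. psi ` {y \<in> hseries D. y - x \<in> series_of A}"
  have *: "?C x <+>\<^bsub>FM\<^esub> ?C y = {a \<oplus>\<^bsub>Q\<^esub> b |a b. a \<in> ?C x \<and> b \<in> ?C y}"
    by (rule set_add)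
  show "?C x <+>\<^bsub>FM\<^esub> ?C y = ?C (x + y)"
    unfolding *
  proof
    show "{a \<oplus>\<^bsub>Q\<^esub> b |a b. a \<in> ?C x \<and> b \<in> ?C y} \<subseteq> ?C (x + y)"
    proof clarify
      fix a b assume ab: "a \<in> hseries D" "a - x \<in> series_of A" "b \<in> hseries D" "b - y \<in> series_of A"
      have "(a - x) + (b - y) \<in> series_of A" using ab series_of_add[OF A] by blast
      then have "a + b \<in> {z \<in> hseries D. z - (x + y) \<in> series_of A}"
        using ab by (simp add: hseries_add algebra_simps)
      then show "psi a \<oplus>\<^bsub>Q\<^esub> psi b \<in> ?C (x + y)" using ab by auto
    qed
    show "?C (x + y) \<subseteq> {a \<oplus>\<^bsub>Q\<^esub> b |a b. a \<in> ?C x \<and> b \<in> ?C y}"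
    proof clarify
      fix z assume z: "z \<in> hseries D" "z - (x + y) \<in> series_of A"
      have "psi z = psi (z - y) \<oplus>\<^bsub>Q\<^esub> psi y" using z y by (simp add: hseries_diff)
      moreover have "psi (z - y) \<in> ?C x" using z y by (auto simp: hseries_diff algebra_simps)
      moreover have "psi y \<in> ?C y" using y series_of_null[OF A, of 0] by auto
      ultimately show "\<exists>a b. psi z = a \<oplus>\<^bsub>Q\<^esub> b \<and> a \<in> ?C x \<and> b \<in> ?C y" by blast
    qed
  qed
qed

text \<open>The scalar multiplication of \<open>quot_mod\<close> uses a chosen representative; the
  choice does not matter because \<open>A\<close> is closed under multiplication by
  \<open>R\<close>.\<close>

lemma coset_smult:
  assumes A: "submodule A (subR Q Rs) FM" and x: "x \<in> hseries D" and f: "f \<in> R"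
  shows "psi f \<odot>\<^bsub>quot_mod FM J A\<^esub> (coset A x) = coset A (f * x)"
proof -
  let ?B = "coset A x"
  have "psi x \<in> ?B"
    unfolding coset_psi[OF A x] using x series_of_null[OF A, of 0] by auto
  then have "(SOME b. b \<in> ?B) \<in> ?B" by (rule someI)
  then obtain y where y: "(SOME b. b \<in> ?B) = psi y" "y \<in> hseries D" "y - x \<in> series_of A"
    unfolding coset_psi[OF A x] by auto
  have "f * y - f * x \<in> series_of A"
    using series_of_smult[OF A f y(3)] by (simp add: right_diff_distrib)
  then have "coset A (f * y) = coset A (f * x)"
    using y(2) x f by (subst coset_eq_iff[OF A]) (auto simp: hseries_mult R_hseries)
  then show ?thesis using y(1,2) f by (simp add: quot_mod_def R_hseries)
qed

text \<open>The fractional ideal generated by the monomial at \<open>g\<close>.\<close>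

definition level :: "grp \<Rightarrow> 'k set" where
  "level g = psi ` {x \<in> hseries D. vanish g x}"

lemma level_iff: "x \<in> hseries D \<Longrightarrow> psi x \<in> level g \<longleftrightarrow> vanish g x"
  unfolding level_def using psi_eq
  by (auto simp: image_iff dest: vanish_cong[OF null_vanish, THEN iffD2])

lemma series_of_level: "series_of (level g) = {x \<in> hseries D. vanish g x}"
  by (auto simp: series_of_def level_iff)

lemma level_0: "level 0 = Rs"
  by (auto simp: level_def Rs_def R_def)

lemma submodule_level: "submodule (level g) (subR Q Rs) FM"
proof (rule submodule.intro)
  have "subgroup (level g) (add_monoid Q)"
  proof (rule Qf.add.subgroupI)
    show "level g \<subseteq> carrier Q" by (auto simp: level_def)
    show "level g \<noteq> {}" by (auto simp: level_def intro!: exI[of _ 0])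
  qed (auto simp: level_def hseries_uminus vanish_uminus hseries_add vanish_add)
  then show "subgroup (level g) (add_monoid FM)" unfolding subgroup_FM .
  show "submodule_axioms (level g) (subR Q Rs) FM"
    by standard (auto simp: level_def Rs_iff R_hseries hseries_mult R_vanish_mult)
qed

abbreviation quot_level :: "grp \<Rightarrow> ('k, 'k set) module" where
  "quot_level g \<equiv> quot_mod FM (carrier Q) (level g)"

text \<open>Multiplication by the monomial at \<open>g\<close> is bijective on the field and carries
  \<open>level 0\<close> onto \<open>level g\<close>; \<open>F\<close> is the induced map, computed
  on representatives.\<close>

lemma quot_level_iso:
  "mod_iso (subR Q Rs) (quot_level 0) (quot_level g)"
proof -
  let ?t = "hmono g (1::'a)"
  let ?c = "\<lambda>h. coset (level h)"
  define F where "F C = ?c g (?t * lift (SOME b. b \<in> C))" for C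
  have F: "F (?c 0 x) = ?c g (?t * x)" if x: "x \<in> hseries D" for x
  proof -
    have "psi x \<in> ?c 0 x"
      unfolding coset_psi[OF submodule_level x] using x by (auto simp: series_of_level)
    then have "(SOME b. b \<in> ?c 0 x) \<in> ?c 0 x" by (rule someI)
    then obtain y where y: "(SOME b. b \<in> ?c 0 x) = psi y" "y \<in> hseries D" "vanish 0 (y - x)"
      unfolding coset_psi[OF submodule_level x] by (auto simp: series_of_level)
    have l: "lift (psi y) \<in> hseries D" "null (lift (psi y) - y)" using lift y(2) by auto
    have "lift (psi y) - x = (lift (psi y) - y) + (y - x)" by simp
    then have "vanish 0 (lift (psi y) - x)" using l(2) y(3) null_vanish vanish_add by metis
    then have "vanish g (?t * (lift (psi y) - x))" using vanish_hmono_mult[of 0 _ g 1] by simp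
    then have "?c g (?t * lift (psi y)) = ?c g (?t * x)"
      using l x by (subst coset_eq_iff[OF submodule_level])
        (auto simp: hseries_mult series_of_level hseries_diff right_diff_distrib)
    then show ?thesis unfolding F_def y(1) .
  qed
  have car: "carrier (quot_level h) = ?c h ` hseries D" for h
    by (auto simp: quot_mod_def)
  have add: "add (quot_level h) (?c h x) (?c h y) = ?c h (x + y)"
    if "x \<in> hseries D" "y \<in> hseries D" for h x y
    using coset_add[OF submodule_level that] by (simp add: quot_mod_def)
  show ?thesis
    unfolding mod_iso_def car
  proof (intro exI[of _ F] conjI ballI)
    show "bij_betw F (?c 0 ` hseries D) (?c g ` hseries D)"
      unfolding bij_betw_def
    proof
      show "inj_on F (?c 0 ` hseries D)"
      proof (rule inj_onI, clarify)
        fix x y assume xy: "x \<in> hseries D" "y \<in> hseries D" "F (?c 0 x) = F (?c 0 y)"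
        then have "?c g (?t * x) = ?c g (?t * y)" using F by simp
        then have "?t * x - ?t * y \<in> series_of (level g)"
          using xy by (subst (asm) coset_eq_iff[OF submodule_level]) (auto simp: hseries_mult)
        then have "vanish g (?t * (x - y))" by (simp add: series_of_level right_diff_distrib)
        then have "vanish (- g + g) (hmono (- g) 1 * (?t * (x - y)))" by (rule vanish_hmono_mult)
        then have "vanish 0 (x - y)" by (simp add: mult.assoc[symmetric] hmono_mult_hmono)
        then show "?c 0 x = ?c 0 y"
          using xy by (subst coset_eq_iff[OF submodule_level]) (auto simp: series_of_level hseries_diff)
      qed
      show "F ` ?c 0 ` hseries D = ?c g ` hseries D"
      proof
        show "F ` ?c 0 ` hseries D \<subseteq> ?c g ` hseries D" using F by (auto simp: hseries_mult)
        show "?c g ` hseries D \<subseteq> F ` ?c 0 ` hseries D"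
        proof clarify
          fix x :: "(grp, 'a) hahn" assume x: "x \<in> hseries D"
          let ?y = "hmono (- g) 1 * x"
          have y: "?y \<in> hseries D" using x by (simp add: hseries_mult)
          have "?c g x = F (?c 0 ?y)" unfolding F[OF y] by (simp add: mult.assoc[symmetric] hmono_mult_hmono)
          then show "?c g x \<in> F ` ?c 0 ` hseries D" using y by blast
        qed
      qed
    qed
    fix a b assume "a \<in> ?c 0 ` hseries D" "b \<in> ?c 0 ` hseries D"
    then obtain x y where "a = ?c 0 x" "x \<in> hseries D" "b = ?c 0 y" "y \<in> hseries D" by auto
    then show "F (a \<oplus>\<^bsub>quot_level 0\<^esub> b) = F a \<oplus>\<^bsub>quot_level g\<^esub> F b"
      by (simp only: add F hseries_add hseries_mult hseries_hmono distrib_left)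
  next
    fix s a assume "s \<in> carrier (subR Q Rs)" "a \<in> ?c 0 ` hseries D"
    then obtain f x where fx: "s = psi f" "f \<in> R" "a = ?c 0 x" "x \<in> hseries D" by (auto simp: Rs_iff)
    have "F (s \<odot>\<^bsub>quot_level 0\<^esub> a) = ?c g (?t * (f * x))"
      using fx by (simp add: coset_smult[OF submodule_level] F R_hseries hseries_mult)
    also have "\<dots> = s \<odot>\<^bsub>quot_level g\<^esub> F a"
      using fx by (simp add: coset_smult[OF submodule_level] F hseries_mult mult.left_commute)
    finally show "F (s \<odot>\<^bsub>quot_level 0\<^esub> a) = s \<odot>\<^bsub>quot_level g\<^esub> F a" .
  qed
qed

section \<open>Type and non-standardness of the module\<close>

lemma gen_nonzero: "psiM (gen n) \<noteq> psiM 0"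
proof
  assume "psiM (gen n) = psiM 0"
  then have "vanish 0 (gen n)" using psiM_eq[OF gen_M zero_M] by simp
  then have "hcoeff (gen n) (- gbase n) \<in> I" by (simp add: vanish_def)
  then show False by (simp add: gen_order)
qed

lemma Ann_gen: "Ann Rs U (psiM (gen n)) = level (gbase n)"
proof -
  have "psi f \<odot>\<^bsub>U\<^esub> psiM (gen n) = \<zero>\<^bsub>U\<^esub> \<longleftrightarrow> vanish (gbase n) f" if "f \<in> R" for f
    using that gen_annihilator[of f n] by (simp add: gen_M psiM_eq M_smult)
  moreover have "vanish 0 x" if "vanish (gbase n) x" for x
    using that vanish_mono less_imp_le[OF gbase_pos] by blast
  ultimately show ?thesis
    unfolding Ann_def level_def Rs_def by (auto simp: R_def image_iff)
qed

text \<open>For \<open>q\<close> of value at least \<open>- gbase k\<close>, choose \<open>t\<close>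
  beyond \<open>k\<close> and \<open>n\<close>. Then \<open>gen n\<close> is a multiple of
  \<open>gen t\<close> by an element of value \<open>gbase t - gbase n\<close>, which exceeds
  \<open>gbase k\<close>; multiplying \<open>q\<close> by this element lands in
  \<open>R\<close>.\<close>

lemma Dset_gen: "Dset Q Rs U (psiM (gen n)) = carrier Q"
proof
  show "Dset Q Rs U (psiM (gen n)) \<subseteq> carrier Q"
    unfolding Dset_def
  proof (rule Union_least, clarify)
    fix s' s b assume s: "s \<in> Rs" and b: "b \<in> carrier U" "s \<odot>\<^bsub>U\<^esub> b = psiM (gen n)" and s': "s' \<in> Rs"
    obtain f where f: "s = psi f" "f \<in> R" using s by (auto simp: Rs_iff)
    obtain y where y: "b = psiM y" "y \<in> M" using b(1) by auto
    \<comment> \<open>A divisor of the nonzero element \<open>psiM (gen n)\<close> is itself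
      nonzero, so its inverse lies in the field.\<close>
    have "\<not> null f"
    proof
      assume "null f"
      then have "vanish 0 (f * y)" by (intro null_vanish null_mult)
      then have "psiM (f * y) = psiM 0" using f y by (simp add: psiM_eq M_smult)
      then show False using b(2) f y gen_nonzero[of n] by simp
    qed
    then have "s \<in> carrier Q - {\<zero>\<^bsub>Q\<^esub>}" using f by (simp add: psi_zero_iff R_hseries)
    then have "inv\<^bsub>Q\<^esub> s \<in> carrier Q" using Qf.field_Units Qf.Units_inv_closed by blast
    moreover have "s' \<in> carrier Q" using s' R_hseries by (auto simp: Rs_iff)
    ultimately show "inv\<^bsub>Q\<^esub> s \<otimes>\<^bsub>Q\<^esub> s' \<in> carrier Q" by (rule Qf.m_closed)
  qed
  show "carrier Q \<subseteq> Dset Q Rs U (psiM (gen n))"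
  proof
    fix q assume "q \<in> carrier Q"
    then obtain x where x: "q = psi x" "x \<in> hseries D" by auto
    obtain k where k: "vanish (- gbase k) x" using vanish_lower[OF x(2)] by blast
    obtain t where t: "max k n < t" using greater_omega1 by blast
    have kt: "gbase k + gbase n < gbase t" using t by (intro gsub_less_gbase gsub_add) auto
    have nt: "n \<le> t" using t by auto
    obtain e where e: "e \<in> R" "hcoeff e 0 \<notin> I" "vanish (gbase n) (u n - e * u t)"
      using transition[OF nt] .
    let ?h = "hmono (gbase t - gbase n) (1::'a)"
    have fR: "?h * e \<in> R" and v: "vanish 0 (gen n - ?h * e * gen t)" using gen_transition[OF nt e(1,3)] by auto
    have sm: "psi (?h * e) \<odot>\<^bsub>U\<^esub> psiM (gen t) = psiM (gen n)"
      using v fR vanish_uminus[OF v] by (simp add: gen_M psiM_eq M_smult)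
    have "hcoeff (?h * e) (gbase t - gbase n) \<notin> I" using e(2) by (simp add: hcoeff_hmono_mult)
    then have "\<not> null (?h * e)" by (auto simp: null_def)
    then have un: "psi (?h * e) \<in> carrier Q - {\<zero>\<^bsub>Q\<^esub>}" using fR by (simp add: psi_zero_iff R_hseries)
    have "vanish ((gbase t - gbase n) + (0 + - gbase k)) (?h * (e * x))"
      by (intro vanish_hmono_mult vanish_mult R_vanish e k)
    then have "vanish 0 (?h * e * x)"
      using kt by (auto simp: mult.assoc algebra_simps intro: vanish_mono)
    then have "psi (?h * e * x) \<in> Rs" using x fR by (subst psi_Rs_iff) (auto simp: R_hseries hseries_mult)
    moreover have "q = inv\<^bsub>Q\<^esub> (psi (?h * e)) \<otimes>\<^bsub>Q\<^esub> psi (?h * e * x)"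
    proof -
      have "psi (?h * e * x) = psi (?h * e) \<otimes>\<^bsub>Q\<^esub> q" using x fR by (simp add: R_hseries)
      moreover have "psi (?h * e) \<in> Units Q" using un Qf.field_Units by simp
      moreover have "q \<in> carrier Q" using x by simp
      ultimately show ?thesis
        using Qf.m_assoc[of "inv\<^bsub>Q\<^esub> (psi (?h * e))" "psi (?h * e)" q] un
        by (simp only: Qf.Units_inv_closed Qf.Units_l_inv Qf.l_one Diff_iff)
    qed
    ultimately have "q \<in> (\<lambda>s. inv\<^bsub>Q\<^esub> (psi (?h * e)) \<otimes>\<^bsub>Q\<^esub> s) ` Rs" by blast
    moreover have "psi (?h * e) \<in> Rs" using fR by (auto simp: Rs_iff)
    moreover have "psiM (gen t) \<in> carrier U" by (simp add: gen_M)
    ultimately show "q \<in> Dset Q Rs U (psiM (gen n))" unfolding Dset_def using sm by blast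
  qed
qed

lemma type_U: "has_type_Q_mod_R Q Rs U"
  unfolding has_type_Q_mod_R_def
proof (intro bexI conjI)
  fix n :: omega1
  show "psiM (gen n) \<in> carrier U" by (simp add: gen_M)
  show "psiM (gen n) \<noteq> \<zero>\<^bsub>U\<^esub>" using gen_nonzero by simp
  show "mod_iso (subR Q Rs) (quot_mod FM (carrier Q) Rs)
    (quot_mod FM (Dset Q Rs U (psiM (gen n))) (Ann Rs U (psiM (gen n))))"
    unfolding Ann_gen Dset_gen using quot_level_iso[of "gbase n"] by (simp only: level_0)
qed

text \<open>Let \<open>z n\<close> represent the image of the \<open>n\<close>-th generator and let
  \<open>a n\<close> be its order. Comparing annihilators shows that \<open>A\<close> is the set of
  elements of value at least \<open>a n + gbase n\<close>, for every \<open>n\<close>. The shifted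
  series \<open>d n\<close> of order 0 then inherit the transition relations and form the family
  excluded by \<open>no_trivialization\<close>.\<close>

lemma not_standard:
  assumes S: "w1_stationary S" and DS: "D = {d. limit_ord d \<and> Rep_omega1 d \<in> S}"
  shows "\<not> standard_uniserial Q Rs U"
proof
  assume "standard_uniserial Q Rs U"
  then obtain J A f where A: "submodule A (subR Q Rs) FM" and J: "submodule J (subR Q Rs) FM"
    and bij: "bij_betw f (carrier U) (carrier (quot_mod FM J A))"
    and fs: "\<And>s x. s \<in> carrier (subR Q Rs) \<Longrightarrow> x \<in> carrier U \<Longrightarrow> f (s \<odot>\<^bsub>U\<^esub> x) = s \<odot>\<^bsub>quot_mod FM J A\<^esub> f x"
    unfolding standard_uniserial_def mod_iso_def by blast
  let ?c = "coset A"
  let ?A = "series_of A"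
  have "\<exists>z \<in> hseries D. f (psiM (gen n)) = ?c z" for n
  proof -
    have "f (psiM (gen n)) \<in> carrier (quot_mod FM J A)"
      using bij gen_M[of n] by (auto simp: bij_betw_def)
    then obtain y where "y \<in> J" "f (psiM (gen n)) = A +>\<^bsub>FM\<^esub> y" by (auto simp: quot_mod_def)
    moreover from this(1) obtain x where "y = psi x" "x \<in> series_of J"
      using series_of_image[OF J] by auto
    ultimately show ?thesis using series_of_hseries[OF J] by blast
  qed
  then obtain z where z: "\<And>n. z n \<in> hseries D" "\<And>n. f (psiM (gen n)) = ?c (z n)" by metis
  have fg: "f (psiM (g * gen n)) = ?c (g * z n)" if g: "g \<in> R" for g n
  proof -
    have "psi g \<in> carrier (subR Q Rs)" using g by (auto simp: Rs_iff)
    then have "f (psi g \<odot>\<^bsub>U\<^esub> psiM (gen n)) = psi g \<odot>\<^bsub>quot_mod FM J A\<^esub> f (psiM (gen n))"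
      by (rule fs) (simp add: gen_M)
    then show ?thesis using g z by (simp add: gen_M coset_smult[OF A])
  qed
  have inj: "inj_on f (psiM ` M)" using bij by (simp add: bij_betw_def)
  \<comment> \<open>Injectivity of \<open>f\<close> makes the annihilator of the coset of
    \<open>z n\<close> equal to that of \<open>gen n\<close>.\<close>
  have mem: "g * z n \<in> ?A \<longleftrightarrow> vanish (gbase n) g" if g: "g \<in> R" for g n
  proof -
    have gM: "g * gen n \<in> M" using g gen_M M_smult by blast
    have "g * z n \<in> ?A \<longleftrightarrow> ?c (g * z n) = ?c (0 * z n)"
      using g z by (subst coset_eq_iff[OF A]) (auto simp: hseries_mult R_hseries)
    also have "\<dots> \<longleftrightarrow> f (psiM (g * gen n)) = f (psiM (0 * gen n))"
      using fg[OF g] fg[OF R_0] by simp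
    also have "\<dots> \<longleftrightarrow> psiM (g * gen n) = psiM 0"
      using inj_on_eq_iff[OF inj, of "psiM (g * gen n)" "psiM 0"] gM by simp
    also have "\<dots> \<longleftrightarrow> vanish (gbase n) g"
      using gM by (simp add: psiM_eq gen_annihilator)
    finally show ?thesis .
  qed
  have v1: "\<not> vanish (gbase n) 1" for n
    using gbase_pos[of n] by (auto simp: vanish_def hcoeff_1 intro!: exI[of _ 0])
  have "\<exists>a. vanish a (z n) \<and> hcoeff (z n) a \<notin> I" for n
  proof -
    have "z n \<notin> ?A" using mem[OF R_1, of n] v1 by simp
    then have "\<not> null (z n)" using series_of_null[OF A z(1)] by blast
    then obtain g where "hcoeff (z n) g \<notin> I" by (auto simp: null_def)
    then show ?thesis by (metis order_ex)
  qed
  then obtain a where a: "\<And>n. vanish (a n) (z n)" "\<And>n. hcoeff (z n) (a n) \<notin> I" by metis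
  have tA: "x \<in> ?A \<longleftrightarrow> vanish (a n + gbase n) x" if x: "x \<in> hseries D" for x n
  proof
    assume v: "vanish (a n + gbase n) x"
    obtain g where g: "g \<in> hseries D" "vanish (gbase n) g" "null (x - z n * g)"
      using hseries_divide[OF z(1) a x v] .
    have gR: "g \<in> R" using g vanish_mono less_imp_le[OF gbase_pos] by (auto simp: R_def)
    have "x - g * z n \<in> ?A" using g x z by (intro series_of_null[OF A]) (auto simp: hseries_diff hseries_mult mult.commute)
    moreover have "g * z n \<in> ?A" using mem[OF gR] g(2) by simp
    ultimately have "(x - g * z n) + g * z n \<in> ?A" by (rule series_of_add[OF A])
    then show "x \<in> ?A" by simp
  next
    assume xA: "x \<in> ?A"
    show "vanish (a n + gbase n) x"
    proof (cases "vanish (a n) x")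
      case True
      then have "vanish (a n + 0) x" by simp
      then obtain g where g: "g \<in> hseries D" "vanish 0 g" "null (x - z n * g)"
        by (rule hseries_divide[OF z(1) a x])
      have gR: "g \<in> R" using g by (simp add: R_def)
      have "x - g * z n \<in> ?A" using g x z by (intro series_of_null[OF A]) (auto simp: hseries_diff hseries_mult mult.commute)
      then have "x - (x - g * z n) \<in> ?A" using xA series_of_diff[OF A] by blast
      then have "vanish (gbase n) g" using mem[OF gR, of n] by simp
      then have "vanish (a n + gbase n) (z n * g)" using a(1) vanish_mult by blast
      then show ?thesis using vanish_cong[OF null_vanish[OF g(3)]] by simp
    next
      case False
      \<comment> \<open>An element of \<open>A\<close> of smaller value than \<open>z n\<close>
        would divide \<open>z n\<close> and put it into \<open>A\<close>, although 1 does not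
        annihilate the generator.\<close>
      then obtain g where "g < a n" "hcoeff x g \<notin> I" by (auto simp: vanish_def)
      then obtain b where b: "vanish b x" "hcoeff x b \<notin> I" "b < a n" using order_ex by (metis le_less_trans)
      have "vanish (b + 0) (z n)" using vanish_mono[OF a(1)] b(3) by simp
      then obtain g where g: "g \<in> hseries D" "vanish 0 g" "null (z n - x * g)"
        by (rule hseries_divide[OF x b(1,2) z(1)])
      have gR: "g \<in> R" using g by (simp add: R_def)
      have "z n - g * x \<in> ?A" using g x z by (intro series_of_null[OF A]) (auto simp: hseries_diff hseries_mult mult.commute)
      then have "(z n - g * x) + g * x \<in> ?A" using series_of_smult[OF A gR xA] series_of_add[OF A] by blast
      then have "1 * z n \<in> ?A" by simp
      then show ?thesis using mem[OF R_1] v1 by blast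
    qed
  qed
  \<comment> \<open>The bounds for \<open>m\<close> and \<open>n\<close> describe the same set, and
    a monomial of value exactly \<open>a n + gbase n\<close> tests one against the other.\<close>
  have le: "a m + gbase m \<le> a n + gbase n" for m n
  proof (rule ccontr)
    let ?g = "a n + gbase n"
    assume "\<not> a m + gbase m \<le> ?g"
    then have "\<not> vanish (a m + gbase m) (hmono ?g 1)"
      by (auto simp: vanish_def hcoeff_hmono intro!: exI[of _ ?g])
    moreover have "vanish ?g (hmono ?g (1::'a))" by (rule vanish_hmono) simp
    ultimately show False using tA[of "hmono ?g 1"] by simp
  qed
  have eqa: "a m + gbase m = a n + gbase n" for m n using le[of m n] le[of n m] by simp
  define d where "d n = hmono (- a n) 1 * z n" for n
  show False
  proof (rule no_trivialization[OF S DS, of d])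
    show "d n \<in> R" for n
      using vanish_hmono_mult[OF a(1)[of n], of "- a n" 1] z(1)[of n] by (simp add: R_def d_def hseries_mult)
    then have dR: "\<And>n. d n \<in> R" .
    show "hcoeff (d n) 0 \<notin> I" for n using a(2)[of n] by (simp add: d_def hcoeff_hmono_mult)
    show "vanish (gbase m) (d m * u n - d n * u m)" if mn: "m < n" for m n
    proof -
      have mn': "m \<le> n" using mn by simp
      obtain e where e: "e \<in> R" "hcoeff e 0 \<notin> I" "vanish (gbase m) (u m - e * u n)"
        using transition[OF mn'] .
      let ?h = "hmono (gbase n - gbase m) (1::'a)"
      have fR: "?h * e \<in> R" and v: "vanish 0 (gen m - ?h * e * gen n)"
        using gen_transition[OF mn' e(1,3)] by auto
      have "psiM (gen m) = psiM (?h * e * gen n)"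
        using v fR by (simp add: gen_M psiM_eq M_smult)
      then have "?c (z m) = ?c (?h * e * z n)" using fg[OF fR, of n] z(2)[of m] by simp
      then have "z m - ?h * e * z n \<in> ?A"
        using z fR by (subst (asm) coset_eq_iff[OF A]) (auto simp: hseries_mult R_hseries)
      then have "vanish (a m + gbase m) (z m - ?h * e * z n)"
        using tA[of "z m - ?h * e * z n" m] z(1) fR by (simp add: hseries_diff hseries_mult R_hseries)
      then have "vanish (- a m + (a m + gbase m)) (hmono (- a m) 1 * (z m - ?h * e * z n))"
        by (rule vanish_hmono_mult)
      moreover have "hmono (- a m) 1 * (?h * e * z n) = e * d n"
      proof -
        have "- a m + (gbase n - gbase m) = - a n" using eqa[of m n] by (simp add: algebra_simps eq_diff_eq)
        then have "hmono (- a m) 1 * ?h = hmono (- a n) (1::'a)" by (simp add: hmono_mult_hmono)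
        then have "(hmono (- a m) 1 * ?h) * (e * z n) = hmono (- a n) 1 * (e * z n)" by simp
        then show ?thesis by (simp only: d_def ac_simps)
      qed
      ultimately have de: "vanish (gbase m) (d m - e * d n)" by (simp add: d_def right_diff_distrib)
      \<comment> \<open>The same \<open>e\<close> relates \<open>u m\<close> to \<open>u n\<close>
        and \<open>d m\<close> to \<open>d n\<close>, so it can be eliminated; having value 0, it is
        then cancelled by \<open>vanish_of_order\<close>.\<close>
      have "e * (d m * u n - d n * u m) = u m * (d m - e * d n) - d m * (u m - e * u n)"
        by (simp add: algebra_simps)
      moreover have "vanish (gbase m) (u m * (d m - e * d n))"
        using vanish_mult[OF u_vanish de] by simp
      moreover have "vanish (gbase m) (d m * (u m - e * u n))" by (rule R_vanish_mult[OF dR e(3)])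
      ultimately have "vanish (0 + gbase m) (e * (d m * u n - d n * u m))" using vanish_diff by simp
      then show ?thesis by (rule vanish_of_order[OF R_vanish[OF e(1)] e(2)])
    qed
  qed
qed

end

section \<open>Coefficients and cardinalities\<close>

datatype 'k rterm = RVar 'k | RZero | ROne | RNeg "'k rterm" | RAdd "'k rterm" "'k rterm" | RMul "'k rterm" "'k rterm"

inductive req :: "'k rterm \<Rightarrow> 'k rterm \<Rightarrow> bool" where
  req_refl: "req s s"
| req_sym: "req s t \<Longrightarrow> req t s"
| req_trans: "req s t \<Longrightarrow> req t w \<Longrightarrow> req s w"
| req_neg: "req s t \<Longrightarrow> req (RNeg s) (RNeg t)"
| req_add: "req s s' \<Longrightarrow> req t t' \<Longrightarrow> req (RAdd s t) (RAdd s' t')"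
| req_mul: "req s s' \<Longrightarrow> req t t' \<Longrightarrow> req (RMul s t) (RMul s' t')"
| req_add_assoc: "req (RAdd (RAdd s t) w) (RAdd s (RAdd t w))"
| req_add_comm: "req (RAdd s t) (RAdd t s)"
| req_add_zero: "req (RAdd RZero s) s"
| req_add_neg: "req (RAdd (RNeg s) s) RZero"
| req_mul_assoc: "req (RMul (RMul s t) w) (RMul s (RMul t w))"
| req_mul_comm: "req (RMul s t) (RMul t s)"
| req_mul_one: "req (RMul ROne s) s"
| req_distrib: "req (RMul (RAdd s t) w) (RAdd (RMul s w) (RMul t w))"

quotient_type 'k frc = "'k rterm" / req
  by (intro equivpI reflpI sympI transpI) (auto intro: req_refl req_sym req_trans)

text \<open>Evaluation in the integers with all variables at 0; it separates 0 from 1 in the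
  quotient.\<close>

primrec int_eval :: "'k rterm \<Rightarrow> int" where
  "int_eval (RVar k) = 0"
| "int_eval RZero = 0"
| "int_eval ROne = 1"
| "int_eval (RNeg s) = - int_eval s"
| "int_eval (RAdd s t) = int_eval s + int_eval t"
| "int_eval (RMul s t) = int_eval s * int_eval t"

lemma int_eval_req: "req s t \<Longrightarrow> int_eval s = int_eval t"
  by (induction rule: req.induct) (auto simp: algebra_simps)

instantiation frc :: (type) comm_ring_1
begin

lift_definition zero_frc :: "'a frc" is RZero .
lift_definition one_frc :: "'a frc" is ROne .
lift_definition uminus_frc :: "'a frc \<Rightarrow> 'a frc" is RNeg by (rule req_neg)
lift_definition plus_frc :: "'a frc \<Rightarrow> 'a frc \<Rightarrow> 'a frc" is RAdd by (rule req_add)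
lift_definition times_frc :: "'a frc \<Rightarrow> 'a frc \<Rightarrow> 'a frc" is RMul by (rule req_mul)
lift_definition minus_frc :: "'a frc \<Rightarrow> 'a frc \<Rightarrow> 'a frc" is "\<lambda>s t. RAdd s (RNeg t)"
  by (intro req_add req_neg)

instance
proof
  fix a b c :: "'a frc"
  show "a * b * c = a * (b * c)" by transfer (rule req_mul_assoc)
  show "a * b = b * a" by transfer (rule req_mul_comm)
  show "1 * a = a" by transfer (rule req_mul_one)
  show "a + b + c = a + (b + c)" by transfer (rule req_add_assoc)
  show "a + b = b + a" by transfer (rule req_add_comm)
  show "0 + a = a" by transfer (rule req_add_zero)
  show "- a + a = 0" by transfer (rule req_add_neg)
  show "a - b = a + - b" by transfer (rule req_refl)
  show "(a + b) * c = a * c + b * c" by transfer (rule req_distrib)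
  show "(0 :: 'a frc) \<noteq> 1" by transfer (use int_eval_req in force)
qed

end

lift_definition fvar :: "'k \<Rightarrow> 'k frc" is RVar .

text \<open>Variables outside the carrier are sent to zero, so that every term evaluates into the
  carrier.\<close>

primrec ring_eval :: "('k, 'b) ring_scheme \<Rightarrow> 'k rterm \<Rightarrow> 'k" where
  "ring_eval K (RVar k) = (if k \<in> carrier K then k else \<zero>\<^bsub>K\<^esub>)"
| "ring_eval K RZero = \<zero>\<^bsub>K\<^esub>"
| "ring_eval K ROne = \<one>\<^bsub>K\<^esub>"
| "ring_eval K (RNeg s) = \<ominus>\<^bsub>K\<^esub> ring_eval K s"
| "ring_eval K (RAdd s t) = ring_eval K s \<oplus>\<^bsub>K\<^esub> ring_eval K t"
| "ring_eval K (RMul s t) = ring_eval K s \<otimes>\<^bsub>K\<^esub> ring_eval K t"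

definition frc_eval :: "('k, 'b) ring_scheme \<Rightarrow> 'k frc \<Rightarrow> 'k" where
  "frc_eval K a = ring_eval K (SOME s. abs_frc s = a)"

context cring
begin

lemma ring_eval_closed: "ring_eval R s \<in> carrier R"
  by (induction s) auto

lemma ring_eval_req: "req s t \<Longrightarrow> ring_eval R s = ring_eval R t"
  by (induction rule: req.induct)
    (auto simp: ring_eval_closed a_assoc m_assoc l_neg l_distr intro: a_comm m_comm)

lemma frc_eval_abs: "frc_eval R (abs_frc s) = ring_eval R s"
proof -
  have "abs_frc (SOME t. abs_frc t = abs_frc s) = abs_frc s" by (rule someI[of _ s]) simp
  then show ?thesis unfolding frc_eval_def frc.abs_eq_iff by (rule ring_eval_req)
qed

lemma frc_eval_closed [simp]: "frc_eval R a \<in> carrier R"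
  by (induction a rule: frc.abs_induct) (simp add: frc_eval_abs ring_eval_closed)

lemma frc_eval_0 [simp]: "frc_eval R 0 = \<zero>"
  and frc_eval_1 [simp]: "frc_eval R 1 = \<one>"
  by (simp_all add: zero_frc_def one_frc_def frc_eval_abs)

lemma frc_eval_fvar [simp]: "k \<in> carrier R \<Longrightarrow> frc_eval R (fvar k) = k"
  by (simp add: fvar_def frc_eval_abs)

lemma frc_eval_uminus [simp]: "frc_eval R (- a) = \<ominus> frc_eval R a"
  by (induction a rule: frc.abs_induct) (simp add: frc_eval_abs uminus_frc.abs_eq)

lemma frc_eval_add [simp]: "frc_eval R (a + b) = frc_eval R a \<oplus> frc_eval R b"
  by (induction a rule: frc.abs_induct, induction b rule: frc.abs_induct)
    (simp add: frc_eval_abs plus_frc.abs_eq)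

lemma frc_eval_mult [simp]: "frc_eval R (a * b) = frc_eval R a \<otimes> frc_eval R b"
  by (induction a rule: frc.abs_induct, induction b rule: frc.abs_induct)
    (simp add: frc_eval_abs times_frc.abs_eq)

lemma frc_eval_diff: "frc_eval R (a - b) = frc_eval R a \<ominus> frc_eval R b"
  using frc_eval_add[of a "- b"] by (simp add: a_minus_def)

lemma frc_eval_diff_zero: "frc_eval R (a - b) = \<zero> \<longleftrightarrow> frc_eval R a = frc_eval R b"
  by (simp add: frc_eval_diff r_right_minus_eq)

end

text \<open>The inverse in the field, taken as a variable, is an inverse modulo the kernel.\<close>

lemma (in field) max_ideal_frc: "max_ideal {a. frc_eval R a = \<zero>}"
proof
  fix a assume "a \<notin> {a. frc_eval R a = \<zero>}"
  then have u: "frc_eval R a \<in> Units R" using field_Units by simp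
  then have "frc_eval R (a * fvar (inv (frc_eval R a)) - 1) = \<zero>"
    by (simp add: frc_eval_diff Units_inv_closed Units_r_inv r_right_minus_eq)
  then show "\<exists>b. a * b - 1 \<in> {a. frc_eval R a = \<zero>}" by blast
qed auto

section \<open>Cardinality of the sets of series\<close>

lemma card_nat_set_le_real: "|UNIV :: nat set set| \<le>o |UNIV :: real set|"
  using eqpoll_imp_lepoll[OF nat_sets_eqpoll_reals] unfolding lepoll_def
  by (subst card_of_ordLeq[symmetric]) blast

lemma w1_le_nat_set: "cardSuc natLeq \<le>o |UNIV :: nat set set|"
proof -
  have "|UNIV :: nat set| <o |Pow (UNIV :: nat set)|" by (rule card_of_Pow)
  then have "natLeq <o |UNIV :: nat set set|"
    using card_of_nat ordIso_symmetric ordIso_ordLess_trans by (metis Pow_UNIV)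
  then show ?thesis using cardSuc_least[OF natLeq_Card_order card_of_Card_order] by blast
qed

lemma card_omega1: "|UNIV :: omega1 set| =o cardSuc natLeq"
proof -
  have "bij_betw Rep_omega1 UNIV (Field w1)"
    using type_definition.Rep_range[OF type_definition_omega1] by (simp add: bij_betw_def inj_def Rep_omega1_inject)
  then have "|UNIV :: omega1 set| =o |Field w1|" using card_of_ordIsoI by blast
  then show ?thesis using Field_w1_ordIso ordIso_transitive unfolding w1_def by blast
qed

definition supported :: "'k set \<Rightarrow> 'k \<Rightarrow> omega1 \<Rightarrow> (grp \<Rightarrow> 'k) set" where
  "supported A z n = {h. \<forall>g. h g \<in> A \<and> (g \<notin> gsub n \<longrightarrow> h g = z)}"

text \<open>Such a function is determined by its values on the countable set \<open>gsub n\<close>.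
  Coded as sets of naturals, these countably many values are packed into a single set by
  pairing.\<close>

lemma card_supported:
  assumes "|A| \<le>o |UNIV :: nat set set|"
  shows "|supported A z n| \<le>o |UNIV :: nat set set|"
proof -
  obtain k :: "'a \<Rightarrow> nat set" where k: "inj_on k A"
    using assms card_of_ordLeq[of A "UNIV :: nat set set"] by auto
  define en where "en = from_nat_into (gsub n)"
  have ne: "gsub n \<noteq> {}" using gsub_0 by blast
  define F where "F h = {prod_encode (i, j) |i j. j \<in> k (h (en i))}" for h
  have F: "prod_encode (i, j) \<in> F h \<longleftrightarrow> j \<in> k (h (en i))" for h i j by (auto simp: F_def)
  have "inj_on F (supported A z n)"
  proof (rule inj_onI, rule ext)
    fix h h' g assume h: "h \<in> supported A z n" "h' \<in> supported A z n" "F h = F h'"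
    show "h g = h' g"
    proof (cases "g \<in> gsub n")
      case True
      then obtain i where i: "en i = g" using from_nat_into_surj[OF countable_gsub] unfolding en_def by metis
      have "k (h g) = k (h' g)" using F[of i] h(3) i by blast
      then show ?thesis using k h(1,2) by (auto simp: supported_def inj_on_def)
    next
      case False
      then show ?thesis using h(1,2) by (simp add: supported_def)
    qed
  qed
  then show ?thesis using card_of_ordLeq[of "supported A z n" "UNIV :: nat set set"] by auto
qed

text \<open>Under the Continuum Hypothesis each \<open>supported A z n\<close> has at most as many
  elements as \<open>A\<close>, and so has the union over the \<aleph>1 many
  \<open>n\<close>.\<close>

lemma inj_supported:
  assumes CH and A: "aleph1_card A"
  obtains j :: "(grp \<Rightarrow> 'k) \<Rightarrow> 'k" where "inj_on j (\<Union>n. supported A z n)" "j ` (\<Union>n. supported A z n) \<subseteq> A"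
proof -
  have A1: "|A| =o cardSuc natLeq" using A by (simp add: aleph1_card_def)
  have R1: "|UNIV :: real set| =o cardSuc natLeq" using assms(1) by (simp add: CH_def aleph1_card_def)
  have NA: "|UNIV :: nat set set| \<le>o |A|"
    by (rule ordLeq_ordIso_trans[OF card_nat_set_le_real ordIso_transitive[OF R1 ordIso_symmetric[OF A1]]])
  have AN: "|A| \<le>o |UNIV :: nat set set|"
    using A1 w1_le_nat_set ordIso_ordLeq_trans by blast
  have "infinite A"
    using NA card_of_ordLeq_finite by (metis Finite_Set.finite_set infinite_UNIV_nat)
  moreover have "|UNIV :: omega1 set| \<le>o |A|"
    using card_omega1 A1 ordIso_symmetric ordIso_transitive ordIso_iff_ordLeq by blast
  moreover have "\<forall>n\<in>UNIV. |supported A z n| \<le>o |A|"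
    using card_supported[OF AN] NA ordLeq_transitive by blast
  ultimately have "|\<Union>n. supported A z n| \<le>o |A|"
    by (rule card_of_UNION_ordLeq_infinite)
  then show thesis using that card_of_ordLeq[of "\<Union>n. supported A z n" A] by blast
qed

lemma hseries_support: "x \<in> hseries D \<Longrightarrow> \<exists>n. hsupp x \<subseteq> gsub n"
  unfolding hseries_def mem_Collect_eq by (rule good_bounded)

lemma support_mult:
  assumes "hsupp x \<subseteq> gsub m" "hsupp y \<subseteq> gsub n" shows "hsupp (x * y) \<subseteq> gsub (max m n)"
proof
  fix g assume "g \<in> hsupp (x * y)"
  then obtain a b where "g = a + b" "a \<in> hsupp x" "b \<in> hsupp y" using hsupp_mult_sub by blast
  then show "g \<in> gsub (max m n)"
    using assms gsub_mono[of a m "max m n"] gsub_mono[of b n "max m n"] by (auto intro: gsub_add)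
qed

context coherent_units
begin

lemma u_support: "hsupp (u n) \<subseteq> gsub n"
proof
  fix g assume "g \<in> hsupp (u n)"
  then have nz: "(\<Prod>a | gcoord g a \<noteq> 0. if a < n then c (v n a) else 0) \<noteq> 0"
    by (auto simp: in_hsupp u_def hcoeff_hprod split: if_splits)
  have "a < n" if "gcoord g a \<noteq> 0" for a
  proof (rule ccontr)
    assume "\<not> a < n"
    then have "(\<Prod>a | gcoord g a \<noteq> 0. if a < n then c (v n a) else 0) = 0"
      using \<open>gcoord g a \<noteq> 0\<close> by (intro prod_zero finite_gcoord) auto
    then show False using nz by blast
  qed
  then show "g \<in> gsub n" by (auto simp: gsub_def dest: leD)
qed

text \<open>Modulo nonnegative value an element of \<open>M\<close> is a multiple of one generator,
  whose support is bounded; this is what allows \<open>M\<close> to be coded as well.\<close>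

lemma M_support:
  assumes "x \<in> M"
  shows "\<exists>n. \<forall>g<0. g \<notin> gsub n \<longrightarrow> hcoeff x g \<in> I"
proof -
  obtain n f where f: "f \<in> R" "vanish 0 (x - f * gen n)" using assms by (auto simp: M_def)
  obtain m where m: "hsupp f \<subseteq> gsub m" using hseries_support[OF R_hseries[OF f(1)]] by blast
  obtain k where k: "hsupp (hmono (- gbase n) (1::'a)) \<subseteq> gsub k" using hseries_support hseries_hmono by blast
  have s: "hsupp (f * gen n) \<subseteq> gsub (max m (max k n))"
    unfolding gen_def by (intro support_mult m k u_support)
  have "hcoeff x g \<in> I" if "g < 0" "g \<notin> gsub (max m (max k n))" for g
  proof -
    have "hcoeff (f * gen n) g = 0" using s that(2) in_hsupp by blast
    moreover have "hcoeff (x - f * gen n) g \<in> I" using f(2) that(1) by (simp add: vanish_def)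
    ultimately show ?thesis by simp
  qed
  then show ?thesis by blast
qed

end

section \<open>The theorem\<close>

text \<open>The constant term, evaluated by \<open>e\<close>, is a homomorphism of the valuation
  ring onto \<open>K\<close>. Elements outside its kernel are invertible, so the kernel is
  maximal.\<close>

lemma (in transported) residue_field:
  fixes K :: "('r, 'b) ring_scheme" and e :: "'a \<Rightarrow> 'r"
  assumes K: "ring K"
    and e: "\<And>a b. e (a + b) = e a \<oplus>\<^bsub>K\<^esub> e b" "\<And>a b. e (a * b) = e a \<otimes>\<^bsub>K\<^esub> e b" "e 1 = \<one>\<^bsub>K\<^esub>"
    and ker: "\<And>a b. e a = e b \<longleftrightarrow> a - b \<in> I" and zero: "e 0 = \<zero>\<^bsub>K\<^esub>"
    and onto: "range e = carrier K"
  shows "\<exists>P. maximalideal P (subR Q Rs) \<and> (subR Q Rs) Quot P \<simeq> K"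
proof -
  define h where "h a = e (hcoeff (lift a) 0)" for a
  have h: "h (psi x) = e (hcoeff x 0)" if "x \<in> R" for x
    using lift(2)[OF R_hseries[OF that]] by (simp add: h_def ker null_def)
  have hc: "e a \<in> carrier K" for a using onto by blast
  have lm: "e (hcoeff (x * y) 0) = e (hcoeff x 0) \<otimes>\<^bsub>K\<^esub> e (hcoeff y 0)" if "x \<in> R" "y \<in> R" for x y
    using lead_mult[OF R_vanish[OF that(1)] R_vanish[OF that(2)]]
    by (simp add: ker[symmetric] e(2))
  have ringR: "ring (subR Q Rs)"
    using domain_Rs by (auto simp: domain_def cring_def)
  have hom: "ring_hom_ring (subR Q Rs) K h"
  proof (rule ring_hom_ringI[OF ringR K])
    show "h a \<in> carrier K" for a by (simp add: h_def hc)
    show "h (a \<otimes>\<^bsub>subR Q Rs\<^esub> b) = h a \<otimes>\<^bsub>K\<^esub> h b"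
      if "a \<in> carrier (subR Q Rs)" "b \<in> carrier (subR Q Rs)" for a b
      using that by (auto simp: Rs_iff R_hseries h R_mult lm)
    show "h (a \<oplus>\<^bsub>subR Q Rs\<^esub> b) = h a \<oplus>\<^bsub>K\<^esub> h b"
      if "a \<in> carrier (subR Q Rs)" "b \<in> carrier (subR Q Rs)" for a b
      using that by (auto simp: Rs_iff R_hseries h R_add e)
    show "h \<one>\<^bsub>subR Q Rs\<^esub> = \<one>\<^bsub>K\<^esub>" by (simp add: h hcoeff_1 e)
  qed
  interpret h: ring_hom_ring "subR Q Rs" K h by (rule hom)
  have img: "h ` carrier (subR Q Rs) = carrier K"
  proof
    show "carrier K \<subseteq> h ` carrier (subR Q Rs)"
    proof
      fix k assume "k \<in> carrier K"
      then obtain a where a: "k = e a" using onto by blast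
      have "hmono 0 a \<in> R" by (simp add: R_hmono)
      then have "psi (hmono 0 a) \<in> carrier (subR Q Rs)" "h (psi (hmono 0 a)) = k"
        by (auto simp: Rs_iff h a hcoeff_hmono)
      then show "k \<in> h ` carrier (subR Q Rs)" by blast
    qed
  qed (auto simp: h_def hc)
  let ?P = "a_kernel (subR Q Rs) K h"
  have P: "psi x \<in> ?P \<longleftrightarrow> hcoeff x 0 \<in> I" if "x \<in> R" for x
  proof -
    have "psi x \<in> carrier (subR Q Rs)" using that by (auto simp: Rs_iff)
    then have "psi x \<in> ?P \<longleftrightarrow> h (psi x) = \<zero>\<^bsub>K\<^esub>" unfolding a_kernel_def' by blast
    also have "\<dots> \<longleftrightarrow> hcoeff x 0 - 0 \<in> I" unfolding h[OF that] zero[symmetric] ker ..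
    finally show ?thesis by simp
  qed
  have "maximalideal ?P (subR Q Rs)"
  proof (rule maximalidealI)
    show "ideal ?P (subR Q Rs)" by (rule h.kernel_is_ideal)
    have "psi 1 \<notin> ?P" using P[of 1] by (simp add: hcoeff_1)
    moreover have "psi 1 \<in> carrier (subR Q Rs)" by (auto simp: Rs_iff)
    ultimately show "carrier (subR Q Rs) \<noteq> ?P" by blast
    fix J assume J: "ideal J (subR Q Rs)" "?P \<subseteq> J" "J \<subseteq> carrier (subR Q Rs)"
    show "J = ?P \<or> J = carrier (subR Q Rs)"
    proof (cases "J \<subseteq> ?P")
      case False
      then obtain x where x: "psi x \<in> J" "x \<in> R" "hcoeff x 0 \<notin> I"
        using J(3) P by (force simp: Rs_iff)
      obtain y where y: "y \<in> hseries D" "null (x * y - 1)" "vanish (- 0) y"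
        using hseries_inverse[OF R_hseries[OF x(2)] R_vanish[OF x(2)] x(3)] .
      have yR: "y \<in> R" using y by (simp add: R_def)
      then have "psi y \<in> carrier (subR Q Rs)" by (auto simp: Rs_iff)
      then have "psi x \<otimes>\<^bsub>subR Q Rs\<^esub> psi y \<in> J" by (rule ideal.I_r_closed[OF J(1) x(1)])
      moreover have "psi x \<otimes>\<^bsub>subR Q Rs\<^esub> psi y = psi 1"
        using x(2) y by (simp add: R_hseries psi_eq hseries_mult)
      ultimately have "\<one>\<^bsub>subR Q Rs\<^esub> \<in> J" by simp
      then show ?thesis using ideal.one_imp_carrier[OF J(1)] by simp
    qed (use J(2) in blast)
  qed
  then show ?thesis using h.FactRing_iso[OF img] by blast
qed

lemma aleph1_infinite: "aleph1_card A \<Longrightarrow> infinite A"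
proof
  assume A: "aleph1_card A" "finite A"
  then have "|A| \<le>o natLeq" using card_le_natLeq_iff countable_finite by blast
  moreover have "natLeq <o |A|"
    using A(1) ordIso_symmetric ordLess_ordIso_trans[OF cardSuc_greater[OF natLeq_Card_order]]
    unfolding aleph1_card_def by blast
  ultimately show False using not_ordLess_ordLeq by blast
qed

theorem theorem11:
  fixes K :: "'k ring" and S :: "nat set set"
  assumes "CH"
    and "field K" and "aleph1_card (carrier K)"
    and "w1_stationary S"
  shows "\<exists>(Q :: 'k ring) Rs (r :: nat set \<Rightarrow> 'k).
     is_quotient_field Q Rs \<and> valuation_domain (subR Q Rs) \<and> aleph1_card Rs
     \<and> (\<exists>P. maximalideal P (subR Q Rs) \<and> (subR Q Rs) Quot P \<simeq> K)
     \<and> (\<forall>nu\<in>Field w1. r nu \<in> Rs \<and> r nu \<noteq> \<zero>\<^bsub>Q\<^esub>)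
     \<and> (\<forall>mu nu. mu \<in> Field w1 \<and> nu \<in> Field w1 \<and> w1_less mu nu \<longrightarrow> rdvd (subR Q Rs) (r mu) (r nu))
     \<and> carrier Q = (\<Union>nu\<in>Field w1. (\<lambda>s. inv\<^bsub>Q\<^esub> (r nu) \<otimes>\<^bsub>Q\<^esub> s) ` Rs)
     \<and> w1_equiv (Gamma_set Q Rs r) S
     \<and> (\<exists>U :: ('k, 'k) module. nonstandard_uniserial Q Rs U \<and> has_type_Q_mod_R Q Rs U)"
proof -
  interpret K: field K by (rule assms(2))
  define I where "I = {a. frc_eval K a = \<zero>\<^bsub>K\<^esub>}"
  define D where "D = {d. limit_ord d \<and> Rep_omega1 d \<in> S}"
  have I_iff: "a - b \<in> I \<longleftrightarrow> frc_eval K a = frc_eval K b" for a b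
    by (simp add: I_def K.frc_eval_diff_zero)
  have I_iff0: "a \<in> I \<longleftrightarrow> frc_eval K a = \<zero>\<^bsub>K\<^esub>" for a
    by (simp add: I_def)
  have max: "max_ideal I" unfolding I_def by (rule K.max_ideal_frc)
  obtain v :: "omega1 \<Rightarrow> omega1 \<Rightarrow> nat" where v: "\<And>n k. finite {a. a < n \<and> v n a \<le> k}"
    "\<And>m n. m \<le> n \<Longrightarrow> finite {a. a < m \<and> v m a \<noteq> v n a}"
    using coherent_finite_to_one by blast
  have "infinite (carrier K)"
    using aleph1_infinite[OF assms(3)] .
  then obtain \<kappa> :: "nat \<Rightarrow> 'k" where \<kappa>: "inj \<kappa>" "range \<kappa> \<subseteq> carrier K"
    using infinite_countable_subset by blast
  obtain j where j: "inj_on j (\<Union>n. supported (carrier K) \<zero>\<^bsub>K\<^esub> n)"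
    "j ` (\<Union>n. supported (carrier K) \<zero>\<^bsub>K\<^esub> n) \<subseteq> carrier K"
    by (rule inj_supported[OF assms(1,3), of "\<zero>\<^bsub>K\<^esub>"])
  \<comment> \<open>A variable evaluates to the element it names, so distinct elements of
    \<open>K\<close> give scalars distinct modulo \<open>I\<close>.\<close>
  define c where "c i = fvar (\<kappa> i)" for i
  interpret cu: coherent_units I D v c
  proof (intro coherent_units.intro coherent_units_axioms.intro max v)
    show "i = j" if "c i - c j \<in> I" for i j
    proof -
      have "\<kappa> i \<in> carrier K" for i using \<kappa>(2) by blast
      then have "\<kappa> i = \<kappa> j" using that unfolding I_iff c_def by simp
      then show ?thesis using \<kappa>(1) by (simp add: inj_eq)
    qed
  qed
  define val where "val x g = frc_eval K (hcoeff x g)" for x :: "(grp, 'k frc) hahn" and g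
  \<comment> \<open>Nonnegative exponents are erased because \<open>psiM\<close> has to identify
    series whose difference has nonnegative value.\<close>
  define valM where "valM x g = (if g < 0 then val x g else \<zero>\<^bsub>K\<^esub>)" for x :: "(grp, 'k frc) hahn" and g
  have val: "val x \<in> (\<Union>n. supported (carrier K) \<zero>\<^bsub>K\<^esub> n)" if x: "x \<in> hseries D" for x
  proof -
    obtain n where n: "hsupp x \<subseteq> gsub n" using hseries_support[OF x] by blast
    have "hcoeff x g = 0" if "g \<notin> gsub n" for g using n that in_hsupp by blast
    then have "val x \<in> supported (carrier K) \<zero>\<^bsub>K\<^esub> n" by (simp add: supported_def val_def)
    then show ?thesis by blast
  qed
  have valM: "valM x \<in> (\<Union>n. supported (carrier K) \<zero>\<^bsub>K\<^esub> n)" if x: "x \<in> cu.M" for x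
  proof -
    obtain n where n: "\<forall>g<0. g \<notin> gsub n \<longrightarrow> hcoeff x g \<in> I"
      using cu.M_support[OF x] by blast
    then have "valM x \<in> supported (carrier K) \<zero>\<^bsub>K\<^esub> n"
      by (simp add: supported_def val_def valM_def I_iff0)
    then show ?thesis by blast
  qed
  define psi where "psi x = j (val x)" for x
  define psiM where "psiM x = j (valM x)" for x
  interpret t: transported I D v c psi psiM
  proof
    fix x y :: "(grp, 'k frc) hahn" assume xy: "x \<in> hseries D" "y \<in> hseries D"
    have "psi x = psi y \<longleftrightarrow> val x = val y"
      unfolding psi_def by (rule inj_on_eq_iff[OF j(1) val[OF xy(1)] val[OF xy(2)]])
    also have "\<dots> \<longleftrightarrow> cu.null (x - y)" by (simp add: fun_eq_iff val_def cu.null_def I_iff)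
    finally show "psi x = psi y \<longleftrightarrow> cu.null (x - y)" .
  next
    fix x y :: "(grp, 'k frc) hahn" assume xy: "x \<in> cu.M" "y \<in> cu.M"
    have "psiM x = psiM y \<longleftrightarrow> valM x = valM y"
      unfolding psiM_def by (rule inj_on_eq_iff[OF j(1) valM[OF xy(1)] valM[OF xy(2)]])
    also have "\<dots> \<longleftrightarrow> cu.vanish 0 (x - y)"
      by (auto simp: fun_eq_iff valM_def val_def cu.vanish_def I_iff)
    finally show "psiM x = psiM y \<longleftrightarrow> cu.vanish 0 (x - y)" .
  qed
  have residue: "\<exists>P. maximalideal P (subR t.Q t.Rs) \<and> (subR t.Q t.Rs) Quot P \<simeq> K"
  proof (rule t.residue_field[of K "frc_eval K"])
    show "range (frc_eval K) = carrier K"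
    proof
      show "carrier K \<subseteq> range (frc_eval K)" using K.frc_eval_fvar by (metis rangeI subsetI)
    qed auto
  qed (auto simp: I_iff K.ring_axioms)
  \<comment> \<open>Constant series embed \<open>K\<close> into the ring, and \<open>psi\<close>
    takes its values on admissible series in \<open>carrier K\<close>.\<close>
  have card: "aleph1_card t.Rs"
  proof -
    have "inj_on (\<lambda>k. psi (hmono 0 (fvar k))) (carrier K)"
    proof (rule inj_onI)
      fix k l assume kl: "k \<in> carrier K" "l \<in> carrier K" "psi (hmono 0 (fvar k)) = psi (hmono 0 (fvar l))"
      then have "cu.null (hmono 0 (fvar k) - hmono 0 (fvar l))" by (simp add: t.psi_eq)
      then have "hcoeff (hmono 0 (fvar k) - hmono 0 (fvar l)) (0::grp) \<in> I" by (simp only: cu.null_def)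
      then show "k = l" using kl by (simp add: hcoeff_hmono I_iff)
    qed
    moreover have "(\<lambda>k. psi (hmono 0 (fvar k))) ` carrier K \<subseteq> t.Rs"
      using cu.R_hmono[of 0] by (auto simp: t.Rs_def intro!: imageI)
    ultimately have "|carrier K| \<le>o |t.Rs|" using card_of_ordLeq by blast
    moreover have "t.Rs \<subseteq> carrier K"
    proof
      fix a assume "a \<in> t.Rs"
      then obtain x where x: "x \<in> cu.R" "a = j (val x)" by (auto simp: t.Rs_iff psi_def)
      then show "a \<in> carrier K" using j(2) val[OF cu.R_hseries[OF x(1)]] by blast
    qed
    then have "|t.Rs| \<le>o |carrier K|" by (rule card_of_mono1)
    ultimately have "|t.Rs| =o |carrier K|" by (simp add: ordIso_iff_ordLeq)
    then show ?thesis using assms(3) ordIso_transitive unfolding aleph1_card_def by blast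
  qed
  have U: "nonstandard_uniserial t.Q t.Rs t.U"
    unfolding nonstandard_uniserial_def using t.uniserial_U t.not_standard[OF assms(4) D_def] by blast
  show ?thesis
  proof (rule exI[of _ t.Q], rule exI[of _ t.Rs], rule exI[of _ t.r], intro conjI)
    show "\<forall>nu\<in>Field w1. t.r nu \<in> t.Rs \<and> t.r nu \<noteq> \<zero>\<^bsub>t.Q\<^esub>" using t.r_Rs by blast
    show "\<forall>mu nu. mu \<in> Field w1 \<and> nu \<in> Field w1 \<and> w1_less mu nu \<longrightarrow> rdvd (subR t.Q t.Rs) (t.r mu) (t.r nu)"
      using t.r_dvd by blast
    show "\<exists>U :: ('k, 'k) module. nonstandard_uniserial t.Q t.Rs U \<and> has_type_Q_mod_R t.Q t.Rs U"
      using U t.type_U by blast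
  qed (fact t.quotient_field t.valuation_domain_Rs card residue t.Q_union t.Gamma_equiv[OF D_def])+
qed

end
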